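(* There is an algorithm that, given an instance of the Gas-Capacitated Vehicle Routing Problem (GasCVRP) and $r\in\mathbb N$, decides whether there exists a routing of weight at most $r$ in $f(r)\cdot n^{O(1)}$ steps, for some computable function $f$, where $n=|V(G)|$ is the number of vertices of the input graph.
   Context: All graphs are finite and undirected, and $\mathbb N = \{0,1,2,\dots\}$. A walk in $G$ is a sequence of vertices $(v_1,\dots,v_m)$ with consecutive vertices adjacent; vertices and edges may be repeated. It is closed if $v_1 = v_m$. The weight of a walk is $w(p)=\sum_{i=1}^{m-1} w(v_i,v_{i+1})$. GasCVRP: An instance contains a graph $G$ with edge weights $w\colon E(G)\to\mathbb N$ (weight zero is allowed), a nonempty set of depots $D\subseteq V(G)$, a set of clients $C\subseteq V(G)$, a number of vehicles $k\in\mathbb N$, and a gas capacity $g\in\mathbb N$. A routing is a set of $k'$ walks $R=\{p_1,\dots,p_{k'}\}$ (one walk per vehicle) together with an assignment $A\colon C\to[k']$ such that $k'\le k$, every walk starts at a vertex of $D$, every client $c\in C$ is a vertex of $p_{A(c)}$, every walk in $R$ is closed, and $w(p)\le g$ for every $p\in R$. Its weight is $w(R)=\sum_{p\in R}w(p)$. *)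

theory Defs
  imports "Graph_Theory.Graph_Theory"
begin

section \<open>The gas-capacitated vehicle routing problem\<close>

text \<open>
  Undirected graphs are symmetric loop-free pair digraphs (\<^locale>\<open>pair_graph\<close>), so an edge
  $uv$ appears as the two arcs $(u,v)$ and $(v,u)$, which must carry the same weight.  Values of
  \<open>weight\<close> outside the arc set are irrelevant: they influence neither routings nor encodings.
\<close>

record 'a gas_cvrp =
  network :: "'a pair_pre_digraph"
  weight :: "'a \<times> 'a \<Rightarrow> nat"
  depots :: "'a set"
  clients :: "'a set"
  vehicles :: nat
  gas :: nat

definition gas_cvrp_instance :: "'a gas_cvrp \<Rightarrow> bool" where
  "gas_cvrp_instance I \<longleftrightarrow>
     pair_graph (network I) \<and>
     (\<forall>(u, v) \<in> parcs (network I). weight I (u, v) = weight I (v, u)) \<and>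
     depots I \<noteq> {} \<and> depots I \<subseteq> pverts (network I) \<and>
     clients I \<subseteq> pverts (network I)"

definition walk_weight :: "'a gas_cvrp \<Rightarrow> 'a vwalk \<Rightarrow> nat" where
  "walk_weight I p = sum_list (map (weight I) (vwalk_arcs p))"

text \<open>
  The list \<open>R\<close> holds one walk per vehicle in use, numbered from 0; only the values of the
  assignment \<open>A\<close> on clients matter.
\<close>

definition routing :: "'a gas_cvrp \<Rightarrow> 'a vwalk list \<Rightarrow> ('a \<Rightarrow> nat) \<Rightarrow> bool" where
  "routing I R A \<longleftrightarrow>
     length R \<le> vehicles I \<and>
     (\<forall>p \<in> set R. vwalk p (with_proj (network I)) \<and> hd p \<in> depots I \<and> hd p = last p \<and>
        walk_weight I p \<le> gas I) \<and>
     (\<forall>c \<in> clients I. A c < length R \<and> c \<in> set (R ! A c))"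

definition routing_weight :: "'a gas_cvrp \<Rightarrow> 'a vwalk list \<Rightarrow> nat" where
  "routing_weight I R = sum_list (map (walk_weight I) R)"


section \<open>Random access machines\<close>

text \<open>
  A unit-cost RAM with structured control flow.  A program uses finitely many registers, addressed
  directly, and an unbounded memory, addressed through registers; every cell holds a natural number.
  Multiplication is deliberately not an instruction: with addition and truncated
  subtraction as the only arithmetic, $t$ steps lengthen numbers by at most $O(t)$ bits,
  so that unit cost is polynomially related to bit cost.
\<close>

datatype ram =
    Const nat nat       \<comment> \<open>\<open>R i := c\<close>\<close>
  | Add nat nat nat     \<comment> \<open>\<open>R i := R j + R k\<close>\<close>
  | Sub nat nat nat     \<comment> \<open>\<open>R i := R j - R k\<close>, truncated at 0\<close>
  | Load nat nat        \<comment> \<open>\<open>R i := M (R j)\<close>\<close>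
  | Store nat nat       \<comment> \<open>\<open>M (R i) := R j\<close>\<close>
  | Seq ram ram
  | IfNZ nat ram ram    \<comment> \<open>if \<open>R i \<noteq> 0\<close>\<close>
  | WhileNZ nat ram     \<comment> \<open>while \<open>R i \<noteq> 0\<close>\<close>

type_synonym ram_state = "(nat \<Rightarrow> nat) \<times> (nat \<Rightarrow> nat)"

text \<open>
  \<open>exec P s t s'\<close>: started in \<open>s\<close>, the program \<open>P\<close> halts in \<open>s'\<close> after exactly \<open>t\<close> steps, where
  every instruction and every evaluation of a branching or loop condition is one step.
\<close>

inductive exec :: "ram \<Rightarrow> ram_state \<Rightarrow> nat \<Rightarrow> ram_state \<Rightarrow> bool" where
  Const: "exec (Const i c) (R, M) 1 (R(i := c), M)"
| Add: "exec (Add i j k) (R, M) 1 (R(i := R j + R k), M)"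
| Sub: "exec (Sub i j k) (R, M) 1 (R(i := R j - R k), M)"
| Load: "exec (Load i j) (R, M) 1 (R(i := M (R j)), M)"
| Store: "exec (Store i j) (R, M) 1 (R, M(R i := R j))"
| Seq: "exec P s t s' \<Longrightarrow> exec Q s' u s'' \<Longrightarrow> exec (Seq P Q) s (t + u) s''"
| IfTrue: "fst s i \<noteq> 0 \<Longrightarrow> exec P s t s' \<Longrightarrow> exec (IfNZ i P Q) s (Suc t) s'"
| IfFalse: "fst s i = 0 \<Longrightarrow> exec Q s t s' \<Longrightarrow> exec (IfNZ i P Q) s (Suc t) s'"
| WhileFalse: "fst s i = 0 \<Longrightarrow> exec (WhileNZ i P) s 1 s"
| WhileTrue: "fst s i \<noteq> 0 \<Longrightarrow> exec P s t s' \<Longrightarrow> exec (WhileNZ i P) s' u s'' \<Longrightarrow>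
    exec (WhileNZ i P) s (Suc (t + u)) s''"

inductive_simps exec_instr_simps:
  "exec (Const i c) (R, M) t s'" "exec (Add i j k) (R, M) t s'" "exec (Sub i j k) (R, M) t s'"
  "exec (Load i j) (R, M) t s'" "exec (Store i j) (R, M) t s'"
inductive_cases SeqE: "exec (Seq P Q) s t s'"
inductive_cases IfE: "exec (IfNZ i P Q) s t s'"
inductive_cases WhileE: "exec (WhileNZ i P) s t s'"

lemma exec_deterministic:
  "exec P s t s' \<Longrightarrow> exec P s u s'' \<Longrightarrow> u = t \<and> s'' = s'"
proof (induction arbitrary: u s'' rule: exec.induct)
  case (Seq P s t s' Q v s3)
  from Seq.prems obtain t1 t2 s1 where
    "u = t1 + t2" "exec P s t1 s1" "exec Q s1 t2 s''"
    by (rule SeqE)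
  with Seq.IH show ?case by metis
next
  case (IfTrue s i P t s' Q)
  from IfTrue.prems show ?case by (rule IfE) (use IfTrue.hyps(1) IfTrue.IH in auto)
next
  case (IfFalse s i Q t s' P)
  from IfFalse.prems show ?case by (rule IfE) (use IfFalse.hyps(1) IfFalse.IH in auto)
next
  case (WhileFalse s i P)
  from WhileFalse.prems show ?case by (rule WhileE) (use WhileFalse.hyps in auto)
next
  case (WhileTrue s i P t s' v s3)
  from WhileTrue.prems show ?case
  proof (rule WhileE)
    fix t1 t2 s1
    assume "u = Suc (t1 + t2)" "exec P s t1 s1" "exec (WhileNZ i P) s1 t2 s''"
    with WhileTrue.IH show ?thesis by metis
  qed (use WhileTrue.hyps(1) in simp)
qed (simp_all add: exec_instr_simps)

text \<open>
  The input is written to the memory cells \<open>0, 1, 2, \<dots>\<close>, one number per cell, all else being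
  0; the output is read from register 0.
\<close>

definition input_state :: "nat list \<Rightarrow> ram_state" where
  "input_state xs = (\<lambda>_. 0, \<lambda>a. if a < length xs then xs ! a else 0)"

definition run :: "ram \<Rightarrow> nat list \<Rightarrow> nat \<Rightarrow> nat \<Rightarrow> bool" where
  "run P xs t y \<longleftrightarrow> (\<exists>R M. exec P (input_state xs) t (R, M) \<and> R 0 = y)"

definition computable :: "(nat \<Rightarrow> nat) \<Rightarrow> bool" where
  "computable f \<longleftrightarrow> (\<exists>P. \<forall>x. \<exists>t. run P [x] t (f x))"

text \<open>
  The encoding refers to an enumeration \<open>vs\<close> of the vertices and consists of a header, the
  indicator vectors of depots and clients, and the weighted adjacency matrix by rows.
  Since zero is a legitimate weight, an edge of weight $w$ is written as $w+1$ and a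
  non-edge as 0.
\<close>

definition encode :: "'a list \<Rightarrow> 'a gas_cvrp \<Rightarrow> nat \<Rightarrow> nat list" where
  "encode vs I r =
     [length vs, vehicles I, gas I, r] @
     map (\<lambda>v. of_bool (v \<in> depots I)) vs @
     map (\<lambda>v. of_bool (v \<in> clients I)) vs @
     [if (u, v) \<in> parcs (network I) then Suc (weight I (u, v)) else 0. u \<leftarrow> vs, v \<leftarrow> vs]"

end

theory Submission
  imports Defs
begin

text \<open>
  Vertices joined by edges of weight zero can be visited together for free, so only the components
  of the zero-weight subgraph that contain clients matter; each is represented by a target vertex.
  A walk of weight zero serves a single component, and only one that contains a depot.  The at most
  \<open>r\<close> walks of positive weight visit at most \<open>2 r\<close> target components.  Hence a routing of weight at
  most \<open>r\<close> exists iff some \<open>j\<close> walks of total weight at most \<open>r\<close> collect a set \<open>X\<close> of targets that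
  contains all targets without a depot in their component, and \<open>j\<close> plus the number of targets
  outside \<open>X\<close> is at most the number of vehicles.

  Maximising the number of distinct targets is done by colour coding.  At most \<open>q = 2 r\<close> vertices
  are told apart by at most \<open>q\<close> bit positions of their indices, so a mask below \<open>2 n\<close> together with
  a table from the \<open>2\<^sup>q\<close> bit patterns to \<open>{0..q}\<close> colours the \<open>i\<close>-th collected target by \<open>i\<close>.  Given
  the colouring, a search only has to remember how many targets it has collected, which leaves a
  reachability problem on a graph with $f(r) \cdot n^{O(1)}$ states.
\<close>

section \<open>Compiling bounded loop programs\<close>

text \<open>The number of vehicles, the gas capacity and the number of clients are not bounded in
  terms of \<open>r\<close>. Vehicles and gas enter only through comparisons, but storing a
  collected set of up to 2 r targets would cost about n^(2 r) states; the colouring replaces that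
  set by a counter. Counting is enough because of an exchange: a target collected by a walk of
  positive weight saves one free walk, hence one vehicle. The factor 2 arises because a walk of
  weight x meets at most x + 1 target components, and x + 1 \<le> 2 x for positive x. Colourings are
  not enumerated in an outer loop. One is guessed in the start state and carried along, so a single
  reachability computation on W^9 states treats all of them, W being a common bound on the nine
  components of a state. The machine cannot multiply, and f must be computable. Therefore W is n
  times a triple exponential in \<open>r\<close>, obtained by repeated doubling, and all constants
  and powers in the running time are absorbed by shifting the argument of that exponential. Every
  loop of the main program has the same number B of rounds, so its time is a polynomial in B of
  fixed degree.\<close>

definition runs :: "ram \<Rightarrow> ram_state \<Rightarrow> nat \<Rightarrow> ram_state \<Rightarrow> bool" where
  "runs P s T s' \<longleftrightarrow> (\<exists>t\<le>T. exec P s t s')"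

lemma runs_mono: "runs P s T s' \<Longrightarrow> T \<le> U \<Longrightarrow> runs P s U s'"
  unfolding runs_def by (meson le_trans)

lemma runs_instr:
  "runs (Const i c) (R, M) 1 (R(i := c), M)"
  "runs (Add i j k) (R, M) 1 (R(i := R j + R k), M)"
  "runs (Sub i j k) (R, M) 1 (R(i := R j - R k), M)"
  "runs (Load i j) (R, M) 1 (R(i := M (R j)), M)"
  "runs (Store i j) (R, M) 1 (R, M(R i := R j))"
  unfolding runs_def by (blast intro: exec.intros)+

lemma runs_Seq: "runs P s T s' \<Longrightarrow> runs Q s' U s'' \<Longrightarrow> runs (Seq P Q) s (T + U) s''"
  unfolding runs_def by (meson add_mono exec.Seq)

text \<open>\<open>runs\<close> keeps only an upper bound on the steps, so both branches can share
  one. It is the sum of their bounds, which avoids maxima in the time functions.\<close>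

lemma runs_If:
  "(fst s i \<noteq> 0 \<Longrightarrow> runs P s T s') \<Longrightarrow> (fst s i = 0 \<Longrightarrow> runs Q s U s') \<Longrightarrow>
    runs (IfNZ i P Q) s (Suc (T + U)) s'"
proof (cases "fst s i = 0")
  case True
  assume "fst s i = 0 \<Longrightarrow> runs Q s U s'"
  then obtain t where "t \<le> U" "exec Q s t s'" using True by (auto simp: runs_def)
  then show ?thesis using exec.IfFalse[OF True] unfolding runs_def
    by (metis (no_types) Suc_le_mono le_add2 order_trans)
next
  case False
  assume "fst s i \<noteq> 0 \<Longrightarrow> runs P s T s'"
  then obtain t where "t \<le> T" "exec P s t s'" using False by (auto simp: runs_def)
  then show ?thesis using exec.IfTrue[OF False] unfolding runs_def
    by (metis (no_types) Suc_le_mono le_add1 order_trans)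
qed

text \<open>The invariant is indexed by the number of completed rounds. A round costs the body and
  one test; the final 1 is the test that fails.\<close>

lemma runs_While:
  assumes "\<And>j s. j < n \<Longrightarrow> Inv j s \<Longrightarrow>
      fst s i \<noteq> 0 \<and> (\<exists>s'. runs P s T s' \<and> Inv (Suc j) s')"
    and "\<And>s. Inv n s \<Longrightarrow> fst s i = 0"
    and "Inv 0 s"
  shows "\<exists>s'. runs (WhileNZ i P) s (n * Suc T + 1) s' \<and> Inv n s'"
proof -
  have "\<exists>s'. runs (WhileNZ i P) s ((n - j) * Suc T + 1) s' \<and> Inv n s'"
    if "j \<le> n" "Inv j s" for j s
    using that
  proof (induction "n - j" arbitrary: j s)
    case 0
    then have "fst s i = 0" "j = n" using assms(2) by auto
    then show ?case using 0 exec.WhileFalse[of s i P] by (intro exI[of _ s]) (auto simp: runs_def)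
  next
    case (Suc m)
    then have j: "j < n" "n - j = Suc (n - Suc j)" by auto
    from assms(1)[OF j(1)] Suc.prems obtain s' where
      s': "fst s i \<noteq> 0" "runs P s T s'" "Inv (Suc j) s'" by blast
    from Suc.hyps(1)[of "Suc j" s'] Suc.hyps(2) j s' obtain s'' where
      s'': "runs (WhileNZ i P) s' ((n - Suc j) * Suc T + 1) s''" "Inv n s''" by auto
    from s'(2) s''(1) obtain t u where
      tu: "exec P s t s'" "t \<le> T" "exec (WhileNZ i P) s' u s''" "u \<le> (n - Suc j) * Suc T + 1"
      unfolding runs_def by blast
    have "exec (WhileNZ i P) s (Suc (t + u)) s''"
      by (rule exec.WhileTrue) (use s'(1) tu in auto)
    moreover have "Suc (t + u) \<le> (n - j) * Suc T + 1" using tu j by simp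
    ultimately show ?case using s''(2) unfolding runs_def by blast
  qed
  from this[of 0 s] assms(3) show ?thesis by simp
qed

definition move :: "nat \<Rightarrow> nat \<Rightarrow> ram" where
  "move i j = Seq (Const i 0) (Add i j i)"

lemma runs_move: "i \<noteq> j \<Longrightarrow> runs (move i j) (R, M) 2 (R(i := R j), M)"
  using runs_Seq[OF runs_instr(1)[of i 0 R M] runs_instr(2)[of i j i "R(i := 0)" M]]
  by (simp add: move_def numeral_2_eq_2)

section \<open>A language of loops with a common bound, and its compilation\<close>

datatype expr =
    V nat
  | C nat
  | Bound
  | Mem expr
  | Plus expr expr
  | Minus expr expr
  | Cond expr expr expr
  | Iter nat nat expr expr

primrec ev :: "nat \<Rightarrow> expr \<Rightarrow> (nat \<Rightarrow> nat) \<Rightarrow> (nat \<Rightarrow> nat) \<Rightarrow> nat" where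
  "ev B (V x) \<rho> M = \<rho> x"
| "ev B (C c) \<rho> M = c"
| "ev B Bound \<rho> M = B"
| "ev B (Mem e) \<rho> M = M (ev B e \<rho> M)"
| "ev B (Plus e f) \<rho> M = ev B e \<rho> M + ev B f \<rho> M"
| "ev B (Minus e f) \<rho> M = ev B e \<rho> M - ev B f \<rho> M"
| "ev B (Cond e f g) \<rho> M = (if ev B e \<rho> M \<noteq> 0 then ev B f \<rho> M else ev B g \<rho> M)"
| "ev B (Iter a i e f) \<rho> M =
     fold (\<lambda>j x. ev B f (\<rho>(a := x, i := j)) M) [0..<B] (ev B e \<rho> M)"

datatype cmd =
    Put expr expr
  | Then cmd cmd
  | For nat cmd

primrec sem :: "nat \<Rightarrow> cmd \<Rightarrow> (nat \<Rightarrow> nat) \<Rightarrow> (nat \<Rightarrow> nat) \<Rightarrow> nat \<Rightarrow> nat" where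
  "sem B (Put e f) \<rho> M = M(ev B e \<rho> M := ev B f \<rho> M)"
| "sem B (Then p q) \<rho> M = sem B q \<rho> (sem B p \<rho> M)"
| "sem B (For i p) \<rho> M = fold (\<lambda>j. sem B p (\<rho>(i := j))) [0..<B] M"

text \<open>
  Register 0 holds the common bound \<open>B\<close> of all loops, the other even registers form a stack of
  temporaries, and the odd ones hold the variables.  \<open>Iter\<close> and \<open>For\<close> save and restore the
  variables they bind, so that evaluation has no effect on the environment \<open>\<rho>\<close>.
\<close>

definition vr :: "nat \<Rightarrow> nat" where "vr x = 2 * x + 1"
definition tr :: "nat \<Rightarrow> nat" where "tr d = 2 * d + 2"

lemma reg_simps [simp]:
  "vr x = vr y \<longleftrightarrow> x = y" "tr d = tr d' \<longleftrightarrow> d = d'" "vr x \<noteq> tr d" "tr d \<noteq> vr x"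
  "vr x \<noteq> 0" "tr d \<noteq> 0" "0 < vr x" "0 < tr d"
  by (simp_all add: vr_def tr_def) presburger+

text \<open>\<open>tr d\<close> counts upwards and \<open>tr (d + 1)\<close> holds the number of
  remaining rounds, which is the loop condition. The latter is recomputed after every round, so the
  body may overwrite it; in between it holds the increment 1.\<close>

definition for_loop :: "nat \<Rightarrow> ram \<Rightarrow> ram" where
  "for_loop d P =
     Seq (Const (tr d) 0) (Seq (Sub (tr (d + 1)) 0 (tr d))
       (WhileNZ (tr (d + 1)) (Seq P (Seq (Const (tr (d + 1)) 1)
         (Seq (Add (tr d) (tr d) (tr (d + 1))) (Sub (tr (d + 1)) 0 (tr d)))))))"

text \<open>The result goes to \<open>tr d\<close>, and temporaries below \<open>d\<close> stay
  untouched. For \<open>Iter\<close>, positions \<open>d\<close> and \<open>d + 1\<close> save the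
  two variables, \<open>d + 2\<close> is the accumulator and \<open>d + 3\<close> the counter. The
  body may be compiled at \<open>d + 4\<close>, the register of remaining rounds, because
  \<open>for_loop\<close> restores it.\<close>

primrec comp_expr :: "nat \<Rightarrow> expr \<Rightarrow> ram" where
  "comp_expr d (V x) = move (tr d) (vr x)"
| "comp_expr d (C c) = Const (tr d) c"
| "comp_expr d Bound = move (tr d) 0"
| "comp_expr d (Mem e) = Seq (comp_expr d e) (Load (tr d) (tr d))"
| "comp_expr d (Plus e f) =
     Seq (comp_expr d e) (Seq (comp_expr (d + 1) f) (Add (tr d) (tr d) (tr (d + 1))))"
| "comp_expr d (Minus e f) =
     Seq (comp_expr d e) (Seq (comp_expr (d + 1) f) (Sub (tr d) (tr d) (tr (d + 1))))"
| "comp_expr d (Cond e f g) = Seq (comp_expr d e) (IfNZ (tr d) (comp_expr d f) (comp_expr d g))"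
| "comp_expr d (Iter a i e f) =
     Seq (move (tr d) (vr a)) (Seq (move (tr (d + 1)) (vr i)) (Seq (comp_expr (d + 2) e)
       (Seq (for_loop (d + 3) (Seq (move (vr a) (tr (d + 2))) (Seq (move (vr i) (tr (d + 3)))
          (Seq (comp_expr (d + 4) f) (move (tr (d + 2)) (tr (d + 4)))))))
       (Seq (move (vr i) (tr (d + 1))) (Seq (move (vr a) (tr d)) (move (tr d) (tr (d + 2))))))))"

primrec comp_cmd :: "nat \<Rightarrow> cmd \<Rightarrow> ram" where
  "comp_cmd d (Put e f) =
     Seq (comp_expr d e) (Seq (comp_expr (d + 1) f) (Store (tr d) (tr (d + 1))))"
| "comp_cmd d (Then p q) = Seq (comp_cmd d p) (comp_cmd d q)"
| "comp_cmd d (For i p) =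
     Seq (move (tr d) (vr i))
       (Seq (for_loop (d + 1) (Seq (move (vr i) (tr (d + 1))) (comp_cmd (d + 2) p)))
         (move (vr i) (tr d)))"

text \<open>The 10 is three moves of two steps and four steps of loop control per round; the 13 is
  five moves and three steps around the loop.\<close>

primrec time_expr :: "nat \<Rightarrow> expr \<Rightarrow> nat" where
  "time_expr B (V x) = 2"
| "time_expr B (C c) = 1"
| "time_expr B Bound = 2"
| "time_expr B (Mem e) = time_expr B e + 1"
| "time_expr B (Plus e f) = time_expr B e + time_expr B f + 1"
| "time_expr B (Minus e f) = time_expr B e + time_expr B f + 1"
| "time_expr B (Cond e f g) = time_expr B e + time_expr B f + time_expr B g + 1"
| "time_expr B (Iter a i e f) = time_expr B e + B * (time_expr B f + 10) + 13"

primrec time_cmd :: "nat \<Rightarrow> cmd \<Rightarrow> nat" where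
  "time_cmd B (Put e f) = time_expr B e + time_expr B f + 1"
| "time_cmd B (Then p q) = time_cmd B p + time_cmd B q"
| "time_cmd B (For i p) = B * (time_cmd B p + 6) + 7"

lemma runs_for_loop:
  assumes body: "\<And>j R M. j < B \<Longrightarrow> Inv j R M \<Longrightarrow> R 0 = B \<Longrightarrow> R (tr d) = j \<Longrightarrow>
      \<exists>R' M'. runs P (R, M) T (R', M') \<and> Inv (Suc j) R' M' \<and> R' 0 = B \<and> R' (tr d) = j"
    and upd: "\<And>j R M x y. Inv j R M \<Longrightarrow> Inv j (R(tr d := x, tr (d + 1) := y)) M"
    and init: "Inv 0 R M" "R 0 = B"
  shows "\<exists>R' M'. runs (for_loop d P) (R, M) (B * (T + 4) + 3) (R', M') \<and> Inv B R' M' \<and> R' 0 = B"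
proof -
  let ?t = "tr d" and ?u = "tr (d + 1)"
  let ?I = "\<lambda>j s. Inv j (fst s) (snd s) \<and> fst s 0 = B \<and> fst s ?t = j \<and> fst s ?u = B - j"
  let ?body = "Seq P (Seq (Const ?u 1) (Seq (Add ?t ?t ?u) (Sub ?u 0 ?t)))"
  let ?R = "R(?t := 0, ?u := B)"
  have "\<exists>s'. runs (WhileNZ ?u ?body) (?R, M) (B * Suc (T + 3) + 1) s' \<and> ?I B s'"
  proof (rule runs_While[where Inv = ?I])
    fix j s assume j: "j < B" and s: "?I j s"
    obtain R0 M0 where [simp]: "s = (R0, M0)" by (cases s)
    have "Inv j R0 M0" "R0 0 = B" "R0 ?t = j" using s by auto
    from body[OF j this] obtain R' M' where R':
      "runs P (R0, M0) T (R', M')" "Inv (Suc j) R' M'" "R' 0 = B" "R' ?t = j" by blast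
    let ?R' = "R'(?t := Suc j, ?u := B - Suc j)"
    have "runs ?body (R0, M0) (T + (1 + (1 + 1))) (?R', M')"
    proof (intro runs_Seq[OF R'(1)])
      show "runs (Seq (Const ?u 1) (Seq (Add ?t ?t ?u) (Sub ?u 0 ?t))) (R', M') (1 + (1 + 1)) (?R', M')"
        using runs_instr(1)[of ?u 1 R' M'] runs_instr(2)[of ?t ?t ?u "R'(?u := 1)" M']
          runs_instr(3)[of ?u 0 ?t "R'(?u := 1, ?t := Suc j)" M'] R'(3,4)
        by (intro runs_Seq) (auto simp: fun_upd_twist)
    qed
    moreover have "?I (Suc j) (?R', M')" using upd[OF R'(2)] R'(3) by simp
    ultimately show "fst s ?u \<noteq> 0 \<and> (\<exists>s'. runs ?body s (T + 3) s' \<and> ?I (Suc j) s')"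
      using s j by (intro conjI exI[where x = "(?R', M')"]) (simp_all add: numeral_3_eq_3)
  next
    show "?I 0 (?R, M)" using upd[OF init(1)] init(2) by simp
  qed simp
  then obtain s' where s': "runs (WhileNZ ?u ?body) (?R, M) (B * Suc (T + 3) + 1) s'" "?I B s'"
    by blast
  have "runs (for_loop d P) (R, M) (1 + (1 + (B * Suc (T + 3) + 1))) s'"
    unfolding for_loop_def
    by (rule runs_Seq[OF runs_instr(1)], rule runs_Seq[OF runs_instr(3)])
      (use s'(1) init(2) in simp)
  moreover have "1 + (1 + (B * Suc (T + 3) + 1)) = B * (T + 4) + 3" by simp
  ultimately have "runs (for_loop d P) (R, M) (B * (T + 4) + 3) (fst s', snd s')" by (metis prod.collapse)
  then show ?thesis using s'(2) by blast
qed

definition same :: "nat \<Rightarrow> (nat \<Rightarrow> nat) \<Rightarrow> (nat \<Rightarrow> nat) \<Rightarrow> bool" where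
  "same d R R' \<longleftrightarrow> R' 0 = R 0 \<and> (\<forall>x. R' (vr x) = R (vr x)) \<and> (\<forall>k<d. R' (tr k) = R (tr k))"

lemma runs_comp_expr:
  "\<exists>R'. runs (comp_expr d e) (R, M) (time_expr (R 0) e) (R', M) \<and> same d R R' \<and>
     R' (tr d) = ev (R 0) e (\<lambda>x. R (vr x)) M"
proof (induction e arbitrary: d R)
  case (V x)
  show ?case using runs_move[of "tr d" "vr x" R M] by (auto simp: same_def)
next
  case (C x)
  show ?case using runs_instr(1)[of "tr d" x R M] by (auto simp: same_def)
next
  case Bound
  show ?case using runs_move[of "tr d" 0 R M] by (auto simp: same_def)
next
  case (Mem e)
  obtain R' where R': "runs (comp_expr d e) (R, M) (time_expr (R 0) e) (R', M)" "same d R R'"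
    "R' (tr d) = ev (R 0) e (\<lambda>x. R (vr x)) M" using Mem by blast
  show ?case using runs_Seq[OF R'(1) runs_instr(4)[of "tr d" "tr d"]] R'(2,3)
    by (intro exI[of _ "R'(tr d := M (R' (tr d)))"]) (auto simp: same_def fun_upd_def)
next
  case (Plus e f)
  obtain R1 where R1: "runs (comp_expr d e) (R, M) (time_expr (R 0) e) (R1, M)" "same d R R1"
    "R1 (tr d) = ev (R 0) e (\<lambda>x. R (vr x)) M" using Plus.IH(1) by blast
  obtain R2 where R2: "runs (comp_expr (d + 1) f) (R1, M) (time_expr (R 0) f) (R2, M)"
    "same (d + 1) R1 R2" "R2 (tr (d + 1)) = ev (R 0) f (\<lambda>x. R (vr x)) M"
    using Plus.IH(2)[of "d + 1" R1] R1(2) by (auto simp: same_def)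
  let ?R' = "R2(tr d := R2 (tr d) + R2 (tr (d + 1)))"
  have v: "R2 (tr d) = ev (R 0) e (\<lambda>x. R (vr x)) M"
    using R1(3) R2(2) by (simp add: same_def)
  have "runs (comp_expr d (Plus e f)) (R, M) (time_expr (R 0) (Plus e f)) (?R', M)"
    using runs_Seq[OF R1(1) runs_Seq[OF R2(1) runs_instr(2)[of "tr d" "tr d" "tr (d + 1)"]]]
    by (simp add: add.assoc)
  moreover have "same d R ?R'" using R1(2) R2(2) by (auto simp: same_def)
  moreover have "?R' (tr d) = ev (R 0) (Plus e f) (\<lambda>x. R (vr x)) M" using v R2(3) by simp
  ultimately show ?case by blast
next
  case (Minus e f)
  obtain R1 where R1: "runs (comp_expr d e) (R, M) (time_expr (R 0) e) (R1, M)" "same d R R1"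
    "R1 (tr d) = ev (R 0) e (\<lambda>x. R (vr x)) M" using Minus.IH(1) by blast
  obtain R2 where R2: "runs (comp_expr (d + 1) f) (R1, M) (time_expr (R 0) f) (R2, M)"
    "same (d + 1) R1 R2" "R2 (tr (d + 1)) = ev (R 0) f (\<lambda>x. R (vr x)) M"
    using Minus.IH(2)[of "d + 1" R1] R1(2) by (auto simp: same_def)
  let ?R' = "R2(tr d := R2 (tr d) - R2 (tr (d + 1)))"
  have v: "R2 (tr d) = ev (R 0) e (\<lambda>x. R (vr x)) M"
    using R1(3) R2(2) by (simp add: same_def)
  have "runs (comp_expr d (Minus e f)) (R, M) (time_expr (R 0) (Minus e f)) (?R', M)"
    using runs_Seq[OF R1(1) runs_Seq[OF R2(1) runs_instr(3)[of "tr d" "tr d" "tr (d + 1)"]]]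
    by (simp add: add.assoc)
  moreover have "same d R ?R'" using R1(2) R2(2) by (auto simp: same_def)
  moreover have "?R' (tr d) = ev (R 0) (Minus e f) (\<lambda>x. R (vr x)) M" using v R2(3) by simp
  ultimately show ?case by blast
next
  case (Cond e f g)
  obtain R1 where R1: "runs (comp_expr d e) (R, M) (time_expr (R 0) e) (R1, M)" "same d R R1"
    "R1 (tr d) = ev (R 0) e (\<lambda>x. R (vr x)) M" using Cond.IH(1) by blast
  obtain R2 where R2: "runs (comp_expr d f) (R1, M) (time_expr (R 0) f) (R2, M)"
    "same d R1 R2" "R2 (tr d) = ev (R 0) f (\<lambda>x. R (vr x)) M"
    using Cond.IH(2)[of d R1] R1(2) by (auto simp: same_def)
  obtain R3 where R3: "runs (comp_expr d g) (R1, M) (time_expr (R 0) g) (R3, M)"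
    "same d R1 R3" "R3 (tr d) = ev (R 0) g (\<lambda>x. R (vr x)) M"
    using Cond.IH(3)[of d R1] R1(2) by (auto simp: same_def)
  let ?R' = "if R1 (tr d) \<noteq> 0 then R2 else R3"
  have "runs (IfNZ (tr d) (comp_expr d f) (comp_expr d g)) (R1, M)
      (Suc (time_expr (R 0) f + time_expr (R 0) g)) (?R', M)"
    by (rule runs_If) (use R2(1) R3(1) in auto)
  from runs_Seq[OF R1(1) this] show ?case
    using R1(2,3) R2(2,3) R3(2,3) by (intro exI[of _ ?R']) (auto simp: same_def add.assoc fun_upd_def)
next
  case (Iter a i e f)
  let ?B = "R 0" and ?\<rho> = "\<lambda>x. R (vr x)"
  let ?v = "\<lambda>j. fold (\<lambda>j x. ev ?B f (?\<rho>(a := x, i := j)) M) [0..<j] (ev ?B e ?\<rho> M)"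
  let ?R1 = "R(tr d := R (vr a), tr (d + 1) := R (vr i))"
  obtain R2 where R2: "runs (comp_expr (d + 2) e) (?R1, M) (time_expr ?B e) (R2, M)"
    "same (d + 2) ?R1 R2" "R2 (tr (d + 2)) = ev ?B e ?\<rho> M"
  proof -
    have "(\<lambda>x. ?R1 (vr x)) = ?\<rho>" "?R1 0 = ?B" by auto
    then show thesis using Iter.IH(1)[of "d + 2" ?R1] that by metis
  qed
  \<comment> \<open>The registers of \<open>a\<close> and \<open>i\<close> are left free: each round
    reloads them from accumulator and counter, and their old values wait in \<open>tr d\<close> and
    \<open>tr (d + 1)\<close>.\<close>
  let ?Inv = "\<lambda>j S M'. M' = M \<and> S 0 = ?B \<and> (\<forall>x. x \<noteq> a \<longrightarrow> x \<noteq> i \<longrightarrow> S (vr x) = R (vr x)) \<and>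
    (\<forall>k<d. S (tr k) = R (tr k)) \<and> S (tr d) = R (vr a) \<and> S (tr (d + 1)) = R (vr i) \<and>
    S (tr (d + 2)) = ?v j"
  let ?P = "Seq (move (vr a) (tr (d + 2))) (Seq (move (vr i) (tr (d + 3)))
          (Seq (comp_expr (d + 4) f) (move (tr (d + 2)) (tr (d + 4)))))"
  have "\<exists>R' M'. runs (for_loop (d + 3) ?P) (R2, M) (?B * ((time_expr ?B f + 6) + 4) + 3) (R', M') \<and>
      ?Inv ?B R' M' \<and> R' 0 = ?B"
  proof (rule runs_for_loop[where Inv = ?Inv])
    fix j S M' assume j: "j < ?B" and S: "?Inv j S M'" "S 0 = ?B" "S (tr (d + 3)) = j"
    let ?S = "S(vr a := ?v j, vr i := j)"
    have \<rho>': "(\<lambda>x. ?S (vr x)) = ?\<rho>(a := ?v j, i := j)" "?S 0 = ?B"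
      using S by (auto simp: fun_eq_iff)
    have "?v (Suc j) = ev ?B f (?\<rho>(a := ?v j, i := j)) M" by simp
    with Iter.IH(2)[of "d + 4" ?S, unfolded \<rho>'] obtain S' where
      S': "runs (comp_expr (d + 4) f) (?S, M) (time_expr ?B f) (S', M)"
      "same (d + 4) ?S S'" "S' (tr (d + 4)) = ?v (Suc j)"
      by metis
    let ?S' = "S'(tr (d + 2) := ?v (Suc j))"
    have "runs (move (vr a) (tr (d + 2))) (S, M) 2 (S(vr a := ?v j), M)"
      using runs_move[of "vr a" "tr (d + 2)" S M] S by simp
    moreover have "runs (move (vr i) (tr (d + 3))) (S(vr a := ?v j), M) 2 (?S, M)"
      using runs_move[of "vr i" "tr (d + 3)" "S(vr a := ?v j)" M] S by simp
    moreover have "runs (move (tr (d + 2)) (tr (d + 4))) (S', M) 2 (?S', M)"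
      using runs_move[of "tr (d + 2)" "tr (d + 4)" S' M] S' by simp
    ultimately have "runs ?P (S, M) (2 + (2 + (time_expr ?B f + 2))) (?S', M)"
      using S'(1) by (intro runs_Seq) auto
    from runs_mono[OF this, of "time_expr ?B f + 6"] S
    have "runs ?P (S, M') (time_expr ?B f + 6) (?S', M)" by simp
    moreover have "?Inv (Suc j) ?S' M" "?S' 0 = ?B" "?S' (tr (d + 3)) = j"
      using S' S by (auto simp: same_def)
    ultimately show "\<exists>R' M''. runs ?P (S, M') (time_expr ?B f + 6) (R', M'') \<and> ?Inv (Suc j) R' M'' \<and>
        R' 0 = ?B \<and> R' (tr (d + 3)) = j"
      by blast
  next
    show "?Inv 0 R2 M" "R2 0 = ?B" using R2 by (auto simp: same_def)
  qed auto
  then obtain R3 where R3: "runs (for_loop (d + 3) ?P) (R2, M) (?B * (time_expr ?B f + 10) + 3) (R3, M)"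
    "?Inv ?B R3 M" by (auto simp: add.assoc)
  let ?R4 = "R3(vr i := R (vr i), vr a := R (vr a), tr d := ?v ?B)"
  have A: "runs (move (tr d) (vr a)) (R, M) 2 (R(tr d := R (vr a)), M)"
    by (rule runs_move) simp
  have B: "runs (move (tr (d + 1)) (vr i)) (R(tr d := R (vr a)), M) 2 (?R1, M)"
    using runs_move[of "tr (d + 1)" "vr i" "R(tr d := R (vr a))" M] by simp
  have D: "runs (move (vr i) (tr (d + 1))) (R3, M) 2 (R3(vr i := R (vr i)), M)"
    using runs_move[of "vr i" "tr (d + 1)" R3 M] R3 by simp
  have E: "runs (move (vr a) (tr d)) (R3(vr i := R (vr i)), M) 2
      (R3(vr i := R (vr i), vr a := R (vr a)), M)"
    using runs_move[of "vr a" "tr d" "R3(vr i := R (vr i))" M] R3 by simp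
  have F: "runs (move (tr d) (tr (d + 2))) (R3(vr i := R (vr i), vr a := R (vr a)), M) 2 (?R4, M)"
    using runs_move[of "tr d" "tr (d + 2)" "R3(vr i := R (vr i), vr a := R (vr a))" M] R3 by simp
  have "runs (comp_expr d (Iter a i e f)) (R, M)
    (2 + (2 + (time_expr ?B e + ((?B * (time_expr ?B f + 10) + 3) + (2 + (2 + 2)))))) (?R4, M)"
    unfolding comp_expr.simps by (intro runs_Seq) (rule A B R2(1) R3(1) D E F)+
  moreover have "2 + (2 + (time_expr ?B e + ((?B * (time_expr ?B f + 10) + 3) + (2 + (2 + 2)))))
      = time_expr ?B (Iter a i e f)" by simp
  moreover have "same d R ?R4" "?R4 (tr d) = ev ?B (Iter a i e f) ?\<rho> M"
    using R3(2) by (auto simp: same_def)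
  ultimately show ?case by metis
qed

lemma runs_comp_cmd:
  "\<exists>R'. runs (comp_cmd d p) (R, M) (time_cmd (R 0) p) (R', sem (R 0) p (\<lambda>x. R (vr x)) M) \<and>
     same d R R'"
proof (induction p arbitrary: d R M)
  case (Put e f)
  obtain R1 where R1: "runs (comp_expr d e) (R, M) (time_expr (R 0) e) (R1, M)" "same d R R1"
    "R1 (tr d) = ev (R 0) e (\<lambda>x. R (vr x)) M" using runs_comp_expr by blast
  obtain R2 where R2: "runs (comp_expr (d + 1) f) (R1, M) (time_expr (R 0) f) (R2, M)"
    "same (d + 1) R1 R2" "R2 (tr (d + 1)) = ev (R 0) f (\<lambda>x. R (vr x)) M"
    using runs_comp_expr[of "d + 1" f R1 M] R1(2) by (auto simp: same_def)
  have "M(R2 (tr d) := R2 (tr (d + 1))) = sem (R 0) (Put e f) (\<lambda>x. R (vr x)) M"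
    using R1(2,3) R2(2,3) by (simp add: same_def)
  with runs_Seq[OF R1(1) runs_Seq[OF R2(1) runs_instr(5)[of "tr d" "tr (d + 1)"]]]
  have "runs (comp_cmd d (Put e f)) (R, M) (time_cmd (R 0) (Put e f))
      (R2, sem (R 0) (Put e f) (\<lambda>x. R (vr x)) M)"
    by (simp add: add.assoc)
  moreover have "same d R R2" using R1(2) R2(2) by (auto simp: same_def)
  ultimately show ?case by blast
next
  case (Then p q)
  let ?\<rho> = "\<lambda>x. R (vr x)"
  obtain R1 where R1: "runs (comp_cmd d p) (R, M) (time_cmd (R 0) p) (R1, sem (R 0) p ?\<rho> M)"
    "same d R R1" using Then.IH(1) by blast
  obtain R2 where R2: "runs (comp_cmd d q) (R1, sem (R 0) p ?\<rho> M) (time_cmd (R 0) q)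
      (R2, sem (R 0) q ?\<rho> (sem (R 0) p ?\<rho> M))" "same d R1 R2"
    using Then.IH(2)[of d R1 "sem (R 0) p ?\<rho> M"] R1(2) by (auto simp: same_def)
  show ?case using runs_Seq[OF R1(1) R2(1)] R1(2) R2(2)
    by (intro exI[of _ R2]) (auto simp: same_def)
next
  case (For i p)
  let ?B = "R 0" and ?\<rho> = "\<lambda>x. R (vr x)"
  let ?v = "\<lambda>j. fold (\<lambda>j. sem ?B p (?\<rho>(i := j))) [0..<j] M"
  let ?R1 = "R(tr d := R (vr i))"
  let ?Inv = "\<lambda>j S M'. M' = ?v j \<and> S 0 = ?B \<and> (\<forall>x. x \<noteq> i \<longrightarrow> S (vr x) = R (vr x)) \<and>
    (\<forall>k<d. S (tr k) = R (tr k)) \<and> S (tr d) = R (vr i)"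
  let ?P = "Seq (move (vr i) (tr (d + 1))) (comp_cmd (d + 2) p)"
  have "\<exists>R' M'. runs (for_loop (d + 1) ?P) (?R1, M) (?B * ((2 + time_cmd ?B p) + 4) + 3) (R', M') \<and>
      ?Inv ?B R' M' \<and> R' 0 = ?B"
  proof (rule runs_for_loop[where Inv = ?Inv])
    fix j S M' assume j: "j < ?B" and S: "?Inv j S M'" "S 0 = ?B" "S (tr (d + 1)) = j"
    let ?S = "S(vr i := j)"
    have "(\<lambda>x. ?S (vr x)) = ?\<rho>(i := j)" using S by (auto simp: fun_eq_iff)
    then obtain S' where S': "runs (comp_cmd (d + 2) p) (?S, M') (time_cmd ?B p) (S', ?v (Suc j))"
      "same (d + 2) ?S S'"
      using For.IH[of "d + 2" ?S M'] S by (auto simp del: fun_upd_apply simp: fun_upd_other)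
    have "runs (move (vr i) (tr (d + 1))) (S, M') 2 (?S, M')"
      using runs_move[of "vr i" "tr (d + 1)" S M'] S by simp
    from runs_Seq[OF this S'(1)]
    show "\<exists>R' M''. runs ?P (S, M') (2 + time_cmd ?B p) (R', M'') \<and> ?Inv (Suc j) R' M'' \<and>
        R' 0 = ?B \<and> R' (tr (d + 1)) = j"
      using S' S by (intro exI[of _ S'] exI[of _ "?v (Suc j)"]) (auto simp: same_def)
  qed auto
  then obtain R3 where R3: "runs (for_loop (d + 1) ?P) (?R1, M) (?B * (time_cmd ?B p + 6) + 3) (R3, ?v ?B)"
    "?Inv ?B R3 (?v ?B)" by (auto simp: algebra_simps)
  let ?R4 = "R3(vr i := R (vr i))"
  have A: "runs (move (tr d) (vr i)) (R, M) 2 (?R1, M)"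
    by (rule runs_move) simp
  have D: "runs (move (vr i) (tr d)) (R3, ?v ?B) 2 (?R4, ?v ?B)"
    using runs_move[of "vr i" "tr d" R3 "?v ?B"] R3 by simp
  have "runs (comp_cmd d (For i p)) (R, M) (2 + ((?B * (time_cmd ?B p + 6) + 3) + 2)) (?R4, ?v ?B)"
    unfolding comp_cmd.simps by (intro runs_Seq) (rule A R3(1) D)+
  moreover have "same d R ?R4"
    using R3(2) by (auto simp: same_def)
  ultimately show ?case by (auto simp: add.commute add.left_commute)
qed

section \<open>Polynomial bounds for running times\<close>

lemma poly_bound_add:
  fixes F G :: "nat \<Rightarrow> nat"
  assumes "\<forall>B. F B \<le> K * (B + 1) ^ d" "\<forall>B. G B \<le> L * (B + 1) ^ e"
  shows "\<forall>B. F B + G B \<le> (K + L) * (B + 1) ^ (d + e)"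
proof
  fix B :: nat
  have "K * (B + 1) ^ d \<le> K * (B + 1) ^ (d + e)" "L * (B + 1) ^ e \<le> L * (B + 1) ^ (d + e)"
    by (intro mult_le_mono order.refl power_increasing; simp)+
  with assms show "F B + G B \<le> (K + L) * (B + 1) ^ (d + e)"
    by (simp only: add_mult_distrib) (meson add_mono order_trans)
qed

lemma poly_bound_mult:
  fixes F :: "nat \<Rightarrow> nat"
  assumes "\<forall>B. F B \<le> K * (B + 1) ^ d"
  shows "\<forall>B. B * F B \<le> K * (B + 1) ^ Suc d"
proof
  fix B :: nat
  have "B * F B \<le> (B + 1) * (K * (B + 1) ^ d)"
    using assms by (intro mult_le_mono) auto
  then show "B * F B \<le> K * (B + 1) ^ Suc d" by (simp add: mult_ac)
qed

text \<open>
  Since every loop makes exactly \<open>B\<close> iterations, running times are bounded by the program text alone.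
\<close>

definition poly_bounded :: "(nat \<Rightarrow> nat) \<Rightarrow> bool" where
  "poly_bounded F \<longleftrightarrow> (\<exists>K d. \<forall>B. F B \<le> K * (B + 1) ^ d)"

lemma poly_bounded_intros:
  "poly_bounded (\<lambda>B. c)"
  "poly_bounded F \<Longrightarrow> poly_bounded G \<Longrightarrow> poly_bounded (\<lambda>B. F B + G B)"
  "poly_bounded F \<Longrightarrow> poly_bounded (\<lambda>B. B * F B)"
  unfolding poly_bounded_def using poly_bound_add poly_bound_mult
  by (force intro: exI[of _ c] exI[of _ 0], blast, blast)

lemma poly_bounded_time_expr: "poly_bounded (\<lambda>B. time_expr B e)"
  by (induction e) (auto intro!: poly_bounded_intros simp del: One_nat_def add_Suc_right)

lemma poly_bounded_time_cmd: "poly_bounded (\<lambda>B. time_cmd B p)"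
  by (induction p) (auto intro!: poly_bounded_intros poly_bounded_time_expr
      simp del: One_nat_def add_Suc_right)

section \<open>Computing the loop bound\<close>

text \<open>Repeated doubling. The exponent register \<open>j\<close> is counted down to 0 and
  thereby destroyed, at a cost linear in the exponent.\<close>

definition exp_prog :: "nat \<Rightarrow> nat \<Rightarrow> nat \<Rightarrow> ram" where
  "exp_prog i j t = Seq (Const i 1) (WhileNZ j (Seq (Add i i i) (Seq (Const t 1) (Sub j j t))))"

definition mult_prog :: "nat \<Rightarrow> nat \<Rightarrow> nat \<Rightarrow> nat \<Rightarrow> ram" where
  "mult_prog i j k t = Seq (Const i 0) (WhileNZ j (Seq (Add i i k) (Seq (Const t 1) (Sub j j t))))"

lemma runs_exp_prog:
  assumes "distinct [i, j, t]"
  shows "\<exists>R'. runs (exp_prog i j t) (R, M) (4 * R j + 2) (R', M) \<and> R' i = 2 ^ R j \<and>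
    (\<forall>x. x \<notin> {i, j, t} \<longrightarrow> R' x = R x)"
proof -
  let ?I = "\<lambda>m s. snd s = M \<and> fst s i = 2 ^ m \<and> fst s j = R j - m \<and> (\<forall>x. x \<notin> {i, j, t} \<longrightarrow> fst s x = R x)"
  let ?P = "Seq (Add i i i) (Seq (Const t 1) (Sub j j t))"
  have "\<exists>s'. runs (WhileNZ j ?P) (R(i := 1), M) (R j * Suc (1 + (1 + 1)) + 1) s' \<and> ?I (R j) s'"
  proof (rule runs_While[where Inv = ?I])
    fix m s assume m: "m < R j" and s: "?I m s"
    obtain S where S: "s = (S, M)" using s by (cases s) auto
    let ?S1 = "S(i := S i + S i)" let ?S2 = "?S1(t := 1)" let ?S3 = "?S2(j := ?S2 j - ?S2 t)"
    have "runs ?P (S, M) (1 + (1 + 1)) (?S3, M)"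
      by (rule runs_Seq[OF runs_instr(2) runs_Seq[OF runs_instr(1) runs_instr(3)]])
    moreover have "?I (Suc m) (?S3, M)" using s S assms by auto
    moreover have "fst s j \<noteq> 0" using s m by simp
    ultimately show "fst s j \<noteq> 0 \<and> (\<exists>s'. runs ?P s (1 + (1 + 1)) s' \<and> ?I (Suc m) s')"
      unfolding S by blast
  next
    show "?I 0 (R(i := 1), M)" using assms by auto
  qed auto
  then obtain s' where s': "runs (WhileNZ j ?P) (R(i := 1), M) (R j * Suc (1 + (1 + 1)) + 1) s'" "?I (R j) s'"
    by blast
  have "runs (exp_prog i j t) (R, M) (1 + (R j * Suc (1 + (1 + 1)) + 1)) (fst s', M)"
    unfolding exp_prog_def by (rule runs_Seq[OF runs_instr(1)]) (use s' in \<open>metis prod.collapse\<close>)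
  moreover have "1 + (R j * Suc (1 + (1 + 1)) + 1) = 4 * R j + 2" by simp
  ultimately show ?thesis using s'(2) by (intro exI[of _ "fst s'"]) metis
qed

lemma runs_mult_prog:
  assumes "distinct [i, j, k, t]"
  shows "\<exists>R'. runs (mult_prog i j k t) (R, M) (4 * R j + 2) (R', M) \<and> R' i = R j * R k \<and>
    (\<forall>x. x \<notin> {i, j, t} \<longrightarrow> R' x = R x)"
proof -
  let ?I = "\<lambda>m s. snd s = M \<and> fst s i = m * R k \<and> fst s j = R j - m \<and> (\<forall>x. x \<notin> {i, j, t} \<longrightarrow> fst s x = R x)"
  let ?P = "Seq (Add i i k) (Seq (Const t 1) (Sub j j t))"
  have "\<exists>s'. runs (WhileNZ j ?P) (R(i := 0), M) (R j * Suc (1 + (1 + 1)) + 1) s' \<and> ?I (R j) s'"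
  proof (rule runs_While[where Inv = ?I])
    fix m s assume m: "m < R j" and s: "?I m s"
    obtain S where S: "s = (S, M)" using s by (cases s) auto
    let ?S1 = "S(i := S i + S k)" let ?S2 = "?S1(t := 1)" let ?S3 = "?S2(j := ?S2 j - ?S2 t)"
    have "runs ?P (S, M) (1 + (1 + 1)) (?S3, M)"
      by (rule runs_Seq[OF runs_instr(2) runs_Seq[OF runs_instr(1) runs_instr(3)]])
    moreover have "?I (Suc m) (?S3, M)" using s S assms by auto
    moreover have "fst s j \<noteq> 0" using s m by simp
    ultimately show "fst s j \<noteq> 0 \<and> (\<exists>s'. runs ?P s (1 + (1 + 1)) s' \<and> ?I (Suc m) s')"
      unfolding S by blast
  next
    show "?I 0 (R(i := 0), M)" using assms by auto
  qed auto
  then obtain s' where s': "runs (WhileNZ j ?P) (R(i := 0), M) (R j * Suc (1 + (1 + 1)) + 1) s'" "?I (R j) s'"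
    by blast
  have "runs (mult_prog i j k t) (R, M) (1 + (R j * Suc (1 + (1 + 1)) + 1)) (fst s', M)"
    unfolding mult_prog_def by (rule runs_Seq[OF runs_instr(1)]) (use s' in \<open>metis prod.collapse\<close>)
  moreover have "1 + (R j * Suc (1 + (1 + 1)) + 1) = 4 * R j + 2" by simp
  ultimately show ?thesis using s'(2) by (intro exI[of _ "fst s'"]) metis
qed

text \<open>The number of colour tables is (2 r + 1)^(2^(2 r)) \<le> 2^2^(4 r + 1). The third
  exponential turns the linear term 4 r + 1 into a constant shift of \<open>r\<close>, and lets
  constant factors and powers be absorbed in the same way.\<close>

definition tower :: "nat \<Rightarrow> nat" where
  "tower x = 2 ^ 2 ^ 2 ^ x"

definition tower_prog :: "nat \<Rightarrow> nat \<Rightarrow> nat \<Rightarrow> nat \<Rightarrow> ram" where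
  "tower_prog c i j t = Seq (Const t c) (Seq (Add i i t)
     (Seq (exp_prog j i t) (Seq (exp_prog i j t) (exp_prog j i t))))"

lemma tower_ge: "x < tower x" "2 ^ x \<le> tower x" "2 ^ 2 ^ x \<le> tower x"
proof -
  have e: "n < 2 ^ n" for n :: nat by (rule less_exp)
  have "(2::nat) ^ 2 ^ x < 2 ^ 2 ^ 2 ^ x" "(2::nat) ^ x < 2 ^ 2 ^ x"
    by (rule e)+
  then show "2 ^ x \<le> tower x" "2 ^ 2 ^ x \<le> tower x"
    unfolding tower_def by linarith+
  then show "x < tower x" using e[of x] by linarith
qed

lemma runs_tower_prog:
  assumes d: "distinct [i, j, t]"
  shows "\<exists>R'. runs (tower_prog c i j t) (R, M) (12 * tower (R i + c) + 8) (R', M) \<and>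
    R' j = tower (R i + c) \<and> (\<forall>x. x \<notin> {i, j, t} \<longrightarrow> R' x = R x)"
proof -
  let ?x = "R i + c" let ?R1 = "R(t := c)" let ?R2 = "?R1(i := ?R1 i + ?R1 t)"
  have x: "?R2 i = ?x" using d by simp
  have d': "distinct [j, i, t]" using d by auto
  have "\<exists>R3. runs (exp_prog j i t) (?R2, M) (4 * ?x + 2) (R3, M) \<and> R3 j = 2 ^ ?x \<and>
      (\<forall>y. y \<notin> {i, j, t} \<longrightarrow> R3 y = ?R2 y)"
    using runs_exp_prog[OF d', of ?R2 M] unfolding x insert_commute[of j i] .
  then obtain R3 where R3: "runs (exp_prog j i t) (?R2, M) (4 * ?x + 2) (R3, M)" "R3 j = 2 ^ ?x"
    "\<forall>y. y \<notin> {i, j, t} \<longrightarrow> R3 y = ?R2 y" by blast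
  obtain R4 where R4: "runs (exp_prog i j t) (R3, M) (4 * 2 ^ ?x + 2) (R4, M)" "R4 i = 2 ^ 2 ^ ?x"
    "\<forall>y. y \<notin> {i, j, t} \<longrightarrow> R4 y = R3 y"
    using runs_exp_prog[OF d, of R3 M] unfolding R3(2) by blast
  obtain R5 where R5: "runs (exp_prog j i t) (R4, M) (4 * 2 ^ 2 ^ ?x + 2) (R5, M)" "R5 j = 2 ^ 2 ^ 2 ^ ?x"
    "\<forall>y. y \<notin> {i, j, t} \<longrightarrow> R5 y = R4 y"
    using runs_exp_prog[OF d', of R4 M] unfolding R4(2) insert_commute[of j i] by blast
  have "runs (tower_prog c i j t) (R, M)
    (1 + (1 + ((4 * ?x + 2) + ((4 * 2 ^ ?x + 2) + (4 * 2 ^ 2 ^ ?x + 2))))) (R5, M)"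
    unfolding tower_prog_def
    by (rule runs_Seq[OF runs_instr(1) runs_Seq[OF runs_instr(2) runs_Seq[OF R3(1) runs_Seq[OF R4(1) R5(1)]]]])
  then have "runs (tower_prog c i j t) (R, M) (12 * tower ?x + 8) (R5, M)"
  proof (rule runs_mono)
    have "1 + (1 + ((4 * x + 2) + ((4 * a + 2) + (4 * b + 2)))) \<le> 12 * y + 8"
      if "x < y" "a \<le> y" "b \<le> y" for x y a b :: nat
      using that by linarith
    then show "1 + (1 + ((4 * ?x + 2) + ((4 * 2 ^ ?x + 2) + (4 * 2 ^ 2 ^ ?x + 2)))) \<le> 12 * tower ?x + 8"
      using tower_ge by blast
  qed
  moreover have "\<forall>y. y \<notin> {i, j, t} \<longrightarrow> R5 y = R y" using R3(3) R4(3) R5(3) by simp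
  ultimately show ?thesis using R5(2) by (auto simp: tower_def)
qed

lemma computable_tower: "computable (\<lambda>x. tower (x + c))"
  unfolding computable_def
proof (intro exI allI)
  fix x
  let ?P = "Seq (Const 1 0) (Seq (Load 1 1) (Seq (tower_prog c 1 2 3) (move 0 2)))"
  let ?M = "snd (input_state [x])" let ?R = "(\<lambda>_. 0)(Suc 0 := 0, 1 := x)"
  have M: "?M 0 = x" by (simp add: input_state_def)
  obtain R' where R': "runs (tower_prog c 1 2 3) (?R, ?M) (12 * tower (x + c) + 8) (R', ?M)"
    "R' 2 = tower (x + c)"
    using runs_tower_prog[of 1 2 3 c ?R ?M] by auto
  have "runs (Load 1 1) ((\<lambda>_. 0)(Suc 0 := 0), ?M) 1 (?R, ?M)"
    using runs_instr(4)[of 1 1 "(\<lambda>_. 0)(Suc 0 := 0)" ?M] M by simp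
  moreover have "runs (Const 1 0) (\<lambda>_. 0, ?M) 1 ((\<lambda>_. 0)(Suc 0 := 0), ?M)"
    using runs_instr(1)[of 1 0 "\<lambda>_. 0" ?M] by simp
  ultimately have "runs ?P (\<lambda>_. 0, ?M) (1 + (1 + ((12 * tower (x + c) + 8) + 2))) (R'(0 := R' 2), ?M)"
    using R'(1) runs_move[of 0 2 R' ?M] by (intro runs_Seq) auto
  then obtain t where "exec ?P (input_state [x]) t (R'(0 := R' 2), ?M)"
    by (auto simp: runs_def input_state_def)
  then have "run ?P [x] t (tower (x + c))" unfolding run_def using R'(2)
    by (intro exI[of _ "R'(0 := R' 2)"] exI[of _ ?M]) simp
  \<comment> \<open>The introduction rules left a schematic step count that may depend on
    \<open>x\<close> only, hence the choice operator.\<close>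
  then show "run ?P [x] (SOME t. run ?P [x] t (tower (x + c))) (tower (x + c))" by (rule someI)
qed

text \<open>The exponent is fixed by the program text, so the loop is unrolled. There is no empty
  program; the base case clears a scratch register instead.\<close>

primrec repeat :: "nat \<Rightarrow> ram \<Rightarrow> ram" where
  "repeat 0 P = Const 2 0"
| "repeat (Suc k) P = Seq P (repeat k P)"

definition power_prog :: "nat \<Rightarrow> ram" where
  "power_prog k = Seq (Const 0 1) (repeat k (Seq (move 2 1) (Seq (mult_prog 3 2 0 4) (move 0 3))))"

text \<open>Input cells 3 and 0 contain \<open>r\<close> and n. Register 1, which is
  \<open>vr 0\<close>, receives W = n * \<open>tower (r + 2)\<close>, and register 0 the loop bound
  W^9.\<close>

definition prepare :: ram where
  "prepare = Seq (Const 2 3) (Seq (Load 2 2) (Seq (tower_prog 2 2 3 4)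
     (Seq (Const 2 0) (Seq (Load 2 2) (Seq (mult_prog 1 2 3 4) (power_prog 9))))))"

lemma runs_power_prog:
  "\<exists>R'. runs (power_prog k) (R, M) (k * (4 * R 1 + 6) + 2) (R', M) \<and> R' 0 = R 1 ^ k \<and> R' 1 = R 1"
proof -
  let ?P = "Seq (move 2 1) (Seq (mult_prog 3 2 0 4) (move 0 3))"
  have "\<exists>R'. runs (repeat k ?P) (S, M) (k * (4 * S 1 + 6) + 1) (R', M) \<and>
      R' 0 = S 0 * S 1 ^ k \<and> R' 1 = S 1" for S
  proof (induction k arbitrary: S)
    case 0
    then show ?case using runs_instr(1)[of 2 0 S M] by (intro exI[of _ "S(2 := 0)"]) (simp add: fun_upd_def)
  next
    case (Suc k)
    let ?S1 = "S(2 := S 1)"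
    obtain S2 where S2: "runs (mult_prog 3 2 0 4) (?S1, M) (4 * S 1 + 2) (S2, M)"
      "S2 3 = S 1 * S 0" "S2 1 = S 1"
      using runs_mult_prog[of 3 2 0 4 ?S1 M] by auto
    let ?S3 = "S2(0 := S2 3)"
    have "?S3 0 = S 1 * S 0" "?S3 1 = S 1" using S2 by simp_all
    with Suc.IH[of ?S3] obtain S4 where S4: "runs (repeat k ?P) (?S3, M) (k * (4 * S 1 + 6) + 1) (S4, M)"
      "S4 0 = S 1 * S 0 * S 1 ^ k" "S4 1 = S 1"
      by metis
    have "runs (repeat (Suc k) ?P) (S, M) ((2 + ((4 * S 1 + 2) + 2)) + (k * (4 * S 1 + 6) + 1)) (S4, M)"
      unfolding repeat.simps
      by (intro runs_Seq[OF runs_Seq[OF _ runs_Seq[OF S2(1)]] S4(1)]) (rule runs_move; simp)+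
    moreover have "(2 + ((4 * S 1 + 2) + 2)) + (k * (4 * S 1 + 6) + 1) = Suc k * (4 * S 1 + 6) + 1" by simp
    moreover have "S4 0 = S 0 * S 1 ^ Suc k" using S4(2) by simp
    ultimately show ?case using S4(3) by metis
  qed
  from this[of "R(0 := 1)"] obtain R' where
    R': "runs (repeat k ?P) (R(0 := 1), M) (k * (4 * R 1 + 6) + 1) (R', M)" "R' 0 = R 1 ^ k" "R' 1 = R 1"
    by auto
  have "runs (power_prog k) (R, M) (1 + (k * (4 * R 1 + 6) + 1)) (R', M)"
    unfolding power_prog_def by (rule runs_Seq[OF runs_instr(1) R'(1)])
  then show ?thesis using R'(2,3) by auto
qed

lemma runs_prepare:
  fixes M :: "nat \<Rightarrow> nat"
  defines "W \<equiv> M 0 * tower (M 3 + 2)"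
  assumes n: "0 < M 0"
  shows "\<exists>R'. runs prepare (\<lambda>_. 0, M) (200 * (W ^ 9 + 1)) (R', M) \<and> R' 0 = W ^ 9 \<and> R' 1 = W"
proof -
  let ?t = "tower (M 3 + 2)"
  let ?R1 = "(\<lambda>_. 0::nat)(2 := 3)" let ?R2 = "?R1(2 := M 3)"
  obtain R3 where R3: "runs (tower_prog 2 2 3 4) (?R2, M) (12 * ?t + 8) (R3, M)" "R3 3 = ?t"
    using runs_tower_prog[of 2 3 4 2 ?R2 M] by auto
  let ?R4 = "R3(2 := 0)" let ?R5 = "?R4(2 := M 0)"
  obtain R6 where R6: "runs (mult_prog 1 2 3 4) (?R5, M) (4 * M 0 + 2) (R6, M)" "R6 1 = W"
    using runs_mult_prog[of 1 2 3 4 ?R5 M] R3(2) by (auto simp: W_def)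
  obtain R7 where R7: "runs (power_prog 9) (R6, M) (9 * (4 * W + 6) + 2) (R7, M)"
    "R7 0 = W ^ 9" "R7 1 = W"
    using runs_power_prog[of 9 R6 M] R6(2) by auto
  have l: "runs (Load 2 2) (?R1, M) 1 (?R2, M)" "runs (Load 2 2) (?R4, M) 1 (?R5, M)"
    using runs_instr(4)[of 2 2 ?R1 M] runs_instr(4)[of 2 2 ?R4 M] by simp_all
  have "runs prepare (\<lambda>_. 0, M)
    (1 + (1 + ((12 * ?t + 8) + (1 + (1 + ((4 * M 0 + 2) + (9 * (4 * W + 6) + 2))))))) (R7, M)"
    unfolding prepare_def
    by (rule runs_Seq[OF runs_instr(1) runs_Seq[OF l(1) runs_Seq[OF R3(1)
      runs_Seq[OF runs_instr(1) runs_Seq[OF l(2) runs_Seq[OF R6(1) R7(1)]]]]]])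
  moreover have "1 + (1 + ((12 * ?t + 8) + (1 + (1 + ((4 * M 0 + 2) + (9 * (4 * W + 6) + 2)))))) \<le>
      200 * (W ^ 9 + 1)"
  proof -
    have t: "0 < ?t" by (simp add: tower_def)
    have W: "?t \<le> W" "M 0 \<le> W" using n t by (simp_all add: W_def)
    then have "W ^ 1 \<le> W ^ 9" using t by (intro power_increasing) auto
    then show ?thesis using W by simp
  qed
  ultimately show ?thesis using R7(2,3) runs_mono by blast
qed

text \<open>With b = 2^x the left side is at most 2^(K + e * 2^b), and K + e * 2^b \<le> 2^(K + e +
  b). The third level takes care of the rest, as K + e + b \<le> 2^(x + K + e).\<close>

lemma tower_absorbs: "K * tower x ^ e \<le> tower (x + K + e)"
proof -
  let ?b = "2 ^ x :: nat"
  have "K + 2 ^ ?b * e \<le> (K + e) * 2 ^ ?b" by (simp add: algebra_simps)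
  also have "\<dots> \<le> 2 ^ (K + e) * 2 ^ ?b" using less_exp[of "K + e"] by (intro mult_le_mono1) simp
  also have "\<dots> = 2 ^ (K + e + ?b)" by (simp add: power_add)
  also have "\<dots> \<le> 2 ^ 2 ^ (x + K + e)"
  proof (rule power_increasing)
    have "(K + e) * 1 \<le> (K + e) * ?b" by (intro mult_le_mono2) simp
    then have "K + e + ?b \<le> (K + e + 1) * ?b" by simp
    also have "\<dots> \<le> 2 ^ (K + e) * ?b"
      using less_exp[of "K + e"] by (intro mult_le_mono1) (simp only: Suc_le_eq Suc_eq_plus1[symmetric])
    finally show "K + e + ?b \<le> 2 ^ (x + K + e)" by (simp add: power_add mult_ac)
  qed simp
  finally have *: "K + 2 ^ ?b * e \<le> 2 ^ 2 ^ (x + K + e)" .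
  have "K * tower x ^ e \<le> 2 ^ K * 2 ^ (2 ^ ?b * e)"
    using less_exp[of K] by (intro mult_le_mono) (simp_all add: tower_def power_mult)
  also have "\<dots> = 2 ^ (K + 2 ^ ?b * e)" by (simp add: power_add)
  also have "\<dots> \<le> tower (x + K + e)" unfolding tower_def using * by (rule power_increasing) simp
  finally show ?thesis .
qed

section \<open>Routings and zero-weight components\<close>

lemma vwalk_with_proj:
  "vwalk p (with_proj G) \<longleftrightarrow> p \<noteq> [] \<and> set p \<subseteq> pverts G \<and> set (vwalk_arcs p) \<subseteq> parcs G"
  by (auto simp: vwalk_def arcs_ends_def arc_to_ends_def)

lemma vwalk_arcs_append:
  "p \<noteq> [] \<Longrightarrow> q \<noteq> [] \<Longrightarrow> last p = hd q \<Longrightarrow>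
    vwalk_arcs (p @ tl q) = vwalk_arcs p @ vwalk_arcs q"
  by (induction p rule: vwalk_arcs.induct) (cases q; cases "tl q"; auto)+

locale cvrp =
  fixes I :: "nat gas_cvrp" and n :: nat
  assumes inst: "gas_cvrp_instance I" and verts: "pverts (network I) = {..<n}"
begin

abbreviation "E \<equiv> parcs (network I)"
abbreviation "w \<equiv> weight I"
abbreviation "ww \<equiv> walk_weight I"
abbreviation "G \<equiv> with_proj (network I)"

definition "Z = {(u, v). (u, v) \<in> E \<and> w (u, v) = 0}"

abbreviation "conn u v \<equiv> (u, v) \<in> Z\<^sup>*"

lemma E_sym: "(u, v) \<in> E \<Longrightarrow> (v, u) \<in> E" and w_sym: "(u, v) \<in> E \<Longrightarrow> w (v, u) = w (u, v)"
  and E_verts: "(u, v) \<in> E \<Longrightarrow> u < n \<and> v < n"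
proof -
  interpret pair_graph "network I" using inst by (simp add: gas_cvrp_instance_def)
  assume uv: "(u, v) \<in> E"
  then show "(v, u) \<in> E" using arcs_symmetric by blast
  show "u < n \<and> v < n" using in_arcsD1[OF uv] in_arcsD2[OF uv] verts by auto
  show "w (v, u) = w (u, v)" using inst uv by (auto simp: gas_cvrp_instance_def)
qed

lemma depots_less: "d \<in> depots I \<Longrightarrow> d < n" and clients_less: "c \<in> clients I \<Longrightarrow> c < n"
  using inst verts by (auto simp: gas_cvrp_instance_def)

lemma conn_sym: "conn u v \<Longrightarrow> conn v u"
proof -
  have "sym Z" by (auto simp: sym_def Z_def E_sym w_sym)
  then show "conn u v \<Longrightarrow> conn v u" by (meson sym_rtrancl symD)
qed

lemma conn_less: "conn u v \<Longrightarrow> u < n \<Longrightarrow> v < n"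
  by (induction rule: rtrancl_induct) (auto simp: Z_def dest: E_verts)

text \<open>\<open>S\<close> need only be contained in the visited set, so coverage can be weakened
  at will and is united when walks are joined.\<close>

definition wk :: "nat \<Rightarrow> nat \<Rightarrow> nat \<Rightarrow> nat set \<Rightarrow> bool" where
  "wk u v x S \<longleftrightarrow> (\<exists>p. vwalk p G \<and> hd p = u \<and> last p = v \<and> ww p = x \<and> S \<subseteq> set p)"

lemma wk_mono: "wk u v x S \<Longrightarrow> S' \<subseteq> S \<Longrightarrow> wk u v x S'"
  unfolding wk_def by (blast intro: order_trans)

lemma wk_refl: "u < n \<Longrightarrow> wk u u 0 {u}"
  unfolding wk_def by (intro exI[of _ "[u]"]) (auto simp: vwalk_with_proj verts walk_weight_def)

lemma wk_edge: "(u, v) \<in> E \<Longrightarrow> wk u v (w (u, v)) {u, v}"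
  unfolding wk_def using E_verts[of u v]
  by (intro exI[of _ "[u, v]"]) (auto simp: vwalk_with_proj verts walk_weight_def)

lemma wk_trans: "wk u v x S \<Longrightarrow> wk v z y S' \<Longrightarrow> wk u z (x + y) (S \<union> S')"
proof -
  assume "wk u v x S" "wk v z y S'"
  then obtain p q where
    p: "vwalk p G" "hd p = u" "last p = v" "ww p = x" "S \<subseteq> set p" and
    q: "vwalk q G" "hd q = v" "last q = z" "ww q = y" "S' \<subseteq> set q" unfolding wk_def by blast
  have ne: "p \<noteq> []" "q \<noteq> []" using p q by (auto simp: vwalk_with_proj)
  have a: "vwalk_arcs (p @ tl q) = vwalk_arcs p @ vwalk_arcs q"
    by (rule vwalk_arcs_append) (use ne p q in auto)
  have s: "set (p @ tl q) = set p \<union> set q"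
    using ne p(3) q(2) by (cases q) (auto dest: last_in_set)
  have "last (p @ tl q) = z" using ne p(3) q(2,3) by (cases q) auto
  then show ?thesis unfolding wk_def
    using p q ne a s by (intro exI[of _ "p @ tl q"]) (auto simp: vwalk_with_proj walk_weight_def)
qed

lemma wk_conn: "conn u v \<Longrightarrow> u < n \<Longrightarrow> wk u v 0 {u, v}"
proof (induction rule: rtrancl_induct)
  case base
  then show ?case using wk_refl by simp
next
  case (step y z)
  then have "wk u y 0 {u, y}" "wk y z 0 {y, z}" using wk_edge[of y z] by (auto simp: Z_def)
  from wk_trans[OF this] show ?case by (auto simp: wk_def)
qed

text \<open>Visit the finitely many vertices one after another and return to \<open>u\<close> each
  time, all at no cost.\<close>

lemma wk_component: "u < n \<Longrightarrow> wk u u 0 {v. conn u v}"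
proof -
  assume u: "u < n"
  have "finite S \<Longrightarrow> S \<subseteq> {v. conn u v} \<Longrightarrow> wk u u 0 S" for S
  proof (induction S rule: finite_induct)
    case empty
    then show ?case using wk_refl[OF u] by (auto simp: wk_def)
  next
    case (insert v S)
    then have "conn u v" "v < n" using conn_less u by auto
    from wk_trans[OF wk_trans[OF wk_conn[OF this(1) u] wk_conn[OF conn_sym[OF this(1)] this(2)]]]
      insert have "wk u u (0 + 0 + 0) ({u, v} \<union> {v, u} \<union> S)" by blast
    then have "wk u u 0 ({u, v} \<union> {v, u} \<union> S)" by simp
    then show ?case by (rule wk_mono) auto
  qed
  moreover have "finite {v. conn u v}"
    by (rule finite_subset[of _ "{..<n}"]) (use conn_less u in auto)
  ultimately show ?thesis by blast
qed

definition ok :: "nat list \<Rightarrow> bool" where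
  "ok p \<longleftrightarrow> vwalk p G \<and> hd p \<in> depots I \<and> hd p = last p \<and> ww p \<le> gas I"

text \<open>Coverage by the union replaces the assignment, which can be chosen afterwards: each
  client picks a walk that contains it.\<close>

definition tours :: "nat \<Rightarrow> nat \<Rightarrow> nat set \<Rightarrow> bool" where
  "tours j t U \<longleftrightarrow> (\<exists>R. length R = j \<and> (\<forall>p\<in>set R. ok p) \<and> routing_weight I R = t \<and>
     U \<subseteq> (\<Union>p\<in>set R. set p))"

lemma tours_mono: "tours j t U \<Longrightarrow> U' \<subseteq> U \<Longrightarrow> tours j t U'"
  unfolding tours_def by (blast intro: order_trans)

lemma tours_empty: "tours 0 0 {}"
  by (auto simp: tours_def routing_weight_def)

lemma tours_wk: "wk d d x U \<Longrightarrow> d \<in> depots I \<Longrightarrow> x \<le> gas I \<Longrightarrow> tours 1 x U"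
proof -
  assume "wk d d x U" "d \<in> depots I" "x \<le> gas I"
  moreover from this(1) obtain p where
    "vwalk p G" "hd p = d" "last p = d" "ww p = x" "U \<subseteq> set p" unfolding wk_def by blast
  ultimately have "ok p" "ww p = x" "U \<subseteq> set p" by (simp_all add: ok_def)
  then show ?thesis unfolding tours_def
    by (intro exI[of _ "[p]"]) (auto simp: routing_weight_def)
qed

lemma tours_add: "tours j t U \<Longrightarrow> tours j' t' U' \<Longrightarrow> tours (j + j') (t + t') (U \<union> U')"
proof -
  assume "tours j t U" "tours j' t' U'"
  then obtain R R' where
    "length R = j" "\<forall>p\<in>set R. ok p" "routing_weight I R = t" "U \<subseteq> (\<Union>p\<in>set R. set p)"
    "length R' = j'" "\<forall>p\<in>set R'. ok p" "routing_weight I R' = t'" "U' \<subseteq> (\<Union>p\<in>set R'. set p)"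
    unfolding tours_def by blast
  then show ?thesis unfolding tours_def
    by (intro exI[of _ "R @ R'"]) (auto simp: routing_weight_def)
qed

lemma routing_iff_ok:
  "routing I R A \<longleftrightarrow> length R \<le> vehicles I \<and> (\<forall>p\<in>set R. ok p) \<and>
     (\<forall>c \<in> clients I. A c < length R \<and> c \<in> set (R ! A c))"
  by (auto simp: routing_def ok_def)

lemma tours_routing:
  assumes "tours j t U" "j \<le> vehicles I" "clients I \<subseteq> U" "t \<le> r"
  shows "\<exists>R A. routing I R A \<and> routing_weight I R \<le> r"
proof -
  obtain R where R: "length R = j" "\<forall>p\<in>set R. ok p" "routing_weight I R = t"
    "U \<subseteq> (\<Union>p\<in>set R. set p)" using assms(1) unfolding tours_def by blast
  have "\<exists>i. i < length R \<and> c \<in> set (R ! i)" if "c \<in> clients I" for c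
  proof -
    from that assms(3) R(4) obtain p where "p \<in> set R" "c \<in> set p" by blast
    then show ?thesis by (metis in_set_conv_nth)
  qed
  then obtain A where "\<forall>c \<in> clients I. A c < length R \<and> c \<in> set (R ! A c)" by metis
  then show ?thesis using R assms by (auto simp: routing_iff_ok)
qed

end

section \<open>Representatives of zero-weight components and the search\<close>

locale cvrp_targets = cvrp +
  fixes T :: "nat set" and r :: nat
  assumes T_clients: "T \<subseteq> clients I"
    and T_covers: "c \<in> clients I \<Longrightarrow> \<exists>x\<in>T. conn x c"
    and T_unique: "x \<in> T \<Longrightarrow> y \<in> T \<Longrightarrow> conn x y \<Longrightarrow> x = y"
begin

definition "must = {x \<in> T. \<nexists>d. d \<in> depots I \<and> conn d x}"

lemma T_less: "x \<in> T \<Longrightarrow> x < n" and finite_T: "finite T"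
proof -
  show "x \<in> T \<Longrightarrow> x < n" using T_clients clients_less by blast
  show "finite T" by (rule finite_subset[of _ "{..<n}"]) (use T_clients clients_less in auto)
qed

text \<open>
  The arguments are the start and the current vertex of the current walk, the collected targets, the
  weight of the current walk and of all walks, and the number of walks.
  The vertex \<open>n\<close>, which is not in the graph, is the position before the first walk.
\<close>

inductive search :: "nat \<Rightarrow> nat \<Rightarrow> nat list \<Rightarrow> nat \<Rightarrow> nat \<Rightarrow> nat \<Rightarrow> bool" where
  start: "search n n [] 0 0 0"
| move: "search d v xs x t j \<Longrightarrow> (v, v') \<in> E \<Longrightarrow> x + w (v, v') \<le> gas I \<Longrightarrow> t + w (v, v') \<le> r \<Longrightarrow>
    search d v' xs (x + w (v, v')) (t + w (v, v')) j"
| collect: "search d v xs x t j \<Longrightarrow> y \<in> T \<Longrightarrow> conn y v \<Longrightarrow> y \<notin> set xs \<Longrightarrow>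
    search d v (y # xs) x t j"
| new: "search d d xs x t j \<Longrightarrow> d' \<in> depots I \<Longrightarrow> search d' d' xs 0 t (Suc j)"

lemma search_distinct: "search d v xs x t j \<Longrightarrow> distinct xs \<and> set xs \<subseteq> T"
  by (induction rule: search.induct) auto

text \<open>The finished walks cover \<open>U\<close> and the current one covers \<open>U'\<close>.
  Collecting a target is realised by inserting a free round trip through the whole zero-weight
  component of the current vertex, so every client that the target represents is covered.\<close>

lemma search_tours:
  "search d v xs x t j \<Longrightarrow> t \<le> r \<and>
     (j = 0 \<and> d = n \<and> v = n \<and> xs = [] \<and> t = 0 \<or>
     (\<exists>j' t' U U'. j = Suc j' \<and> tours j' t' U \<and> wk d v x U' \<and> d \<in> depots I \<and> x \<le> gas I \<and> t = t' + x \<and>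
        {z. \<exists>y\<in>set xs. conn y z} \<subseteq> U \<union> U'))"
proof (induction rule: search.induct)
  case start
  then show ?case by simp
next
  case (move d v xs x t j v')
  have "v \<noteq> n" using E_verts[OF move(2)] by simp
  with move.IH obtain j' t' U U' where
    "j = Suc j'" "tours j' t' U" "wk d v x U'" "d \<in> depots I" "t = t' + x"
    "{z. \<exists>y\<in>set xs. conn y z} \<subseteq> U \<union> U'" by blast
  moreover from this have "wk d v' (x + w (v, v')) (U' \<union> {v, v'})"
    using wk_trans[OF _ wk_edge[OF move(2)]] by blast
  ultimately show ?case using move.hyps(3,4)
    by (intro conjI disjI2 exI[of _ j'] exI[of _ t'] exI[of _ U] exI[of _ "U' \<union> {v, v'}"])
      (simp_all, blast)
next
  case (collect d v xs x t j y)
  have y: "y < n" using collect T_less by blast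
  then have v: "v < n" using collect conn_less by blast
  with collect.IH obtain j' t' U U' where
    "j = Suc j'" "tours j' t' U" "wk d v x U'" "d \<in> depots I" "t = t' + x" "x \<le> gas I"
    "{z. \<exists>y\<in>set xs. conn y z} \<subseteq> U \<union> U'" by blast
  moreover have "wk d v x (U' \<union> {z. conn y z})"
  proof -
    have "{z. conn y z} \<subseteq> {z. conn v z}"
      using conn_sym[OF collect(3)] by (auto intro: rtrancl_trans)
    with wk_trans[OF \<open>wk d v x U'\<close> wk_component[OF v]] show ?thesis
      by (auto elim!: wk_mono)
  qed
  ultimately show ?case using collect.IH
    by (intro conjI disjI2 exI[of _ j'] exI[of _ t'] exI[of _ U] exI[of _ "U' \<union> {z. conn y z}"])
      (simp_all, blast)
next
  case (new d xs x t j d')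
  have d': "wk d' d' 0 {d'}" using new depots_less wk_refl by blast
  show ?case
  proof (cases "j = 0")
    case True
    with new.IH have "xs = []" "t = 0" by auto
    then show ?thesis using True new d' tours_empty
      by (intro conjI disjI2 exI[of _ 0] exI[of _ "{}"] exI[of _ "{d'}"]) auto
  next
    case False
    with new.IH obtain j' t' U U' where
      *: "j = Suc j'" "tours j' t' U" "wk d d x U'" "d \<in> depots I" "t = t' + x" "x \<le> gas I"
      "{z. \<exists>y\<in>set xs. conn y z} \<subseteq> U \<union> U'" by blast
    have "tours j t (U \<union> U')" using tours_add[OF *(2) tours_wk[OF *(3,4,6)]] * by simp
    then show ?thesis using * new d'
      by (intro conjI disjI2 exI[of _ j] exI[of _ t] exI[of _ "U \<union> U'"] exI[of _ "{d'}"])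
        (simp_all, blast)
  qed
qed

lemma tours_depot_components:
  "finite Y \<Longrightarrow> Y \<subseteq> T - must \<Longrightarrow> tours (card Y) 0 {z. \<exists>y\<in>Y. conn y z}"
proof (induction Y rule: finite_induct)
  case empty
  then show ?case using tours_empty by simp
next
  case (insert y Y)
  then obtain d where d: "d \<in> depots I" "conn d y" by (auto simp: must_def)
  then have "{z. conn y z} \<subseteq> {z. conn d z}" by (auto intro: rtrancl_trans)
  then have "wk d d 0 {z. conn y z}"
    using wk_component[of d] depots_less[OF d(1)] wk_mono by blast
  then have "tours 1 0 {z. conn y z}" by (rule tours_wk) (use d in auto)
  from tours_add[OF this insert.IH] insert
  have "tours (card (insert y Y)) 0 ({z. conn y z} \<union> {z. \<exists>y\<in>Y. conn y z})" by simp
  moreover have "{z. conn y z} \<union> {z. \<exists>y\<in>Y. conn y z} = {z. \<exists>y\<in>insert y Y. conn y z}" by blast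
  ultimately show ?case by simp
qed

text \<open>The targets not collected have a depot in their component and get one free walk each;
  the count inequality leaves room for these \<open>card T - length xs\<close> walks.\<close>

lemma routing_if_search:
  assumes s: "search d d xs x t j" and must: "must \<subseteq> set xs"
    and count: "j + card T \<le> vehicles I + length xs"
  shows "\<exists>R A. routing I R A \<and> routing_weight I R \<le> r"
proof -
  let ?U = "{z. \<exists>y\<in>set xs. conn y z}" and ?V = "{z. \<exists>y\<in>T - set xs. conn y z}"
  have "tours j t ?U \<and> t \<le> r"
  proof (cases "j = 0")
    case True
    then show ?thesis using search_tours[OF s] tours_empty by auto
  next
    case False
    with search_tours[OF s] obtain j' t' U U' where
      *: "j = Suc j'" "tours j' t' U" "wk d d x U'" "d \<in> depots I" "t = t' + x" "x \<le> gas I"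
      "?U \<subseteq> U \<union> U'" "t \<le> r" by blast
    have "tours j t (U \<union> U')" using tours_add[OF *(2) tours_wk[OF *(3,4,6)]] * by simp
    then show ?thesis using tours_mono *(7,8) by blast
  qed
  moreover have "tours (card (T - set xs)) 0 ?V"
    by (rule tours_depot_components) (use finite_T must in auto)
  ultimately have "tours (j + card (T - set xs)) (t + 0) (?U \<union> ?V)" "t \<le> r"
    using tours_add by blast+
  moreover have "card (T - set xs) = card T - length xs"
    using search_distinct[OF s] by (simp add: card_Diff_subset distinct_card)
  moreover have "length xs \<le> card T"
    using search_distinct[OF s] card_mono[OF finite_T, of "set xs"] by (simp add: distinct_card)
  moreover have "clients I \<subseteq> ?U \<union> ?V" using T_covers by blast
  ultimately show ?thesis using count by (intro tours_routing) auto
qed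

section \<open>From routings back to searches\<close>

lemma search_collect:
  assumes "search d v xs x t j" "finite F" "F \<subseteq> T" "\<forall>y\<in>F. conn y v"
  shows "\<exists>xs'. search d v xs' x t j \<and> set xs' = set xs \<union> F"
  using assms(2,1,3,4)
proof (induction F rule: finite_induct)
  case empty
  then show ?case by auto
next
  case (insert y F)
  then obtain xs' where "search d v xs' x t j" "set xs' = set xs \<union> F" by auto
  then show ?case using collect[of d v xs' x t j y] insert
    by (cases "y \<in> set xs'") (auto intro: exI[of _ xs'] exI[of _ "y # xs'"])
qed

definition seen :: "nat list \<Rightarrow> nat set" where
  "seen p = {y \<in> T. \<exists>v\<in>set p. conn y v}"

lemma seen_Cons: "seen (v # p) = {y \<in> T. conn y v} \<union> seen p"
  by (auto simp: seen_def)

lemma walk_weight_Cons: "ww (u # v # p) = w (u, v) + ww (v # p)"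
  by (simp add: walk_weight_def)

text \<open>The search follows the walk and, at each vertex, collects what is free there before
  moving on. Weights are nonnegative, so bounds on the total weight hold for every prefix.\<close>

lemma search_walk:
  assumes "search d (hd p) xs x t j" "vwalk p G" "x + ww p \<le> gas I" "t + ww p \<le> r"
  shows "\<exists>xs'. search d (last p) xs' (x + ww p) (t + ww p) j \<and> set xs' = set xs \<union> seen p"
  using assms
proof (induction p arbitrary: xs x t rule: vwalk_arcs.induct)
  case 1
  then show ?case by (simp add: vwalk_with_proj)
next
  case (2 v)
  then have "search d v xs x t j" by simp
  then have "\<exists>xs'. search d v xs' x t j \<and> set xs' = set xs \<union> {y \<in> T. conn y v}"
    by (rule search_collect) (use finite_T in auto)
  then show ?case by (simp add: walk_weight_def seen_def)
next
  case (3 u v p)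
  obtain xs1 where xs1: "search d u xs1 x t j" "set xs1 = set xs \<union> {y \<in> T. conn y u}"
  proof -
    have "search d u xs x t j" using 3(2) by simp
    then have "\<exists>xs'. search d u xs' x t j \<and> set xs' = set xs \<union> {y \<in> T. conn y u}"
      by (rule search_collect) (use finite_T in auto)
    then show thesis using that by blast
  qed
  have "search d v xs1 (x + w (u, v)) (t + w (u, v)) j"
    by (rule move[OF xs1(1)]) (use 3 in \<open>auto simp: vwalk_with_proj walk_weight_Cons\<close>)
  then have "\<exists>xs'. search d (last (v # p)) xs' (x + w (u, v) + ww (v # p)) (t + w (u, v) + ww (v # p)) j \<and>
      set xs' = set xs1 \<union> seen (v # p)"
    by (intro 3(1)) (use 3(3-) in \<open>auto simp: vwalk_with_proj walk_weight_Cons\<close>)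
  then obtain xs' where
    "search d (last (v # p)) xs' (x + w (u, v) + ww (v # p)) (t + w (u, v) + ww (v # p)) j"
    "set xs' = set xs1 \<union> seen (v # p)" by blast
  then show ?case using xs1(2)
    by (intro exI[of _ xs']) (auto simp: walk_weight_Cons add.assoc seen_Cons[of u])
qed

lemma search_tour_list:
  assumes "\<forall>p\<in>set R. ok p" "routing_weight I R \<le> r"
  shows "\<exists>d xs x. search d d xs x (routing_weight I R) (length R) \<and> set xs = (\<Union>p\<in>set R. seen p)"
  using assms
proof (induction R rule: rev_induct)
  case Nil
  then show ?case using start by (force simp: routing_weight_def)
next
  case (snoc p R)
  then obtain d xs x where "search d d xs x (routing_weight I R) (length R)"
    "set xs = (\<Union>p\<in>set R. seen p)" by (auto simp: routing_weight_def)
  moreover have p: "ok p" using snoc by simp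
  ultimately have "search (hd p) (hd p) xs 0 (routing_weight I R) (Suc (length R))"
    using new by (auto simp: ok_def)
  with search_walk[OF this] p snoc.prems obtain xs' where
    "search (hd p) (last p) xs' (0 + ww p) (routing_weight I R + ww p) (Suc (length R))"
    "set xs' = set xs \<union> seen p"
    by (auto simp: ok_def routing_weight_def)
  then show ?case using p \<open>set xs = _\<close>
    by (intro exI[of _ "hd p"] exI[of _ xs'] exI[of _ "0 + ww p"])
      (auto simp: ok_def routing_weight_def)
qed

lemma card_component: "card {y \<in> T. conn y v} \<le> 1"
proof -
  have "x = y" if "x \<in> {y \<in> T. conn y v}" "y \<in> {y \<in> T. conn y v}" for x y
    using that T_unique conn_sym by (blast intro: rtrancl_trans)
  then have "card {y \<in> T. conn y v} \<le> Suc 0"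
    using finite_T card_le_Suc0_iff_eq[of "{y \<in> T. conn y v}"] by fastforce
  then show ?thesis by simp
qed

text \<open>A zero-weight component has at most one target and can only be left along an edge of
  positive weight, so every target after the first one is paid for.\<close>

lemma card_seen: "vwalk p G \<Longrightarrow> card (seen p) \<le> ww p + 1"
proof (induction p rule: vwalk_arcs.induct)
  case 1
  then show ?case by (simp add: vwalk_with_proj)
next
  case (2 v)
  then show ?case using card_component[of v] by (simp add: seen_def)
next
  case (3 u v p)
  then have IH: "card (seen (v # p)) \<le> ww (v # p) + 1" and uv: "(u, v) \<in> E"
    by (auto simp: vwalk_with_proj)
  show ?case
  proof (cases "w (u, v) = 0")
    case True
    then have "(u, v) \<in> Z" using uv by (simp add: Z_def)
    then have "seen (u # v # p) = seen (v # p)" by (auto simp: seen_def intro: rtrancl_into_rtrancl)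
    then show ?thesis using IH True by (simp add: walk_weight_Cons)
  next
    case False
    have "card (seen (u # v # p)) \<le> card {y \<in> T. conn y u} + card (seen (v # p))"
      unfolding seen_Cons[of u] by (rule card_Un_le)
    then show ?thesis using IH False card_component[of u] by (simp add: walk_weight_Cons)
  qed
qed

lemma zero_walk_conn: "vwalk p G \<Longrightarrow> ww p = 0 \<Longrightarrow> v \<in> set p \<Longrightarrow> conn (hd p) v"
proof (induction p rule: vwalk_arcs.induct)
  case (3 u v' p)
  then have "(u, v') \<in> Z" by (auto simp: vwalk_with_proj walk_weight_Cons Z_def)
  moreover have "v = u \<or> conn v' v" using 3 by (auto simp: vwalk_with_proj walk_weight_Cons)
  ultimately show ?case by (auto intro: converse_rtrancl_into_rtrancl)
qed auto

text \<open>The search follows only the walks of positive weight, of which there are at most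
  \<open>r\<close>; together they meet at most 2 r targets. Each remaining target lies on a walk of
  weight 0. That walk starts at a depot in the same component, so the target is not in
  \<open>must\<close>, and its vehicle accounts for the target in the count.\<close>

lemma search_if_routing:
  assumes rt: "routing I R A" and wt: "routing_weight I R \<le> r"
  shows "\<exists>d xs x t j. search d d xs x t j \<and> must \<subseteq> set xs \<and>
    j + card T \<le> vehicles I + length xs \<and> j \<le> r \<and> length xs \<le> 2 * r"
proof -
  let ?Rp = "filter (\<lambda>p. ww p \<noteq> 0) R"
  have ok: "\<forall>p\<in>set R. ok p" using rt by (simp add: routing_iff_ok)
  have wp: "routing_weight I ?Rp = routing_weight I R"
    unfolding routing_weight_def by (induction R) auto
  obtain d xs x where s: "search d d xs x (routing_weight I ?Rp) (length ?Rp)"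
    and xs: "set xs = (\<Union>p\<in>set ?Rp. seen p)"
    using search_tour_list[of ?Rp] ok wt wp by auto
  have len: "length ?Rp \<le> routing_weight I R"
    unfolding routing_weight_def by (induction R) auto
  have "card (set xs) \<le> 2 * routing_weight I R"
  proof -
    have "card (\<Union>p\<in>set ?Rp. seen p) \<le> 2 * routing_weight I R" using ok
    proof (induction R)
      case (Cons p R)
      have "card (seen p) \<le> ww p + 1" using Cons.prems card_seen by (simp add: ok_def)
      moreover have "card (seen p \<union> (\<Union>p\<in>set (filter (\<lambda>p. ww p \<noteq> 0) R). seen p)) \<le>
          card (seen p) + card (\<Union>p\<in>set (filter (\<lambda>p. ww p \<noteq> 0) R). seen p)"
        by (rule card_Un_le)
      moreover have "card (\<Union>p\<in>set (filter (\<lambda>p. ww p \<noteq> 0) R). seen p) \<le> 2 * routing_weight I R"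
        using Cons by simp
      ultimately show ?case by (auto simp: routing_weight_def)
    qed (simp add: routing_weight_def)
    then show ?thesis using xs by simp
  qed
  then have lxs: "length xs \<le> 2 * r" using search_distinct[OF s] wt by (simp add: distinct_card)
  have A: "A y < length R \<and> y \<in> set (R ! A y)" if "y \<in> T" for y
    using rt that T_clients by (auto simp: routing_iff_ok)
  have zero: "ww (R ! A y) = 0" if "y \<in> T" "y \<notin> set xs" for y
  proof (rule ccontr)
    assume "ww (R ! A y) \<noteq> 0"
    then have "R ! A y \<in> set ?Rp" "y \<in> seen (R ! A y)" using A[OF that(1)] that(1) by (auto simp: seen_def)
    then show False using that(2) xs by blast
  qed
  have hd: "conn (hd (R ! A y)) y" if "y \<in> T" "y \<notin> set xs" for y
    using zero_walk_conn[OF _ zero[OF that]] A[OF that(1)] ok by (auto simp: ok_def)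
  have must: "must \<subseteq> set xs"
  proof
    fix y assume y: "y \<in> must"
    show "y \<in> set xs"
    proof (rule ccontr)
      assume n: "y \<notin> set xs"
      have "y \<in> T" using y by (simp add: must_def)
      moreover from this have "ok (R ! A y)" using A ok nth_mem by blast
      ultimately have "hd (R ! A y) \<in> depots I" "conn (hd (R ! A y)) y"
        using hd n unfolding ok_def by blast+
      then show False using y by (auto simp: must_def)
    qed
  qed
  \<comment> \<open>A walk of weight 0 stays in one component, which has one target, so targets not
    collected lie on different walks.\<close>
  have inj: "inj_on A (T - set xs)"
  proof (rule inj_onI)
    fix y z assume "y \<in> T - set xs" "z \<in> T - set xs" "A y = A z"
    with hd[of y] hd[of z] show "y = z" using T_unique conn_sym
      by (metis DiffD1 DiffD2 rtrancl_trans)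
  qed
  have "card (T - set xs) = card (A ` (T - set xs))" using inj by (simp add: card_image)
  also have "\<dots> \<le> card {i. i < length R \<and> ww (R ! i) = 0}"
    by (rule card_mono) (use A zero in auto)
  also have "\<dots> = length (filter (\<lambda>p. ww p = 0) R)" by (simp add: length_filter_conv_card)
  finally have "card (T - set xs) \<le> length (filter (\<lambda>p. ww p = 0) R)" .
  moreover have "length ?Rp + length (filter (\<lambda>p. ww p = 0) R) = length R"
    using sum_length_filter_compl[of "\<lambda>p. ww p \<noteq> 0" R] by simp
  moreover have "card (T - set xs) = card T - length xs"
    using search_distinct[OF s] by (simp add: card_Diff_subset distinct_card)
  moreover have "length R \<le> vehicles I" using rt by (simp add: routing_iff_ok)
  ultimately have "length ?Rp + card T \<le> vehicles I + length xs" by linarith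
  then show ?thesis using s must len wt lxs by (blast intro: le_trans)
qed

end

section \<open>Colourings by few bit positions\<close>

text \<open>Positional digits serve three times: base 2 for masks, base q + 1 for colour tables,
  base W for search states.\<close>

definition dig :: "nat \<Rightarrow> nat \<Rightarrow> nat \<Rightarrow> nat" where
  "dig b x l = x div b ^ l mod b"

lemma dig_less: "0 < b \<Longrightarrow> dig b x l < b"
  by (simp add: dig_def)

lemma dig_2: "dig 2 x l = of_bool (bit x l)"
  by (simp add: dig_def bit_iff_odd mod2_eq_if)

primrec undig :: "nat \<Rightarrow> nat list \<Rightarrow> nat" where
  "undig b [] = 0"
| "undig b (d # ds) = d + b * undig b ds"

lemma dig_undig:
  assumes "\<forall>d\<in>set ds. d < b" "k < length ds"
  shows "dig b (undig b ds) k = ds ! k"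
  using assms
proof (induction ds arbitrary: k)
  case (Cons d ds)
  show ?case
  proof (cases k)
    case 0
    then show ?thesis using Cons.prems by (simp add: dig_def)
  next
    case (Suc k')
    have "(d + b * undig b ds) div b ^ Suc k' = undig b ds div b ^ k'"
      using Cons.prems by (simp add: div_mult2_eq)
    then show ?thesis using Cons Suc by (simp add: dig_def)
  qed
qed simp

lemma undig_less: "\<forall>d\<in>set ds. d < b \<Longrightarrow> undig b ds < b ^ length ds"
proof (induction ds)
  case (Cons d ds)
  then have "undig b ds + 1 \<le> b ^ length ds" by simp
  then have "b * (undig b ds + 1) \<le> b * b ^ length ds" by (rule mult_le_mono2)
  then show ?case using Cons.prems by simp
qed simp

text \<open>The bits of \<open>x\<close> at the positions selected by the mask \<open>m\<close>,
  packed without gaps and in reversed order. The order is immaterial: what counts is that the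
  pattern determines the selected bits and is small.\<close>

definition pattern :: "nat \<Rightarrow> nat \<Rightarrow> nat \<Rightarrow> nat" where
  "pattern N m x = fold (\<lambda>l a. if dig 2 m l \<noteq> 0 then a + a + dig 2 x l else a) [0..<N] 0"

lemma pattern_Suc:
  "pattern (Suc N) m x =
     (if bit m N then 2 * pattern N m x + of_bool (bit x N) else pattern N m x)"
  by (simp add: pattern_def dig_2)

lemma pattern_0 [simp]: "pattern 0 m x = 0"
  by (simp add: pattern_def)

lemma pattern_less: "pattern N m x < 2 ^ card {l. l < N \<and> bit m l}"
proof (induction N)
  case (Suc N)
  have "{l. l < Suc N \<and> bit m l} = (if bit m N then insert N {l. l < N \<and> bit m l} else {l. l < N \<and> bit m l})"
    by (auto simp: less_Suc_eq)
  then show ?case using Suc by (auto simp: pattern_Suc of_bool_def)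
qed simp

lemma pattern_inject:
  "pattern N m x = pattern N m y \<Longrightarrow> l < N \<Longrightarrow> bit m l \<Longrightarrow> bit x l = bit y l"
proof (induction N arbitrary: l)
  case (Suc N)
  show ?case
  proof (cases "bit m N")
    case True
    then have *: "2 * pattern N m x + of_bool (bit x N) = 2 * pattern N m y + of_bool (bit y N)"
      using Suc.prems by (simp add: pattern_Suc)
    then have "bit x N = bit y N" by (cases "bit x N"; cases "bit y N") (simp; presburger)+
    then show ?thesis using * Suc by (cases "l = N") auto
  next
    case False
    then show ?thesis using Suc by (cases "l = N") (auto simp: pattern_Suc)
  qed
qed simp

text \<open>
  Adding one element to a separated set creates at most one new unseparated pair, and one more bit
  position separates that pair.
\<close>

lemma separating_bits:
  fixes S :: "nat set"
  assumes "finite S" "S \<subseteq> {..<2 ^ L}"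
  shows "\<exists>D\<subseteq>{..<L}. card D \<le> card S \<and> (\<forall>x\<in>S. \<forall>y\<in>S. (\<forall>l\<in>D. bit x l = bit y l) \<longrightarrow> x = y)"
  using assms
proof (induction S rule: finite_induct)
  case empty
  show ?case by (rule exI[of _ "{}"]) simp
next
  case (insert x S)
  then obtain D where D: "D \<subseteq> {..<L}" "card D \<le> card S"
    "\<And>x y. x \<in> S \<Longrightarrow> y \<in> S \<Longrightarrow> \<forall>l\<in>D. bit x l = bit y l \<Longrightarrow> x = y" by auto
  have fD: "finite D" using D(1) finite_subset by blast
  show ?case
  proof (cases "\<exists>y\<in>S. \<forall>l\<in>D. bit x l = bit y l")
    case False
    then show ?thesis using D insert by (intro exI[of _ D]) fastforce
  next
    case True
    then obtain y where y: "y \<in> S" "\<forall>l\<in>D. bit x l = bit y l" by blast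
    have "\<exists>l<L. bit x l \<noteq> bit y l"
    proof (rule ccontr)
      assume "\<not> ?thesis"
      then have "take_bit L x = take_bit L y"
        by (intro bit_eqI) (auto simp: bit_take_bit_iff)
      moreover have "take_bit L x = x" "take_bit L y = y"
        using insert.prems y(1) by (auto intro: take_bit_nat_eq_self)
      ultimately show False using insert.hyps y(1) by simp
    qed
    then obtain l where l: "l < L" "bit x l \<noteq> bit y l" by blast
    have card: "card (insert l D) \<le> card (insert x S)"
      using D(2) insert.hyps fD by (simp add: card_insert_if)
    \<comment> \<open>Since \<open>D\<close> separates \<open>S\<close>, only one element of
      \<open>S\<close> can be confused with \<open>x\<close>.\<close>
    have *: "z = y" if "z \<in> S" "\<forall>l\<in>D. bit x l = bit z l" for z
      using D(3)[OF that(1) y(1)] that(2) y(2) by simp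
    show ?thesis
    proof (intro exI[of _ "insert l D"] conjI ballI impI)
      fix u v assume uv: "u \<in> insert x S" "v \<in> insert x S" "\<forall>l\<in>insert l D. bit u l = bit v l"
      show "u = v"
      proof (cases "u = x"; cases "v = x")
        assume "u = x" "v \<noteq> x" then show ?thesis using uv *[of v] l(2) by auto
      next
        assume "u \<noteq> x" "v = x" then show ?thesis using uv *[of u] l(2) by auto
      next
        assume "u \<noteq> x" "v \<noteq> x" then show ?thesis using uv D(3)[of u v] by auto
      qed simp
    qed (use D(1) l(1) card in auto)
  qed
qed

lemma exists_mask: "D \<subseteq> {..<L} \<Longrightarrow> \<exists>m::nat. m < 2 ^ L \<and> (\<forall>l. bit m l \<longleftrightarrow> l \<in> D)"
proof -
  assume D: "D \<subseteq> {..<L}"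
  let ?ds = "map (\<lambda>l. of_bool (l \<in> D)) [0..<L] :: nat list"
  let ?m = "undig 2 ?ds"
  have ds: "\<forall>d\<in>set ?ds. d < 2" by auto
  have m: "?m < 2 ^ L" using undig_less[OF ds] by simp
  have "bit ?m l \<longleftrightarrow> l \<in> D" for l
  proof (cases "l < L")
    case True
    then have "of_bool (bit ?m l) = (of_bool (l \<in> D) :: nat)"
      using dig_undig[OF ds, of l] by (simp add: dig_2)
    then show ?thesis by (simp only: of_bool_eq_iff)
  next
    case False
    then have "(2::nat) ^ L \<le> 2 ^ l" by (intro power_increasing) auto
    with m have "?m < 2 ^ l" by (rule less_le_trans)
    then have "?m div 2 ^ l = 0" by (rule div_less)
    then show ?thesis using False D by (auto simp: bit_iff_odd)
  qed
  with m show ?thesis by blast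
qed

text \<open>
  The cut-off at \<open>B\<close> is never effective for the colourings that are needed; it is there because
  programs can only raise to powers up to \<open>B\<close>.
\<close>

definition colour :: "nat \<Rightarrow> nat \<Rightarrow> nat \<Rightarrow> nat \<Rightarrow> nat \<Rightarrow> nat" where
  "colour B q m k x = dig (Suc q) k (min (pattern B m x) B)"

text \<open>Take L with 2^L \<le> n < 2^(L + 1). Then L + 1 bits suffice for vertices and masks, so
  masks are below 2 n. At most \<open>q\<close> selected positions give patterns below 2^q, and a
  table is the number whose 2^q digits in base q + 1 are the colours. Patterns of no element get
  colour 0.\<close>

lemma exists_colouring:
  assumes xs: "distinct xs" "set xs \<subseteq> {..<n}" "length xs \<le> q" and n: "0 < n"
    and B: "2 * n \<le> B" "2 ^ q \<le> B"
  shows "\<exists>m k. m < 2 * n \<and> k < Suc q ^ 2 ^ q \<and> (\<forall>i<length xs. colour B q m k (xs ! i) = i)"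
proof -
  obtain L where L: "2 ^ L \<le> n" "n < 2 ^ Suc L" using ex_power_ivl1[of 2 n] n by auto
  have S: "set xs \<subseteq> {..<2 ^ Suc L}" using xs(2) L(2) by auto
  then obtain D where D: "D \<subseteq> {..<Suc L}" "card D \<le> card (set xs)"
    "\<And>x y. x \<in> set xs \<Longrightarrow> y \<in> set xs \<Longrightarrow> \<forall>l\<in>D. bit x l = bit y l \<Longrightarrow> x = y"
    using separating_bits[of "set xs" "Suc L"] by blast
  obtain m :: nat where m: "m < 2 ^ Suc L" "\<And>l. bit m l \<longleftrightarrow> l \<in> D"
    using exists_mask[OF D(1)] by blast
  have LB: "Suc L \<le> B"
  proof -
    have "Suc L \<le> 2 ^ L" using less_exp[of L] by (simp only: Suc_le_eq)
    then show ?thesis using L B by linarith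
  qed
  let ?p = "pattern B m"
  have "{l. l < B \<and> bit m l} = D" using m(2) D(1) LB by auto
  then have p_less: "?p x < 2 ^ q" for x
  proof -
    have "card D \<le> q" using D(2) xs by (simp add: distinct_card)
    then have "(2::nat) ^ card D \<le> 2 ^ q" by (rule power_increasing) simp
    then show ?thesis using pattern_less[of B m x] \<open>{l. l < B \<and> bit m l} = D\<close>
      by (metis less_le_trans)
  qed
  have p_inj: "x = y" if "x \<in> set xs" "y \<in> set xs" "?p x = ?p y" for x y
    using D(3)[OF that(1,2)] pattern_inject[OF that(3)] m(2) D(1) LB by fastforce
  define c where
    "c p = (if \<exists>i<length xs. ?p (xs ! i) = p then SOME i. i < length xs \<and> ?p (xs ! i) = p else 0)" for p
  let ?ds = "map c [0..<2 ^ q]"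
  have c: "c (?p (xs ! i)) = i" if "i < length xs" for i
  proof -
    let ?P = "\<lambda>j. j < length xs \<and> ?p (xs ! j) = ?p (xs ! i)"
    have "?P (SOME j. ?P j)" by (rule someI[of ?P i]) (use that in simp)
    then have "xs ! (SOME j. ?P j) = xs ! i" using p_inj that nth_mem by blast
    with \<open>?P (SOME j. ?P j)\<close> have "(SOME j. ?P j) = i" using xs(1) that by (simp add: nth_eq_iff_index_eq)
    then show ?thesis using that by (auto simp: c_def)
  qed
  have ds_less: "\<forall>d\<in>set ?ds. d < Suc q"
  proof
    fix d assume "d \<in> set ?ds"
    then obtain p where p: "d = c p" by auto
    show "d < Suc q"
    proof (cases "\<exists>i<length xs. ?p (xs ! i) = p")
      case True
      then obtain i where "i < length xs" "?p (xs ! i) = p" by blast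
      then have "d = i" using c p by blast
      then show ?thesis using \<open>i < length xs\<close> xs(3) by simp
    next
      case False
      then show ?thesis using p by (auto simp: c_def)
    qed
  qed
  let ?k = "undig (Suc q) ?ds"
  have "colour B q m ?k (xs ! i) = i" if "i < length xs" for i
  proof -
    have "min (?p (xs ! i)) B = ?p (xs ! i)" using p_less[of "xs ! i"] B(2) by simp
    then have "colour B q m ?k (xs ! i) = ?ds ! ?p (xs ! i)"
      unfolding colour_def using dig_undig[OF ds_less, of "?p (xs ! i)"] p_less[of "xs ! i"] by simp
    also have "\<dots> = c (?p (xs ! i))" using p_less[of "xs ! i"] by (subst nth_map) simp_all
    finally show ?thesis using c[OF that] by metis
  qed
  moreover have "?k < Suc q ^ 2 ^ q" using undig_less[OF ds_less] by simp
  moreover have "m < 2 * n" using m(1) L(1) by simp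
  ultimately show ?thesis by blast
qed

section \<open>The state graph\<close>

context cvrp
begin

text \<open>The least client of a component is a representative that a bounded search over smaller
  vertices can recognise.\<close>

definition targets :: "nat set" where
  "targets = {c \<in> clients I. \<forall>y<c. \<not> (y \<in> clients I \<and> conn y c)}"

lemma cvrp_targets: "cvrp_targets I n targets"
proof
  show "targets \<subseteq> clients I" by (auto simp: targets_def)
  fix c assume c: "c \<in> clients I"
  let ?P = "\<lambda>y. y \<in> clients I \<and> conn y c"
  let ?x = "LEAST y. ?P y"
  have P: "?P ?x" by (rule LeastI[of ?P c]) (use c in simp)
  have "?x \<in> targets" unfolding targets_def
  proof (safe)
    show "?x \<in> clients I" using P by simp
    fix y assume y: "y < ?x" "y \<in> clients I" "conn y ?x"
    then have "?P y" using P by (auto intro: rtrancl_trans)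
    then show False using not_less_Least[OF y(1)] by simp
  qed
  then show "\<exists>x\<in>targets. conn x c" using P by blast
next
  fix x y assume xy: "x \<in> targets" "y \<in> targets" "conn x y"
  then have "conn y x" using conn_sym by simp
  with xy have "\<not> x < y" "\<not> y < x" by (auto simp: targets_def)
  then show "x = y" by simp
qed

end

text \<open>The bounds on \<open>W\<close> make each state component a digit: masks and the extra
  position n, then counts and weights, then colour tables. Nine digits give the exponent in the
  bound on \<open>B\<close>.\<close>

locale cvrp_state = cvrp +
  fixes r W B :: nat
  assumes W: "2 * n \<le> W" "2 * r < W" "Suc (2 * r) ^ 2 ^ (2 * r) \<le> W" and n: "0 < n"
    and B: "W ^ 9 \<le> B"
begin

sublocale cvrp_targets I n targets r
  by (rule cvrp_targets)

text \<open>
  The base-\<open>W\<close> digits of a state are: bit mask and table of the colouring (0, 1), start and current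
  vertex of the current walk (2, 3), number of collected targets (4) and of those that no depot can
  serve for free (5), weight of the current walk (6) and of all walks (7), number of walks (8).
\<close>

abbreviation fld :: "nat \<Rightarrow> nat \<Rightarrow> nat" where "fld k s \<equiv> dig W s k"

text \<open>Digits 0 and 1 are unconstrained: this is where the colouring is guessed.\<close>

definition init :: "nat \<Rightarrow> bool" where
  "init s \<longleftrightarrow> fld 2 s = n \<and> fld 3 s = n \<and> fld 4 s = 0 \<and> fld 5 s = 0 \<and> fld 6 s = 0 \<and> fld 7 s = 0 \<and> fld 8 s = 0"

definition move_step :: "nat \<Rightarrow> nat \<Rightarrow> bool" where
  "move_step s s' \<longleftrightarrow> fld 2 s' = fld 2 s \<and> fld 4 s' = fld 4 s \<and> fld 5 s' = fld 5 s \<and>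
     fld 8 s' = fld 8 s \<and> (fld 3 s, fld 3 s') \<in> E \<and>
     fld 6 s' = fld 6 s + w (fld 3 s, fld 3 s') \<and> fld 7 s' = fld 7 s + w (fld 3 s, fld 3 s') \<and>
     fld 6 s' \<le> gas I \<and> fld 7 s' \<le> r"

text \<open>
  Demanding that the \<open>i\<close>-th collected target has colour \<open>i\<close> makes the collected targets distinct
  without storing them.
\<close>

definition collect_step :: "nat \<Rightarrow> nat \<Rightarrow> nat \<Rightarrow> bool" where
  "collect_step y s s' \<longleftrightarrow> fld 2 s' = fld 2 s \<and> fld 3 s' = fld 3 s \<and> fld 6 s' = fld 6 s \<and>
     fld 7 s' = fld 7 s \<and> fld 8 s' = fld 8 s \<and> y \<in> targets \<and> conn y (fld 3 s) \<and>
     colour B (2 * r) (fld 0 s) (fld 1 s) y = fld 4 s \<and>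
     fld 4 s' = fld 4 s + 1 \<and> fld 5 s' = fld 5 s + of_bool (y \<in> must)"

definition new_step :: "nat \<Rightarrow> nat \<Rightarrow> bool" where
  "new_step s s' \<longleftrightarrow> fld 3 s = fld 2 s \<and> fld 3 s' = fld 2 s' \<and> fld 2 s' \<in> depots I \<and>
     fld 4 s' = fld 4 s \<and> fld 5 s' = fld 5 s \<and> fld 6 s' = 0 \<and> fld 7 s' = fld 7 s \<and>
     fld 8 s' = fld 8 s + 1"

definition step :: "nat \<Rightarrow> nat \<Rightarrow> bool" where
  "step s s' \<longleftrightarrow> fld 0 s' = fld 0 s \<and> fld 1 s' = fld 1 s \<and>
     (move_step s s' \<or> (\<exists>y. collect_step y s s') \<or> new_step s s')"

text \<open>Collected targets are distinct, so collecting as many elements of \<open>must\<close> as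
  exist means collecting all of them. The inequality charges one free walk to every remaining
  target.\<close>

definition final :: "nat \<Rightarrow> bool" where
  "final s \<longleftrightarrow> fld 3 s = fld 2 s \<and> fld 5 s = card must \<and>
     fld 8 s + card targets \<le> vehicles I + fld 4 s"

definition steps :: "(nat \<times> nat) set" where
  "steps = {(s, s'). s < B \<and> s' < B \<and> step s s'}"

lemma finite_must: "finite must"
  using finite_T by (auto simp: must_def)

text \<open>The list is recovered along the path. Its colours are below the count in digit 4,
  whereas a newly collected target has exactly that colour and hence is not yet in the list.\<close>

lemma steps_search:
  assumes "(s0, s) \<in> steps\<^sup>*" "init s0"
  shows "\<exists>xs. search (fld 2 s) (fld 3 s) xs (fld 6 s) (fld 7 s) (fld 8 s) \<and> length xs = fld 4 s \<and>
    card (set xs \<inter> must) = fld 5 s \<and> (\<forall>y\<in>set xs. colour B (2 * r) (fld 0 s) (fld 1 s) y < fld 4 s)"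
  using assms
proof (induction rule: rtrancl_induct)
  case base
  then show ?case using start by (intro exI[of _ "[]"]) (auto simp: init_def)
next
  case (step s s')
  then obtain xs where
    xs: "search (fld 2 s) (fld 3 s) xs (fld 6 s) (fld 7 s) (fld 8 s)" "length xs = fld 4 s"
    "card (set xs \<inter> must) = fld 5 s" "\<forall>y\<in>set xs. colour B (2 * r) (fld 0 s) (fld 1 s) y < fld 4 s"
    by blast
  have st: "step s s'" using step(2) by (simp add: steps_def)
  then have same: "fld 0 s' = fld 0 s" "fld 1 s' = fld 1 s" by (simp_all add: step_def)
  from st consider "move_step s s'" | y where "collect_step y s s'" | "new_step s s'"
    unfolding step_def by blast
  then show ?case
  proof cases
    case 1
    note move = 1[unfolded move_step_def]
    have "search (fld 2 s') (fld 3 s') xs (fld 6 s') (fld 7 s') (fld 8 s')"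
      using search.move[OF xs(1), of "fld 3 s'"] move by simp
    then show ?thesis using xs move same by (intro exI[of _ xs]) simp
  next
    case 2
    note collect = 2[unfolded collect_step_def]
    have y: "y \<notin> set xs" using collect xs(4) by auto
    then have "search (fld 2 s') (fld 3 s') (y # xs) (fld 6 s') (fld 7 s') (fld 8 s')"
      using search.collect[OF xs(1), of y] collect y by simp
    moreover have "card (set (y # xs) \<inter> must) = fld 5 s'"
      using y collect xs(3) finite_must by (cases "y \<in> must") (auto simp: card_insert_if)
    ultimately show ?thesis using xs collect same
      by (intro exI[of _ "y # xs"]) (auto simp: less_Suc_eq)
  next
    case 3
    note new = 3[unfolded new_step_def]
    have "search (fld 2 s') (fld 3 s') xs (fld 6 s') (fld 7 s') (fld 8 s')"
      using search.new[of "fld 2 s" xs "fld 6 s" "fld 7 s" "fld 8 s" "fld 2 s'"] xs(1) new by simp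
    then show ?thesis using xs new same by (intro exI[of _ xs]) simp
  qed
qed

definition state :: "nat \<Rightarrow> nat \<Rightarrow> nat \<Rightarrow> nat \<Rightarrow> nat list \<Rightarrow> nat \<Rightarrow> nat \<Rightarrow> nat \<Rightarrow> nat" where
  "state m k d v xs x t j = undig W [m, k, d, v, length xs, card (set xs \<inter> must), x, t, j]"

lemma search_bounds: "search d v xs x t j \<Longrightarrow> d \<le> n \<and> v \<le> n \<and> x \<le> t \<and> t \<le> r"
  by (induction rule: search.induct) (auto dest: E_verts depots_less)

lemma n_less_W: "n < W" and r_less_W: "r < W"
  using W n by auto

lemma state_digits:
  assumes "search d v xs x t j" "m < W" "k < W" "length xs < W" "j < W"
  shows "\<forall>a\<in>set [m, k, d, v, length xs, card (set xs \<inter> must), x, t, j]. a < W"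
proof -
  have "card (set xs \<inter> must) \<le> card (set xs)" by (rule card_mono) auto
  also have "\<dots> \<le> length xs" by (rule card_length)
  finally show ?thesis using search_bounds[OF assms(1)] assms(2-) n_less_W r_less_W by auto
qed

lemma state_less:
  assumes "search d v xs x t j" "m < W" "k < W" "length xs < W" "j < W"
  shows "state m k d v xs x t j < B"
proof -
  have "length [m, k, d, v, length xs, card (set xs \<inter> must), x, t, j] = 9" by simp
  then have "state m k d v xs x t j < W ^ 9"
    using undig_less[OF state_digits[OF assms]] unfolding state_def by metis
  then show ?thesis using B by (rule less_le_trans)
qed

lemma fld_state:
  assumes "search d v xs x t j" "m < W" "k < W" "length xs < W" "j < W"
  shows "fld 0 (state m k d v xs x t j) = m" "fld 1 (state m k d v xs x t j) = k"
    "fld 2 (state m k d v xs x t j) = d" "fld 3 (state m k d v xs x t j) = v"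
    "fld 4 (state m k d v xs x t j) = length xs"
    "fld 5 (state m k d v xs x t j) = card (set xs \<inter> must)"
    "fld 6 (state m k d v xs x t j) = x" "fld 7 (state m k d v xs x t j) = t"
    "fld 8 (state m k d v xs x t j) = j"
  unfolding state_def by (subst dig_undig[OF state_digits[OF assms]]; simp)+

text \<open>Targets are added in front, so \<open>rev xs\<close> is the order of collection. The
  colour condition passes to shorter lists, so a colouring chosen for the final list works along the
  entire search.\<close>

lemma search_steps:
  assumes "search d v xs x t j" "m < W" "k < W" "length xs < W" "j < W"
    "\<forall>i<length xs. colour B (2 * r) m k (rev xs ! i) = i"
  shows "\<exists>s0. s0 < B \<and> init s0 \<and> (s0, state m k d v xs x t j) \<in> steps\<^sup>*"
  using assms
proof (induction rule: search.induct)
  case start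
  note st = search.start start
  show ?case
    by (intro exI[of _ "state m k n n [] 0 0 0"] conjI)
      (use state_less[OF st(1-5)] fld_state[OF st(1-5)] in \<open>auto simp: init_def\<close>)
next
  case (move d v xs x t j v')
  let ?s = "state m k d v xs x t j" and ?s' = "state m k d v' xs (x + w (v, v')) (t + w (v, v')) j"
  have s': "search d v' xs (x + w (v, v')) (t + w (v, v')) j"
    using search.move move by blast
  have "step ?s ?s'"
    unfolding step_def move_step_def using move fld_state[OF move(1)] fld_state[OF s'] by simp
  then have "(?s, ?s') \<in> steps"
    using state_less[OF move(1)] state_less[OF s'] move by (simp add: steps_def)
  then show ?case using move by (meson rtrancl.rtrancl_into_rtrancl)
next
  case (collect d v xs x t j y)
  let ?s = "state m k d v xs x t j" and ?s' = "state m k d v (y # xs) x t j"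
  have s': "search d v (y # xs) x t j" using search.collect collect by blast
  have c: "colour B (2 * r) m k (rev xs ! i) = i" if "i < length xs" for i
    using collect.prems(5)[rule_format, of i] that by (simp add: nth_append)
  have y: "colour B (2 * r) m k y = length xs"
    using collect.prems(5)[rule_format, of "length xs"] by (simp add: nth_append)
  have l: "length xs < W" using collect.prems by simp
  have "step ?s ?s'"
    unfolding step_def collect_step_def using collect fld_state[OF collect(1) collect.prems(1,2) l collect.prems(4)]
      fld_state[OF s' collect.prems(1-4)] y finite_must
    by (intro conjI disjI2 disjI1 exI[of _ y]) (auto simp: card_insert_if)
  then have "(?s, ?s') \<in> steps"
    using state_less[OF collect(1)] state_less[OF s'] collect.prems l by (simp add: steps_def)
  moreover have "\<exists>s0. s0 < B \<and> init s0 \<and> (s0, ?s) \<in> steps\<^sup>*"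
    using collect.IH[OF collect.prems(1,2) l collect.prems(4)] c by blast
  ultimately show ?case by (meson rtrancl.rtrancl_into_rtrancl)
next
  case (new d xs x t j d')
  let ?s = "state m k d d xs x t j" and ?s' = "state m k d' d' xs 0 t (Suc j)"
  have s': "search d' d' xs 0 t (Suc j)" using search.new new by blast
  have j: "j < W" using new.prems by simp
  have "step ?s ?s'"
    unfolding step_def new_step_def using new(2) fld_state[OF new(1) new.prems(1-3) j] fld_state[OF s' new.prems(1-4)]
    by simp
  then have "(?s, ?s') \<in> steps"
    using state_less[OF new(1) new.prems(1-3) j] state_less[OF s' new.prems(1-4)] by (simp add: steps_def)
  then show ?case using new.IH[OF new.prems(1-3) j new.prems(5)] by (meson rtrancl.rtrancl_into_rtrancl)
qed

theorem routing_iff_steps: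
  "(\<exists>R A. routing I R A \<and> routing_weight I R \<le> r) \<longleftrightarrow>
     (\<exists>s0 s. s0 < B \<and> s < B \<and> init s0 \<and> (s0, s) \<in> steps\<^sup>* \<and> final s)"
proof
  assume "\<exists>R A. routing I R A \<and> routing_weight I R \<le> r"
  then obtain d xs x t j where s: "search d d xs x t j" "must \<subseteq> set xs"
    "j + card targets \<le> vehicles I + length xs" "j \<le> r" "length xs \<le> 2 * r"
    using search_if_routing by blast
  have B': "W \<le> B"
  proof -
    have "W ^ 1 \<le> W ^ 9" using n_less_W by (intro power_increasing) auto
    then show ?thesis using B by simp
  qed
  \<comment> \<open>This makes the cut-off in \<open>colour\<close> harmless. The case r = 0 is
    separate because the base 2 r + 1 is then only 1.\<close>
  have "(2::nat) ^ (2 * r) \<le> W"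
  proof (cases "r = 0")
    case True then show ?thesis using W by simp
  next
    case False
    have "(2::nat) ^ (2 * r) \<le> Suc (2 * r) ^ (2 * r)" using False by (intro power_mono) auto
    also have "\<dots> \<le> Suc (2 * r) ^ 2 ^ (2 * r)"
      using less_exp[of "2 * r"] by (intro power_increasing) auto
    finally show ?thesis using W by simp
  qed
  then obtain m k where mk: "m < 2 * n" "k < Suc (2 * r) ^ 2 ^ (2 * r)"
    "\<forall>i<length (rev xs). colour B (2 * r) m k (rev xs ! i) = i"
    using exists_colouring[of "rev xs" n "2 * r" B] search_distinct[OF s(1)] s(5) n W B' T_less
    by (auto simp: subset_iff)
  have lt: "m < W" "k < W" "length xs < W" "j < W" using mk W s r_less_W by auto
  from search_steps[OF s(1) lt] mk(3) obtain s0 where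
    s0: "s0 < B" "init s0" "(s0, state m k d d xs x t j) \<in> steps\<^sup>*" by auto
  have "set xs \<inter> must = must" using s(2) by blast
  then have "final (state m k d d xs x t j)"
    unfolding final_def using fld_state[OF s(1) lt] s(3) by simp
  then show "\<exists>s0 s. s0 < B \<and> s < B \<and> init s0 \<and> (s0, s) \<in> steps\<^sup>* \<and> final s"
    using s0 state_less[OF s(1) lt] by blast
next
  assume "\<exists>s0 s. s0 < B \<and> s < B \<and> init s0 \<and> (s0, s) \<in> steps\<^sup>* \<and> final s"
  then obtain s0 s where s: "init s0" "(s0, s) \<in> steps\<^sup>*" "final s" by blast
  from steps_search[OF s(2,1)] obtain xs where
    xs: "search (fld 2 s) (fld 3 s) xs (fld 6 s) (fld 7 s) (fld 8 s)" "length xs = fld 4 s"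
    "card (set xs \<inter> must) = fld 5 s" by blast
  have "set xs \<inter> must = must"
    by (rule card_subset_eq[OF finite_must]) (use xs s(3) in \<open>auto simp: final_def\<close>)
  then have "must \<subseteq> set xs" by blast
  with xs s(3) show "\<exists>R A. routing I R A \<and> routing_weight I R \<le> r"
    by (intro routing_if_search[of "fld 2 s" xs "fld 6 s" "fld 7 s" "fld 8 s"]) (auto simp: final_def)
qed

end

section \<open>Arithmetic and reachability as loop programs\<close>

text \<open>All variables read by an expression, bound ones included, lie below this number, so the
  number itself is a fresh variable.\<close>

primrec var_bound :: "expr \<Rightarrow> nat" where
  "var_bound (V x) = Suc x"
| "var_bound (C c) = 0"
| "var_bound Bound = 0"
| "var_bound (Mem e) = var_bound e"
| "var_bound (Plus e f) = max (var_bound e) (var_bound f)"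
| "var_bound (Minus e f) = max (var_bound e) (var_bound f)"
| "var_bound (Cond e f g) = max (var_bound e) (max (var_bound f) (var_bound g))"
| "var_bound (Iter a i e f) = max (var_bound e) (var_bound f)"

lemma ev_cong: "(\<And>x. x < var_bound e \<Longrightarrow> \<rho> x = \<rho>' x) \<Longrightarrow> ev B e \<rho> M = ev B e \<rho>' M"
proof (induction e arbitrary: \<rho> \<rho>')
  case (Iter a i e f)
  have "ev B f (\<rho>(a := x, i := j)) M = ev B f (\<rho>'(a := x, i := j)) M" for x j
    by (rule Iter.IH(2)) (use Iter.prems in auto)
  moreover have "ev B e \<rho> M = ev B e \<rho>' M" by (rule Iter.IH(1)) (use Iter.prems in auto)
  ultimately show ?case by simp
next
  case (Cond e f g)
  have "ev B e \<rho> M = ev B e \<rho>' M" by (rule Cond.IH(1)) (use Cond.prems in auto)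
  moreover have "ev B f \<rho> M = ev B f \<rho>' M" by (rule Cond.IH(2)) (use Cond.prems in auto)
  moreover have "ev B g \<rho> M = ev B g \<rho>' M" by (rule Cond.IH(3)) (use Cond.prems in auto)
  ultimately show ?case by simp
next
  case (Plus e f)
  have "ev B e \<rho> M = ev B e \<rho>' M" by (rule Plus.IH(1)) (use Plus.prems in auto)
  moreover have "ev B f \<rho> M = ev B f \<rho>' M" by (rule Plus.IH(2)) (use Plus.prems in auto)
  ultimately show ?case by simp
next
  case (Minus e f)
  have "ev B e \<rho> M = ev B e \<rho>' M" by (rule Minus.IH(1)) (use Minus.prems in auto)
  moreover have "ev B f \<rho> M = ev B f \<rho>' M" by (rule Minus.IH(2)) (use Minus.prems in auto)
  ultimately show ?case by simp
next
  case (Mem e)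
  have "ev B e \<rho> M = ev B e \<rho>' M" by (rule Mem.IH) (use Mem.prems in auto)
  then show ?case by simp
qed auto

lemma ev_fresh [simp]: "var_bound e \<le> a \<Longrightarrow> ev B e (\<rho>(a := x)) M = ev B e \<rho> M"
  by (rule ev_cong) auto

section \<open>Truth values and arithmetic by bounded loops\<close>

definition Not' :: "expr \<Rightarrow> expr" where "Not' e = Cond e (C 0) (C 1)"
definition And :: "expr \<Rightarrow> expr \<Rightarrow> expr" where "And e f = Cond e f (C 0)"
definition Or :: "expr \<Rightarrow> expr \<Rightarrow> expr" where "Or e f = Cond e (C 1) f"
text \<open>Nonzero means true. The truth value of \<open>Less\<close> is a difference, which is why
  \<open>Bool\<close> normalises values before they are counted.\<close>

definition Less :: "expr \<Rightarrow> expr \<Rightarrow> expr" where "Less e f = Minus f e"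
definition Leq :: "expr \<Rightarrow> expr \<Rightarrow> expr" where "Leq e f = Not' (Minus e f)"
definition Eq :: "expr \<Rightarrow> expr \<Rightarrow> expr" where "Eq e f = And (Leq e f) (Leq f e)"
definition Bool :: "expr \<Rightarrow> expr" where "Bool e = Cond e (C 1) (C 0)"

text \<open>The accumulator lies above \<open>i\<close> and above everything read by
  \<open>e\<close>, so \<open>e\<close> cannot see it.\<close>

definition Sum :: "nat \<Rightarrow> expr \<Rightarrow> expr" where
  "Sum i e = (let a = max (var_bound e) (Suc i) in Iter a i (C 0) (Plus (V a) e))"

definition Ex' :: "nat \<Rightarrow> expr \<Rightarrow> expr" where "Ex' i e = Sum i (Bool e)"

text \<open>Adds \<open>f\<close> once for every number below \<open>e\<close>. As loops stop at the
  bound, the first factor is cut off there; quotients and exponents are affected likewise, whence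
  the \<open>min\<close> in the evaluation rules.\<close>

definition Times :: "expr \<Rightarrow> expr \<Rightarrow> expr" where
  "Times e f = (let i = max (var_bound e) (var_bound f) in Sum i (Cond (Less (V i) e) f (C 0)))"

definition Div :: "expr \<Rightarrow> expr \<Rightarrow> expr" where
  "Div e f = (let i = max (var_bound e) (var_bound f) in
     Sum i (Bool (Leq (Times (Plus (V i) (C 1)) f) e)))"

definition Mod :: "expr \<Rightarrow> expr \<Rightarrow> expr" where
  "Mod e f = Minus e (Times (Div e f) f)"

definition Pow :: "expr \<Rightarrow> expr \<Rightarrow> expr" where
  "Pow e f = (let i = max (var_bound e) (var_bound f) in
     Iter (Suc i) i (C 1) (Cond (Less (V i) f) (Times e (V (Suc i))) (V (Suc i))))"

definition Dig :: "expr \<Rightarrow> expr \<Rightarrow> expr \<Rightarrow> expr" where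
  "Dig b x l = Mod (Div x (Pow b l)) b"

lemma ev_connectives [simp]:
  "0 < ev B (Not' e) \<rho> M \<longleftrightarrow> \<not> 0 < ev B e \<rho> M"
  "0 < ev B (And e f) \<rho> M \<longleftrightarrow> 0 < ev B e \<rho> M \<and> 0 < ev B f \<rho> M"
  "0 < ev B (Or e f) \<rho> M \<longleftrightarrow> 0 < ev B e \<rho> M \<or> 0 < ev B f \<rho> M"
  "0 < ev B (Less e f) \<rho> M \<longleftrightarrow> ev B e \<rho> M < ev B f \<rho> M"
  "0 < ev B (Leq e f) \<rho> M \<longleftrightarrow> ev B e \<rho> M \<le> ev B f \<rho> M"
  "0 < ev B (Eq e f) \<rho> M \<longleftrightarrow> ev B e \<rho> M = ev B f \<rho> M"
  "ev B (Bool e) \<rho> M = of_bool (0 < ev B e \<rho> M)"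
  "ev B (Leq e f) \<rho> M = of_bool (ev B e \<rho> M \<le> ev B f \<rho> M)"
  "ev B (Less e f) \<rho> M = ev B f \<rho> M - ev B e \<rho> M"
  by (auto simp: Not'_def And_def Or_def Less_def Leq_def Eq_def Bool_def)

lemma fold_upt_cong:
  "(\<And>j x. j < N \<Longrightarrow> f j x = g j x) \<Longrightarrow> fold f [0..<N] x = fold g [0..<N] x"
  by (rule fold_cong) auto

lemma fold_plus_eq_sum: "fold (\<lambda>j s. s + f j) [0..<N] 0 = (\<Sum>j<N. f j :: nat)"
  by (induction N) auto

lemma ev_Sum [simp]: "ev B (Sum i e) \<rho> M = (\<Sum>j<B. ev B e (\<rho>(i := j)) M)"
proof -
  let ?a = "max (var_bound e) (Suc i)"
  have "ev B e (\<rho>(?a := x, i := j)) M = ev B e (\<rho>(i := j)) M" for x j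
    by (rule ev_cong) auto
  moreover have "?a \<noteq> i" by linarith
  ultimately show ?thesis by (simp add: Sum_def Let_def fold_plus_eq_sum)
qed

lemma sum_upt_pos:
  fixes f :: "nat \<Rightarrow> nat"
  shows "0 < (\<Sum>j<N. f j) \<longleftrightarrow> (\<exists>j<N. 0 < f j)"
  by (induction N) (auto simp: less_Suc_eq)

lemma ev_Ex [simp]: "0 < ev B (Ex' i e) \<rho> M \<longleftrightarrow> (\<exists>j<B. 0 < ev B e (\<rho>(i := j)) M)"
  unfolding Ex'_def ev_Sum sum_upt_pos by simp

lemma ev_Times [simp]: "ev B (Times e f) \<rho> M = min (ev B e \<rho> M) B * ev B f \<rho> M"
proof -
  have "(\<Sum>j<N. if j < x then y else 0) = min x N * y" for N x y :: nat
    by (induction N) (auto simp: min_def le_Suc_eq algebra_simps)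
  then show ?thesis by (simp add: Times_def Let_def not_le cong: if_cong)
qed

lemma sum_count_multiples:
  fixes x y N :: nat
  assumes "0 < y"
  shows "(\<Sum>j<N. of_bool (Suc j * y \<le> x)) = min (x div y) N"
proof (induction N)
  case (Suc N)
  have "Suc N * y \<le> x \<longleftrightarrow> Suc N \<le> x div y" using assms by (simp add: less_eq_div_iff_mult_less_eq)
  then show ?case using Suc by (auto simp: min_def)
qed simp

lemma ev_Div [simp]:
  assumes "0 < ev B f \<rho> M"
  shows "ev B (Div e f) \<rho> M = min (ev B e \<rho> M div ev B f \<rho> M) B"
proof -
  have "ev B (Div e f) \<rho> M = (\<Sum>j<B. of_bool (Suc j * ev B f \<rho> M \<le> ev B e \<rho> M))"
    by (auto simp: Div_def Let_def intro!: sum.cong)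
  then show ?thesis using sum_count_multiples[OF assms] by simp
qed

lemma ev_Mod [simp]:
  assumes "0 < ev B f \<rho> M" "ev B e \<rho> M \<le> B"
  shows "ev B (Mod e f) \<rho> M = ev B e \<rho> M mod ev B f \<rho> M"
proof -
  have "ev B e \<rho> M div ev B f \<rho> M \<le> B" using assms(2) div_le_dividend le_trans by blast
  then show ?thesis
    using assms(1) by (simp add: Mod_def min_absorb1 minus_div_mult_eq_mod[symmetric])
qed

lemma ev_Pow [simp]:
  assumes "ev B e \<rho> M \<le> B"
  shows "ev B (Pow e f) \<rho> M = ev B e \<rho> M ^ min (ev B f \<rho> M) B"
proof -
  have *: "fold (\<lambda>j x. if j < k then b * x else x) [0..<N] 1 = b ^ min k N" for b k N :: nat
    by (induction N) (auto simp: min_def not_less le_Suc_eq)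
  show ?thesis
    unfolding Pow_def Let_def ev.simps *[symmetric]
    by (rule fold_upt_cong) (use assms in \<open>simp add: min_absorb1\<close>)
qed

lemma ev_Dig [simp]:
  assumes "0 < ev B b \<rho> M" "ev B b \<rho> M \<le> B" "ev B x \<rho> M \<le> B"
  shows "ev B (Dig b x l) \<rho> M = dig (ev B b \<rho> M) (ev B x \<rho> M) (min (ev B l \<rho> M) B)"
proof -
  let ?p = "ev B b \<rho> M ^ min (ev B l \<rho> M) B"
  have "ev B x \<rho> M div ?p \<le> B" using assms(3) div_le_dividend le_trans by blast
  then show ?thesis using assms by (simp add: Dig_def dig_def)
qed

definition Pattern :: "nat \<Rightarrow> expr \<Rightarrow> expr \<Rightarrow> expr" where
  "Pattern i m x = Iter (Suc i) i (C 0)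
     (Cond (Dig (C 2) m (V i)) (Plus (Plus (V (Suc i)) (V (Suc i))) (Dig (C 2) x (V i))) (V (Suc i)))"

lemma ev_Pattern:
  assumes "ev B m \<rho> M \<le> B" "ev B x \<rho> M \<le> B" "2 \<le> B" "var_bound m \<le> i" "var_bound x \<le> i"
  shows "ev B (Pattern i m x) \<rho> M = pattern B (ev B m \<rho> M) (ev B x \<rho> M)"
  unfolding pattern_def Pattern_def ev.simps
  by (rule fold_upt_cong) (use assms in auto)

definition Colour :: "expr \<Rightarrow> expr \<Rightarrow> expr \<Rightarrow> expr \<Rightarrow> expr" where
  "Colour q m k x = Dig (Plus q (C 1)) k (Pattern (max (var_bound m) (var_bound x)) m x)"

lemma ev_Colour [simp]:
  assumes "ev B m \<rho> M \<le> B" "ev B x \<rho> M \<le> B" "2 \<le> B" "ev B q \<rho> M < B" "ev B k \<rho> M \<le> B"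
  shows "ev B (Colour q m k x) \<rho> M = colour B (ev B q \<rho> M) (ev B m \<rho> M) (ev B k \<rho> M) (ev B x \<rho> M)"
  using assms by (simp add: Colour_def colour_def ev_Pattern)

text \<open>Relaxation in place: a nonzero cell at \<open>base\<close> plus s marks s as reached.
  Variables 1 and 2 range over sources and targets of steps; the loops over 3 and 4 merely repeat
  the round.\<close>

definition Closure :: "expr \<Rightarrow> expr \<Rightarrow> expr \<Rightarrow> cmd" where
  "Closure base init step =
     Then (For 1 (Put (Plus base (V 1)) init))
       (For 3 (For 4 (For 1 (For 2 (Put (Plus base (V 2))
          (Cond (And (Mem (Plus base (V 1))) step) (C 1) (Mem (Plus base (V 2)))))))))"

definition outside :: "nat \<Rightarrow> nat \<Rightarrow> (nat \<Rightarrow> nat) \<Rightarrow> (nat \<Rightarrow> nat) \<Rightarrow> bool" where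
  "outside b B M M' \<longleftrightarrow> (\<forall>a. \<not> (b \<le> a \<and> a < b + B) \<longrightarrow> M' a = M a)"

lemma fold_upt_invariant:
  assumes "P 0 x" "\<And>j x. j < N \<Longrightarrow> P j x \<Longrightarrow> P (Suc j) (f j x)"
  shows "P N (fold f [0..<N] x)"
proof -
  have "j \<le> N \<Longrightarrow> P j (fold f [0..<j] x)" for j
    by (induction j) (use assms in auto)
  then show ?thesis by simp
qed

lemma upt_split: "j < N \<Longrightarrow> [0..<N] = [0..<j] @ j # [Suc j..<N]"
  using upt_add_eq_append[of 0 j "N - j"] by (simp add: upt_conv_Cons)

text \<open>Replaces the semantics of a loop body by an abstract update. The two agree only on
  memories satisfying the invariant, so agreement and invariance are proved together.\<close>

lemma fold_upt_simulation:
  assumes "P x" "\<And>j x. j < N \<Longrightarrow> P x \<Longrightarrow> f j x = g j x \<and> P (g j x)"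
  shows "fold f [0..<N] x = fold g [0..<N] x \<and> P (fold g [0..<N] x)"
proof -
  have "j \<le> N \<Longrightarrow> fold f [0..<j] x = fold g [0..<j] x \<and> P (fold g [0..<j] x)" for j
    by (induction j) (use assms in auto)
  then show ?thesis by simp
qed

text \<open>
  A relation on \<open>B\<close> points has at most \<open>B\<^sup>2\<close> pairs, so the \<open>B\<^sup>2\<close> rounds of the two outer loops reach
  everything.
\<close>

lemma sem_Closure:
  fixes \<rho> M
  assumes init: "\<And>\<rho>' M'. \<rho>' 0 = \<rho> 0 \<Longrightarrow> outside b B M M' \<Longrightarrow> \<rho>' 1 < B \<Longrightarrow>
      0 < ev B ini \<rho>' M' \<longleftrightarrow> P (\<rho>' 1)"
    and step: "\<And>\<rho>' M'. \<rho>' 0 = \<rho> 0 \<Longrightarrow> outside b B M M' \<Longrightarrow> \<rho>' 1 < B \<Longrightarrow> \<rho>' 2 < B \<Longrightarrow>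
      0 < ev B stp \<rho>' M' \<longleftrightarrow> Q (\<rho>' 1) (\<rho>' 2)"
    and base: "\<And>\<rho>' M'. ev B base \<rho>' M' = b"
  defines "M' \<equiv> sem B (Closure base ini stp) \<rho> M"
  shows "outside b B M M'"
    and "s < B \<Longrightarrow> 0 < M' (b + s) \<longleftrightarrow>
      (\<exists>s0<B. P s0 \<and> (s0, s) \<in> {(s, s'). s < B \<and> s' < B \<and> Q s s'}\<^sup>*)"
proof -
  let ?r = "{(s, s'). s < B \<and> s' < B \<and> Q s s'}"
  let ?reach = "\<lambda>s. \<exists>s0<B. P s0 \<and> (s0, s) \<in> ?r\<^sup>*"
  let ?I = "\<lambda>N. outside b B M N \<and> (\<forall>s<B. 0 < N (b + s) \<longrightarrow> ?reach s)"
  define M1 where "M1 = sem B (For 1 (Put (Plus base (V 1)) ini)) \<rho> M"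
  have "outside b B M M1 \<and> (\<forall>s<B. 0 < M1 (b + s) \<longleftrightarrow> P s)"
    unfolding M1_def sem.simps
  proof (rule fold_upt_invariant[where P = "\<lambda>j N. outside b B M N \<and> (\<forall>s<j. 0 < N (b + s) \<longleftrightarrow> P s)"])
    fix j N assume j: "j < B" and N: "outside b B M N \<and> (\<forall>s<j. 0 < N (b + s) \<longleftrightarrow> P s)"
    show "outside b B M (N(ev B (Plus base (V 1)) (\<rho>(1 := j)) N := ev B ini (\<rho>(1 := j)) N)) \<and>
        (\<forall>s<Suc j. 0 < (N(ev B (Plus base (V 1)) (\<rho>(1 := j)) N := ev B ini (\<rho>(1 := j)) N)) (b + s) \<longleftrightarrow> P s)"
      using N j init[of "\<rho>(1 := j)" N] base by (auto simp: outside_def less_Suc_eq)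
  qed (simp add: outside_def)
  then have M1: "outside b B M M1" "\<And>s. s < B \<Longrightarrow> 0 < M1 (b + s) \<longleftrightarrow> P s" by auto
  define upd where "upd s s' N = (N(b + s' := if 0 < N (b + s) \<and> Q s s' then 1 else N (b + s')))"
    for s s' and N :: "nat \<Rightarrow> nat"
  define round where "round N = fold (\<lambda>s. fold (upd s) [0..<B]) [0..<B] N" for N
  have upd_I: "?I (upd s s' N)" if "?I N" "s < B" "s' < B" for s s' N
  proof -
    have "?reach s'" if "?reach s" "Q s s'"
      using that \<open>s < B\<close> \<open>s' < B\<close> by (auto intro: rtrancl_into_rtrancl)
    then show ?thesis using that unfolding outside_def upd_def by auto
  qed
  have upd_mono: "0 < N (b + x) \<Longrightarrow> 0 < upd s s' N (b + x)" for s s' N x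
    by (auto simp: upd_def)
  let ?body = "Put (Plus base (V 2)) (Cond (And (Mem (Plus base (V 1))) stp) (C 1) (Mem (Plus base (V 2))))"
  have sem_upd: "sem B ?body \<rho>' N = upd (\<rho>' 1) (\<rho>' 2) N"
    if "\<rho>' 0 = \<rho> 0" "outside b B M N" "\<rho>' 1 < B" "\<rho>' 2 < B" for \<rho>' N
    using step[of \<rho>' N] that by (auto simp: upd_def base)
  have sem_row: "sem B (For 2 ?body) \<rho>' N = fold (upd (\<rho>' 1)) [0..<B] N \<and>
      ?I (fold (upd (\<rho>' 1)) [0..<B] N)"
    if \<rho>': "\<rho>' 0 = \<rho> 0" "\<rho>' 1 < B" and N: "?I N" for \<rho>' N
    unfolding sem.simps(3)
  proof (rule fold_upt_simulation[where P = ?I, OF N])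
    fix j N assume j: "j < B" and N: "?I N"
    have "sem B ?body (\<rho>'(2 := j)) N = upd (\<rho>' 1) j N"
      using sem_upd[of "\<rho>'(2 := j)" N] \<rho>' N j by (simp del: sem.simps)
    then show "sem B ?body (\<rho>'(2 := j)) N = upd (\<rho>' 1) j N \<and> ?I (upd (\<rho>' 1) j N)"
      using upd_I[OF N \<rho>'(2) j] by blast
  qed
  have sem_round: "sem B (For 1 (For 2 ?body)) \<rho>' N = round N \<and> ?I (round N)"
    if \<rho>': "\<rho>' 0 = \<rho> 0" and N: "?I N" for \<rho>' N
    unfolding sem.simps(3)[of B 1] round_def
  proof (rule fold_upt_simulation[where P = ?I, OF N])
    fix j N assume j: "j < B" and N: "?I N"
    show "sem B (For 2 ?body) (\<rho>'(1 := j)) N = fold (upd j) [0..<B] N \<and> ?I (fold (upd j) [0..<B] N)"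
      using sem_row[of "\<rho>'(1 := j)" N] \<rho>' N j by (simp del: sem.simps)
  qed
  have upd_row_mono: "0 < N (b + x) \<Longrightarrow> 0 < fold (upd s) xs N (b + x)" for N s x xs
    by (induction xs arbitrary: N) (simp_all add: upd_mono)
  have upd_row: "0 < fold (upd s) [0..<B] N (b + s')" if "0 < N (b + s)" "s' < B" "Q s s'" for N s s'
  proof -
    have "[0..<B] = [0..<s'] @ s' # [Suc s'..<B]" using upt_split[OF that(2)] .
    moreover have "0 < fold (upd s) [0..<s'] N (b + s)" using upd_row_mono[of N s] that(1) by simp
    then have "0 < upd s s' (fold (upd s) [0..<s'] N) (b + s')" using that(3) by (simp add: upd_def)
    ultimately show ?thesis using upd_row_mono by simp
  qed
  have rows_mono: "0 < N (b + x) \<Longrightarrow> 0 < fold (\<lambda>s. fold (upd s) [0..<B]) xs N (b + x)" for N x xs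
    by (induction xs arbitrary: N) (simp_all add: upd_row_mono)
  have round_step: "0 < round N (b + s')" if "0 < N (b + s)" "s < B" "s' < B" "Q s s'" for N s s'
  proof -
    have "[0..<B] = [0..<s] @ s # [Suc s..<B]" using upt_split[OF that(2)] .
    moreover have "0 < fold (\<lambda>s. fold (upd s) [0..<B]) [0..<s] N (b + s)" using rows_mono[of N s] that(1) by simp
    then have "0 < fold (upd s) [0..<B] (fold (\<lambda>s. fold (upd s) [0..<B]) [0..<s] N) (b + s')"
      using upd_row that(3,4) by blast
    then have "0 < fold (\<lambda>s. fold (upd s) [0..<B]) [Suc s..<B]
        (fold (upd s) [0..<B] (fold (\<lambda>s. fold (upd s) [0..<B]) [0..<s] N)) (b + s')"
      by (rule rows_mono)
    ultimately show ?thesis unfolding round_def by (simp only: fold_append fold_simps comp_apply)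
  qed
  have round_mono: "0 < N (b + x) \<Longrightarrow> 0 < round N (b + x)" for N x
    using rows_mono by (simp add: round_def)
  \<comment> \<open>Because updates are in place, a round may advance by more than one step. Only a
    lower bound on what \<open>t\<close> rounds reach is claimed; soundness is carried by
    \<open>?I\<close>.\<close>
  have round_pow: "0 < (round ^^ t) M1 (b + s)" if "(s0, s) \<in> ?r ^^ k" "k \<le> t" "P s0" "s0 < B" for k t s0 s
    using that
  proof (induction t arbitrary: k s)
    case 0
    then show ?case using M1(2) by simp
  next
    case (Suc t)
    show ?case
    proof (cases "k \<le> t")
      case True
      then show ?thesis using Suc round_mono by simp
    next
      case False
      then have k: "k = Suc t" using Suc by simp
      then obtain s1 where s1: "(s0, s1) \<in> ?r ^^ t" "(s1, s) \<in> ?r" using Suc.prems(1) by auto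
      then show ?thesis using Suc.IH[OF s1(1)] Suc.prems round_step by auto
    qed
  qed
  have rounds: "sem B (For 4 (For 1 (For 2 ?body))) \<rho>' N = (round ^^ B) N \<and> ?I ((round ^^ B) N)"
    if \<rho>': "\<rho>' 0 = \<rho> 0" and N: "?I N" for \<rho>' N
  proof -
    have "sem B (For 4 (For 1 (For 2 ?body))) \<rho>' N = fold (\<lambda>j. round) [0..<B] N \<and>
        ?I (fold (\<lambda>j. round) [0..<B] N)"
      unfolding sem.simps(3)[of B 4]
      by (rule fold_upt_simulation[where P = ?I, OF N]) (rule sem_round; simp add: \<rho>')
    moreover have "fold (\<lambda>j. round) [0..<k] N = (round ^^ k) N" for k
      by (induction k) auto
    ultimately show ?thesis by simp
  qed
  have M': "M' = (round ^^ (B * B)) M1" "?I M'"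
  proof -
    have I1: "?I M1" using M1 by blast
    have "sem B (For 3 (For 4 (For 1 (For 2 ?body)))) \<rho> M1 = fold (\<lambda>j. round ^^ B) [0..<B] M1 \<and>
        ?I (fold (\<lambda>j. round ^^ B) [0..<B] M1)"
      unfolding sem.simps(3)[of B 3]
      by (rule fold_upt_simulation[where P = ?I, OF I1]) (rule rounds; simp)
    moreover have "fold (\<lambda>j. round ^^ B) [0..<k] M1 = (round ^^ (k * B)) M1" for k
      by (induction k) (auto simp: funpow_add)
    ultimately show "M' = (round ^^ (B * B)) M1" "?I M'"
      unfolding M'_def Closure_def sem.simps(2) M1_def[symmetric] by simp_all
  qed
  then show "outside b B M M'" by blast
  show "0 < M' (b + s) \<longleftrightarrow> ?reach s" if "s < B"
  proof
    assume "?reach s"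
    then obtain s0 where s0: "s0 < B" "P s0" "(s0, s) \<in> ?r\<^sup>*" by blast
    have sub: "?r \<subseteq> {..<B} \<times> {..<B}" by auto
    then have fin: "finite ?r" by (rule finite_subset) simp
    have "card ?r \<le> card ({..<B} \<times> {..<B})" by (rule card_mono) (use sub in auto)
    then have "card ?r \<le> B * B" by (simp add: card_cartesian_product)
    moreover obtain k where "k \<le> card ?r" "(s0, s) \<in> ?r ^^ k"
      using s0(3) rtrancl_finite_eq_relpow[OF fin] by auto
    ultimately show "0 < M' (b + s)" using round_pow[of s0 s k "B * B"] s0 M'(1) by simp
  qed (use M'(2) that in blast)
qed

section \<open>The algorithm\<close>

text \<open>
  Variable 0 holds \<open>W\<close>, variables 1 and 2 hold the source and the target of a step, and variable 5
  holds the vertex under consideration.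
\<close>

definition N_e :: expr where "N_e = Mem (C 0)"
definition W_e :: expr where "W_e = V 0"
definition Depot :: "expr \<Rightarrow> expr" where
  "Depot u = And (Less u N_e) (Mem (Plus (C 4) u))"
definition Client :: "expr \<Rightarrow> expr" where
  "Client u = And (Less u N_e) (Mem (Plus (Plus (C 4) N_e) u))"
definition Adj :: "expr \<Rightarrow> expr \<Rightarrow> expr" where
  "Adj u v = Cond (And (Less u N_e) (Less v N_e))
     (Mem (Plus (Plus (Plus (C 4) N_e) N_e) (Plus (Times u N_e) v))) (C 0)"
definition Fld :: "nat \<Rightarrow> nat \<Rightarrow> expr" where
  "Fld k x = Dig W_e (V x) (C k)"

text \<open>All-pairs reachability becomes reachability from a set: u + v * W stands for the pair
  (u, v), the diagonal is the start, and a step keeps u and moves v. Weights are stored shifted by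
  one, so the entry 1 is an edge of weight 0.\<close>

definition conn_init :: expr where
  "conn_init = And (Eq (Fld 0 1) (Fld 1 1)) (Less (Fld 0 1) N_e)"
definition conn_step :: expr where
  "conn_step = And (Eq (Fld 0 1) (Fld 0 2)) (Eq (Adj (Fld 1 1) (Fld 1 2)) (C 1))"

definition Conn :: "expr \<Rightarrow> expr \<Rightarrow> expr" where
  "Conn u v = Mem (Plus Bound (Plus u (Times v W_e)))"
definition Target :: expr where
  "Target = And (Client (V 5))
     (Not' (Ex' 6 (And (Less (V 6) (V 5)) (And (Client (V 6)) (Conn (V 6) (V 5))))))"
definition Must :: expr where
  "Must = And Target (Not' (Ex' 6 (And (Depot (V 6)) (Conn (V 6) (V 5)))))"

definition Init :: expr where
  "Init = And (Eq (Fld 2 1) N_e) (And (Eq (Fld 3 1) N_e) (And (Eq (Fld 4 1) (C 0))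
     (And (Eq (Fld 5 1) (C 0)) (And (Eq (Fld 6 1) (C 0)) (And (Eq (Fld 7 1) (C 0)) (Eq (Fld 8 1) (C 0)))))))"
definition Same :: "nat \<Rightarrow> expr" where "Same k = Eq (Fld k 2) (Fld k 1)"
definition Weight :: expr where "Weight = Minus (Adj (Fld 3 1) (Fld 3 2)) (C 1)"
definition Move_step :: expr where
  "Move_step = And (Same 2) (And (Same 4) (And (Same 5) (And (Same 8)
     (And (Adj (Fld 3 1) (Fld 3 2)) (And (Eq (Fld 6 2) (Plus (Fld 6 1) Weight))
     (And (Eq (Fld 7 2) (Plus (Fld 7 1) Weight))
     (And (Leq (Fld 6 2) (Mem (C 2))) (Leq (Fld 7 2) (Mem (C 3))))))))))"
definition Collect_step :: expr where
  "Collect_step = And (Same 2) (And (Same 3) (And (Same 6) (And (Same 7) (And (Same 8)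
     (And Target (And (Conn (V 5) (Fld 3 1))
     (And (Eq (Colour (Plus (Mem (C 3)) (Mem (C 3))) (Fld 0 1) (Fld 1 1) (V 5)) (Fld 4 1))
     (And (Eq (Fld 4 2) (Plus (Fld 4 1) (C 1))) (Eq (Fld 5 2) (Plus (Fld 5 1) (Bool Must)))))))))))"
definition New_step :: expr where
  "New_step = And (Eq (Fld 3 1) (Fld 2 1)) (And (Eq (Fld 3 2) (Fld 2 2)) (And (Depot (Fld 2 2))
     (And (Same 4) (And (Same 5) (And (Eq (Fld 6 2) (C 0)) (And (Same 7)
     (Eq (Fld 8 2) (Plus (Fld 8 1) (C 1)))))))))"
definition Step :: expr where
  "Step = And (Same 0) (And (Same 1) (Or Move_step (Or (Ex' 5 Collect_step) New_step)))"
definition Final :: expr where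
  "Final = And (Eq (Fld 3 1) (Fld 2 1)) (And (Eq (Fld 5 1) (Sum 5 (Bool Must)))
     (Leq (Plus (Fld 8 1) (Sum 5 (Bool Target))) (Plus (Mem (C 1)) (Fld 4 1))))"

text \<open>Addresses below B hold the input, those from B to 2 B the zero-weight connectivity,
  those from 2 B to 3 B the reached states. The second closure reads the first table.\<close>

definition tables :: cmd where
  "tables = Then (Closure Bound conn_init conn_step) (Closure (Plus Bound Bound) Init Step)"
definition answer :: expr where
  "answer = Bool (Ex' 1 (And (Mem (Plus (Plus Bound Bound) (V 1))) Final))"

section \<open>Reading the input and evaluating the program\<close>

lemma length_comprehension: "length [f u v. u \<leftarrow> xs, v \<leftarrow> ys] = length xs * length ys"
  by (induction xs) auto

lemma nth_comprehension:
  "u < length xs \<Longrightarrow> v < length ys \<Longrightarrow>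
    [f u v. u \<leftarrow> xs, v \<leftarrow> ys] ! (u * length ys + v) = f (xs ! u) (ys ! v)"
proof (induction xs arbitrary: u)
  case (Cons x xs)
  show ?case
  proof (cases u)
    case (Suc u')
    have "[f u v. u \<leftarrow> x # xs, v \<leftarrow> ys] ! (Suc u' * length ys + v) =
        [f u v. u \<leftarrow> xs, v \<leftarrow> ys] ! (u' * length ys + v)"
      by (simp add: nth_append)
    then show ?thesis using Cons Suc by simp
  qed (use Cons in \<open>simp add: nth_append\<close>)
qed simp

context cvrp_state
begin

definition input :: "nat \<Rightarrow> nat" where
  "input = snd (input_state (encode [0..<n] I r))"

lemma input_header: "input 0 = n" "input 1 = vehicles I" "input 2 = gas I" "input 3 = r"
  by (simp_all add: input_def input_state_def encode_def numeral_2_eq_2 numeral_3_eq_3)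

lemma input_depot: "u < n \<Longrightarrow> input (4 + u) = of_bool (u \<in> depots I)"
  by (simp add: input_def input_state_def encode_def nth_append nth_Cons')

lemma input_client: "u < n \<Longrightarrow> input (4 + n + u) = of_bool (u \<in> clients I)"
  by (simp add: input_def input_state_def encode_def nth_append nth_Cons')

lemma input_adj:
  assumes "u < n" "v < n"
  shows "input (4 + n + n + (u * n + v)) = (if (u, v) \<in> E then Suc (w (u, v)) else 0)"
proof -
  let ?L = "[if (u, v) \<in> E then Suc (w (u, v)) else 0. u \<leftarrow> [0..<n], v \<leftarrow> [0..<n]]"
  let ?H = "[length [0..<n], vehicles I, gas I, r] @ map (\<lambda>v. of_bool (v \<in> depots I)) [0..<n] @
     map (\<lambda>v. of_bool (v \<in> clients I)) [0..<n]"
  have lt: "u * n + v < n * n"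
  proof -
    have "u * n + v < Suc u * n" using assms by simp
    also have "\<dots> \<le> n * n" using assms by (intro mult_le_mono1) simp
    finally show ?thesis .
  qed
  have e: "encode [0..<n] I r = ?H @ ?L" by (simp add: encode_def)
  have lH: "length ?H = 4 + n + n" by simp
  have lL: "length ?L = n * n" using length_comprehension[of _ "[0..<n]" "[0..<n]"] by simp
  have "(?H @ ?L) ! (length ?H + (u * n + v)) = ?L ! (u * n + v)" by (rule nth_append_length_plus)
  also have "\<dots> = (if (u, v) \<in> E then Suc (w (u, v)) else 0)"
    using nth_comprehension[of u "[0..<n]" v "[0..<n]" "\<lambda>u v. if (u, v) \<in> E then Suc (w (u, v)) else 0"] assms
    by simp
  moreover have "length ?H + (u * n + v) < length (?H @ ?L)" using lt lL by simp
  ultimately show ?thesis unfolding input_def input_state_def snd_conv e lH by simp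
qed

text \<open>\<open>input_fits\<close> keeps the input clear of the tables, and
  \<open>W_square\<close> makes all vertex pairs fit into one table. Two factors of \<open>W\<close>
  pay for n^2, the other seven, at least 2^7, for the constants.\<close>

lemma W_le_B: "W \<le> B" and W_square: "W * W \<le> B" and input_fits: "4 + n + n + n * n \<le> B"
  and B_gt: "9 \<le> B"
proof -
  have W2: "2 \<le> W" using W n by simp
  have p: "W ^ 1 \<le> W ^ 9" "W ^ 2 \<le> W ^ 9" using W2 by (intro power_increasing; simp)+
  show "W \<le> B" "W * W \<le> B" using p B by (simp_all add: power2_eq_square)
  have "(2::nat) ^ 7 \<le> W ^ 7" using W2 by (intro power_mono) auto
  then have 7: "128 \<le> W ^ 7" by simp
  have "n * n \<le> W * W" using W by (intro mult_le_mono) auto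
  moreover have "n \<le> n * n" "1 \<le> n * n" using n by auto
  ultimately have "4 + n + n + n * n \<le> 128 * (W * W)" by linarith
  also have "\<dots> \<le> W ^ 7 * (W * W)" using 7 by (rule mult_le_mono1)
  also have "\<dots> = W ^ 9" by (simp add: power_numeral_reduce)
  finally show "4 + n + n + n * n \<le> B" using B by simp
  have "(2::nat) ^ 9 \<le> W ^ 9" using W2 by (intro power_mono) auto
  then show "9 \<le> B" using B by simp
qed

definition has_input :: "(nat \<Rightarrow> nat) \<Rightarrow> bool" where
  "has_input N \<longleftrightarrow> (\<forall>a<B. N a = input a)"

lemma header:
  assumes "has_input N"
  shows "N 0 = n" "N (Suc 0) = vehicles I" "N 2 = gas I" "N 3 = r"
  using assms B_gt input_header unfolding has_input_def by simp_all

lemma ev_Depot: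
  assumes "has_input N"
  shows "0 < ev B (Depot e) \<rho> N \<longleftrightarrow> ev B e \<rho> N \<in> depots I"
proof -
  have "N (4 + u) = of_bool (u \<in> depots I)" if "u < n" for u
    using that assms input_fits input_depot[of u] by (simp add: has_input_def)
  then show ?thesis using depots_less by (auto simp: Depot_def N_e_def header[OF assms])
qed

lemma ev_Client:
  assumes "has_input N"
  shows "0 < ev B (Client e) \<rho> N \<longleftrightarrow> ev B e \<rho> N \<in> clients I"
proof -
  have "N (4 + n + u) = of_bool (u \<in> clients I)" if "u < n" for u
    using that assms input_fits input_client[of u] by (simp add: has_input_def)
  then show ?thesis using clients_less by (auto simp: Client_def N_e_def header[OF assms])
qed

lemma ev_Adj:
  assumes "has_input N"
  shows "ev B (Adj e f) \<rho> N = (if (ev B e \<rho> N, ev B f \<rho> N) \<in> E then Suc (w (ev B e \<rho> N, ev B f \<rho> N)) else 0)"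
proof -
  have *: "N (4 + n + n + (u * n + v)) = (if (u, v) \<in> E then Suc (w (u, v)) else 0)"
    if uv: "u < n" "v < n" for u v
  proof -
    have "u * n + v < Suc u * n" using uv by simp
    also have "\<dots> \<le> n * n" using uv by (intro mult_le_mono1) simp
    finally have "4 + n + n + (u * n + v) < B" using input_fits by linarith
    then show ?thesis using assms input_adj[OF uv] by (simp add: has_input_def)
  qed
  have "n \<le> B" using W W_le_B by simp
  then have m: "min u B = u" if "u < n" for u using that by simp
  show ?thesis
  proof (cases "ev B e \<rho> N < n \<and> ev B f \<rho> N < n")
    case True
    then show ?thesis using *[of "ev B e \<rho> N" "ev B f \<rho> N"] m
      by (simp add: Adj_def N_e_def header[OF assms])
  next
    case False
    then have "(ev B e \<rho> N, ev B f \<rho> N) \<notin> E" using E_verts by blast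
    then show ?thesis using False by (auto simp: Adj_def N_e_def header[OF assms])
  qed
qed

lemma ev_Fld:
  assumes "\<rho> 0 = W" "\<rho> x < B" "k \<le> 8"
  shows "ev B (Fld k x) \<rho> N = fld k (\<rho> x)"
  using assms W_le_B B_gt n_less_W by (simp add: Fld_def W_e_def)

lemma fld_less: "fld k s < W"
  using n_less_W by (intro dig_less) simp

lemma conn_table:
  assumes "\<rho> 0 = W"
  defines "N \<equiv> sem B (Closure Bound conn_init conn_step) \<rho> input"
  shows "outside B B input N"
    and "u < n \<Longrightarrow> v < W \<Longrightarrow> 0 < N (B + (u + v * W)) \<longleftrightarrow> conn u v"
proof -
  have inp: "has_input N'" if "outside B B input N'" for N'
    using that by (simp add: has_input_def outside_def)
  let ?P = "\<lambda>s. fld 0 s = fld 1 s \<and> fld 0 s < n"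
  let ?Q = "\<lambda>s s'. fld 0 s = fld 0 s' \<and> (fld 1 s, fld 1 s') \<in> Z"
  let ?r = "{(s, s'). s < B \<and> s' < B \<and> ?Q s s'}"
  have step: "0 < ev B conn_init \<rho>' N' \<longleftrightarrow> ?P (\<rho>' 1)"
    "\<rho>' 2 < B \<Longrightarrow> 0 < ev B conn_step \<rho>' N' \<longleftrightarrow> ?Q (\<rho>' 1) (\<rho>' 2)"
    if "\<rho>' 0 = \<rho> 0" "outside B B input N'" "\<rho>' 1 < B" for \<rho>' N'
    using that inp[OF that(2)]
    by (auto simp: conn_init_def conn_step_def ev_Fld assms(1) ev_Adj N_e_def header Z_def)
  have "outside B B input N"
    unfolding N_def by (rule sem_Closure(1)[where P = ?P and Q = ?Q]) (use step in simp_all)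
  moreover have "0 < N (B + s) \<longleftrightarrow> (\<exists>s0<B. ?P s0 \<and> (s0, s) \<in> ?r\<^sup>*)" if "s < B" for s
    unfolding N_def by (rule sem_Closure(2)[where P = ?P and Q = ?Q]) (use step that in simp_all)
  ultimately have "outside B B input N \<and>
    (\<forall>s<B. 0 < N (B + s) \<longleftrightarrow> (\<exists>s0<B. ?P s0 \<and> (s0, s) \<in> ?r\<^sup>*))" by blast
  then have out: "outside B B input N"
    and tab: "\<And>s. s < B \<Longrightarrow> 0 < N (B + s) \<longleftrightarrow> (\<exists>s0<B. ?P s0 \<and> (s0, s) \<in> ?r\<^sup>*)" by auto
  show "outside B B input N" by (rule out)
  assume u: "u < n" and v: "v < W"
  have pair: "fld 0 (x + y * W) = x" "fld 1 (x + y * W) = y" "x + y * W < B"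
    if "x < W" "y < W" for x y
  proof -
    show "fld 0 (x + y * W) = x" "fld 1 (x + y * W) = y"
      using that by (simp_all add: dig_def)
    have "x + y * W < Suc y * W" using that by simp
    also have "\<dots> \<le> W * W" using that by (intro mult_le_mono1) simp
    finally show "x + y * W < B" using W_square by simp
  qed
  have uW: "u < W" using u n_less_W by simp
  show "0 < N (B + (u + v * W)) \<longleftrightarrow> conn u v"
  proof
    assume "0 < N (B + (u + v * W))"
    then obtain s0 where s0: "?P s0" "(s0, u + v * W) \<in> ?r\<^sup>*" using tab[OF pair(3)[OF uW v]] by blast
    from s0(2) have "fld 0 (u + v * W) = fld 0 s0 \<and> conn (fld 1 s0) (fld 1 (u + v * W))"
    proof (induction rule: rtrancl_induct)
      case (step s s')
      then show ?case by (auto intro: rtrancl_into_rtrancl)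
    qed simp
    then show "conn u v" using s0(1) pair(1,2)[OF uW v] by metis
  next
    assume "conn u v"
    then have "(u + u * W, u + v * W) \<in> ?r\<^sup>* \<and> v < n"
    proof (induction rule: rtrancl_induct)
      case base
      then show ?case using u by simp
    next
      case (step y z)
      then have "y < W" "z < W" "z < n" using E_verts[of y z] n_less_W by (auto simp: Z_def)
      then have "(u + y * W, u + z * W) \<in> ?r" using step(2) pair[OF uW] by simp
      then show ?case using step(3) \<open>z < n\<close> by (meson rtrancl_into_rtrancl)
    qed
    moreover have "?P (u + u * W)" "u + u * W < B" using pair[OF uW uW] u by simp_all
    ultimately have "\<exists>s0<B. ?P s0 \<and> (s0, u + v * W) \<in> ?r\<^sup>*" by (intro exI[of _ "u + u * W"]) simp
    then show "0 < N (B + (u + v * W))" using tab[OF pair(3)[OF uW v]] by simp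
  qed
qed

text \<open>\<open>v\<close> ranges over all digits, since the vertex digit of a state may be the
  initial position \<open>n\<close> or no vertex at all.\<close>

definition has_conn :: "(nat \<Rightarrow> nat) \<Rightarrow> bool" where
  "has_conn N \<longleftrightarrow> has_input N \<and> (\<forall>u<n. \<forall>v<W. 0 < N (B + (u + v * W)) \<longleftrightarrow> conn u v)"

lemma has_conn_input: "has_conn N \<Longrightarrow> has_input N"
  by (simp add: has_conn_def)

lemma ev_Conn:
  assumes "has_conn N" "\<rho> 0 = W" "ev B e \<rho> N < n" "ev B f \<rho> N < W"
  shows "0 < ev B (Conn e f) \<rho> N \<longleftrightarrow> conn (ev B e \<rho> N) (ev B f \<rho> N)"
  using assms W_le_B by (simp add: has_conn_def Conn_def W_e_def)

lemma ev_Target: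
  assumes N: "has_conn N" and \<rho>: "\<rho> 0 = W" "\<rho> 5 < B"
  shows "0 < ev B Target \<rho> N \<longleftrightarrow> \<rho> 5 \<in> targets"
proof (cases "\<rho> 5 \<in> clients I")
  case True
  note [simp] = ev_Client[OF has_conn_input[OF N]] N \<rho>(1)
  have 5: "\<rho> 5 < W" using clients_less[OF True] n_less_W by simp
  have "0 < ev B (And (Less (V 6) (V 5)) (And (Client (V 6)) (Conn (V 6) (V 5)))) (\<rho>(6 := j)) N \<longleftrightarrow>
      j < \<rho> 5 \<and> j \<in> clients I \<and> conn j (\<rho> 5)" for j
    using ev_Conn[OF N, of "\<rho>(6 := j)" "V 6" "V 5"] clients_less[of j] 5 by auto
  moreover have "j < \<rho> 5 \<Longrightarrow> j < B" for j using \<rho>(2) by simp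
  ultimately show ?thesis using True unfolding Target_def targets_def ev_connectives ev_Ex by auto
next
  case False
  then show ?thesis using ev_Client[OF has_conn_input[OF N], of "V 5" \<rho>]
    by (simp add: Target_def targets_def)
qed

lemma ev_Must:
  assumes N: "has_conn N" and \<rho>: "\<rho> 0 = W" "\<rho> 5 < B"
  shows "0 < ev B Must \<rho> N \<longleftrightarrow> \<rho> 5 \<in> must"
proof (cases "\<rho> 5 \<in> targets")
  case True
  have 5: "\<rho> 5 < W" using T_less[OF True] n_less_W by simp
  have "0 < ev B (And (Depot (V 6)) (Conn (V 6) (V 5))) (\<rho>(6 := j)) N \<longleftrightarrow>
      j \<in> depots I \<and> conn j (\<rho> 5)" for j
    using ev_Conn[OF N, of "\<rho>(6 := j)" "V 6" "V 5"] ev_Depot[OF has_conn_input[OF N]] depots_less[of j] 5 \<rho>(1)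
    by auto
  moreover have "j \<in> depots I \<Longrightarrow> j < B" for j using depots_less[of j] n_less_W W_le_B by simp
  ultimately show ?thesis using True ev_Target[OF N \<rho>]
    unfolding Must_def must_def ev_connectives ev_Ex by auto
next
  case False
  then show ?thesis using ev_Target[OF N \<rho>] by (simp add: Must_def must_def)
qed

lemma ev_Init:
  assumes "has_input N" "\<rho> 0 = W" "\<rho> 1 < B"
  shows "0 < ev B Init \<rho> N \<longleftrightarrow> init (\<rho> 1)"
  using assms by (simp add: Init_def init_def ev_Fld N_e_def header)

lemma ev_Move_step:
  assumes "has_input N" "\<rho> 0 = W" "\<rho> 1 < B" "\<rho> 2 < B"
  shows "0 < ev B Move_step \<rho> N \<longleftrightarrow> move_step (\<rho> 1) (\<rho> 2)"
  using assms by (auto simp: Move_step_def move_step_def Same_def Weight_def ev_Fld ev_Adj header)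

lemma ev_New_step:
  assumes "has_input N" "\<rho> 0 = W" "\<rho> 1 < B" "\<rho> 2 < B"
  shows "0 < ev B New_step \<rho> N \<longleftrightarrow> new_step (\<rho> 1) (\<rho> 2)"
  using assms by (auto simp: New_step_def new_step_def Same_def ev_Fld ev_Depot header)

text \<open>Outside \<open>targets\<close> both sides are false. Inside, the vertex is below
  \<open>n\<close>, where the entries of the connectivity table have their meaning.\<close>

lemma ev_Collect_step:
  assumes N: "has_conn N" and \<rho>: "\<rho> 0 = W" "\<rho> 1 < B" "\<rho> 2 < B" "\<rho> 5 < B"
  shows "0 < ev B Collect_step \<rho> N \<longleftrightarrow> collect_step (\<rho> 5) (\<rho> 1) (\<rho> 2)"
proof (cases "\<rho> 5 \<in> targets")
  case True
  note inp = has_conn_input[OF N]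
  have f: "fld k s \<le> B" for k s using fld_less[of s k] W_le_B by simp
  have "ev B (Colour (Plus (Mem (C 3)) (Mem (C 3))) (Fld 0 1) (Fld 1 1) (V 5)) \<rho> N =
      colour B (2 * r) (fld 0 (\<rho> 1)) (fld 1 (\<rho> 1)) (\<rho> 5)"
    using \<rho> f W W_le_B B_gt by (subst ev_Colour) (simp_all add: ev_Fld header[OF inp] mult_2)
  moreover have "0 < ev B (Conn (V 5) (Fld 3 1)) \<rho> N \<longleftrightarrow> conn (\<rho> 5) (fld 3 (\<rho> 1))"
    using ev_Conn[where \<rho> = \<rho>, OF N \<rho>(1), of "V 5" "Fld 3 1"] T_less[OF True] \<rho> fld_less by (simp add: ev_Fld)
  ultimately show ?thesis
    unfolding Collect_step_def collect_step_def using \<rho>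
    by (simp add: Same_def ev_Fld ev_Target[OF N] ev_Must[OF N])
next
  case False
  then show ?thesis using ev_Target[OF N \<rho>(1,4)] by (simp add: Collect_step_def collect_step_def)
qed

lemma ev_Step:
  assumes N: "has_conn N" and \<rho>: "\<rho> 0 = W" "\<rho> 1 < B" "\<rho> 2 < B"
  shows "0 < ev B Step \<rho> N \<longleftrightarrow> step (\<rho> 1) (\<rho> 2)"
proof -
  have "0 < ev B Collect_step (\<rho>(5 := j)) N \<longleftrightarrow> collect_step j (\<rho> 1) (\<rho> 2)" if "j < B" for j
    using ev_Collect_step[OF N, of "\<rho>(5 := j)"] \<rho> that by simp
  moreover have "collect_step j s s' \<Longrightarrow> j < B" for j s s'
    using T_less[of j] n_less_W W_le_B by (simp add: collect_step_def)
  ultimately have "0 < ev B (Ex' 5 Collect_step) \<rho> N \<longleftrightarrow> (\<exists>y. collect_step y (\<rho> 1) (\<rho> 2))"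
    unfolding ev_Ex by metis
  then show ?thesis
    using ev_Move_step[OF has_conn_input[OF N] \<rho>] ev_New_step[OF has_conn_input[OF N] \<rho>] \<rho>
    by (simp add: Step_def step_def Same_def ev_Fld del: ev_Ex)
qed

lemma ev_Final:
  assumes N: "has_conn N" and \<rho>: "\<rho> 0 = W" "\<rho> 1 < B"
  shows "0 < ev B Final \<rho> N \<longleftrightarrow> final (\<rho> 1)"
proof -
  have "(\<Sum>j<B. of_bool (j \<in> S)) = card S" if "S \<subseteq> targets" for S
  proof -
    have "S \<subseteq> {..<B}" using that T_less n_less_W W_le_B by fastforce
    then have "{..<B} \<inter> S = S" by blast
    then show ?thesis by simp
  qed
  from this[of targets] this[of must]
  have "(\<Sum>j<B. of_bool (j \<in> targets)) = card targets" "(\<Sum>j<B. of_bool (j \<in> must)) = card must"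
    by (auto simp: must_def)
  then have "ev B (Sum 5 (Bool Must)) \<rho> N = card must" "ev B (Sum 5 (Bool Target)) \<rho> N = card targets"
    using \<rho> by (simp_all add: ev_Must[OF N] ev_Target[OF N] cong: sum.cong_simp)
  then show ?thesis
    using \<rho> header[OF has_conn_input[OF N]] by (simp add: Final_def final_def ev_Fld del: ev_Sum)
qed

theorem ev_answer:
  assumes \<rho>: "\<rho> 0 = W"
  shows "ev B answer \<rho> (sem B tables \<rho> input) =
    of_bool (\<exists>R A. routing I R A \<and> routing_weight I R \<le> r)"
proof -
  define N1 where "N1 = sem B (Closure Bound conn_init conn_step) \<rho> input"
  define N2 where "N2 = sem B (Closure (Plus Bound Bound) Init Step) \<rho> N1"
  have N1: "outside B B input N1" "\<And>u v. u < n \<Longrightarrow> v < W \<Longrightarrow> 0 < N1 (B + (u + v * W)) \<longleftrightarrow> conn u v"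
    unfolding N1_def using conn_table[where \<rho> = \<rho>, OF \<rho>] by blast+
  \<comment> \<open>The second closure writes only from 2 B on, so the connectivity table stays
    intact while the steps are evaluated.\<close>
  have conn: "has_conn N" if "outside (B + B) B N1 N" for N
    unfolding has_conn_def
  proof (intro conjI allI impI)
    show "has_input N" using that N1(1) by (simp add: has_input_def outside_def)
    fix u v assume uv: "u < n" "v < W"
    have "u + v * W < Suc v * W" using uv n_less_W by simp
    also have "\<dots> \<le> W * W" using uv by (intro mult_le_mono1) simp
    finally have "B + (u + v * W) < B + B" using W_square by simp
    then have "N (B + (u + v * W)) = N1 (B + (u + v * W))" using that by (simp add: outside_def)
    then show "0 < N (B + (u + v * W)) \<longleftrightarrow> conn u v" using N1(2)[OF uv] by simp
  qed
  have "outside (B + B) B N1 N2 \<and>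
    (\<forall>s<B. 0 < N2 (B + B + s) \<longleftrightarrow> (\<exists>s0<B. init s0 \<and> (s0, s) \<in> steps\<^sup>*))"
    unfolding N2_def steps_def
  proof (intro conjI allI impI)
    show "outside (B + B) B N1 (sem B (Closure (Plus Bound Bound) Init Step) \<rho> N1)"
      by (rule sem_Closure(1)[where P = init and Q = step])
        (use conn \<rho> in \<open>simp_all only: ev_Init ev_Step has_conn_input ev.simps\<close>)
    show "0 < sem B (Closure (Plus Bound Bound) Init Step) \<rho> N1 (B + B + s) \<longleftrightarrow>
      (\<exists>s0<B. init s0 \<and> (s0, s) \<in> {(s, s'). s < B \<and> s' < B \<and> step s s'}\<^sup>*)" if "s < B" for s
      by (rule sem_Closure(2)[where P = init and Q = step])
        (use conn \<rho> that in \<open>simp_all only: ev_Init ev_Step has_conn_input ev.simps\<close>)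
  qed
  then have N2: "has_conn N2" "\<And>s. s < B \<Longrightarrow> 0 < N2 (B + B + s) \<longleftrightarrow> (\<exists>s0<B. init s0 \<and> (s0, s) \<in> steps\<^sup>*)"
    using conn by auto
  have "0 < ev B Final (\<rho>(1 := s)) N2 \<longleftrightarrow> final s" if "s < B" for s
    using ev_Final[OF N2(1), of "\<rho>(1 := s)"] \<rho> that by simp
  then have "(\<exists>s<B. 0 < N2 (B + B + s) \<and> 0 < ev B Final (\<rho>(1 := s)) N2) \<longleftrightarrow>
      (\<exists>s<B. (\<exists>s0<B. init s0 \<and> (s0, s) \<in> steps\<^sup>*) \<and> final s)"
    using N2(2) by meson
  then have "ev B answer \<rho> N2 =
      of_bool (\<exists>s<B. (\<exists>s0<B. init s0 \<and> (s0, s) \<in> steps\<^sup>*) \<and> final s)"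
    by (simp add: answer_def)
  moreover have "sem B tables \<rho> input = N2" by (simp add: tables_def N2_def N1_def)
  ultimately show ?thesis unfolding routing_iff_steps by (auto intro: arg_cong[of _ _ of_bool])
qed

end

section \<open>Relabelling and running time\<close>

lemma vwalk_arcs_map: "vwalk_arcs (map f p) = map (map_prod f f) (vwalk_arcs p)"
  by (induction p rule: vwalk_arcs.induct) auto

text \<open>Serves both directions of a relabelling: walks are mapped along \<open>g\<close>, while
  \<open>h\<close> sends a client of \<open>J\<close> to the client of \<open>I\<close> whose
  vehicle serves it.\<close>

lemma routing_transfer:
  assumes verts: "g ` pverts (network I) \<subseteq> pverts (network J)"
    and arcs: "\<And>u v. (u, v) \<in> parcs (network I) \<Longrightarrow>
      (g u, g v) \<in> parcs (network J) \<and> weight J (g u, g v) = weight I (u, v)"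
    and depots: "g ` depots I \<subseteq> depots J"
    and clients: "\<And>c. c \<in> clients J \<Longrightarrow> h c \<in> clients I \<and> g (h c) = c"
    and bounds: "vehicles J = vehicles I" "gas J = gas I"
    and rt: "\<exists>R A. routing I R A \<and> routing_weight I R \<le> r"
  shows "\<exists>R A. routing J R A \<and> routing_weight J R \<le> r"
proof -
  obtain R A where R: "routing I R A" "routing_weight I R \<le> r" using rt by blast
  have ww: "walk_weight J (map g p) = walk_weight I p" if "vwalk p (with_proj (network I))" for p
  proof -
    have "weight J (map_prod g g a) = weight I a" if "a \<in> set (vwalk_arcs p)" for a
    proof -
      have "a \<in> parcs (network I)" using that \<open>vwalk p _\<close> by (auto simp: vwalk_with_proj)
      then show ?thesis using arcs by (cases a) simp
    qed
    then show ?thesis unfolding walk_weight_def vwalk_arcs_map by (simp cong: map_cong)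
  qed
  have walk: "vwalk (map g p) (with_proj (network J))" if "vwalk p (with_proj (network I))" for p
    using that verts arcs by (fastforce simp: vwalk_with_proj vwalk_arcs_map)
  have ok: "vwalk p (with_proj (network I))" "hd p \<in> depots I" "hd p = last p" "walk_weight I p \<le> gas I"
    if "p \<in> set R" for p
    using R(1) that by (auto simp: routing_def)
  have "routing_weight J (map (map g) R) = routing_weight I R"
    unfolding routing_weight_def using ww ok(1) by (simp add: comp_def cong: map_cong)
  moreover have "routing J (map (map g) R) (A \<circ> h)"
    unfolding routing_def
  proof (intro conjI ballI)
    show "length (map (map g) R) \<le> vehicles J" using R(1) bounds by (simp add: routing_def)
  next
    fix q assume "q \<in> set (map (map g) R)"
    then obtain p where p: "p \<in> set R" "q = map g p" by auto
    have ne: "p \<noteq> []" using ok(1)[OF p(1)] by (simp add: vwalk_with_proj)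
    show "vwalk q (with_proj (network J))" using walk ok p by simp
    show "hd q \<in> depots J" using ok(2)[OF p(1)] ne p(2) depots by (auto simp: hd_map)
    show "hd q = last q" using ok(3)[OF p(1)] ne p(2) by (simp add: hd_map last_map)
    show "walk_weight J q \<le> gas J" using ok(1,4)[OF p(1)] ww p(2) bounds by simp
  next
    fix c assume c: "c \<in> clients J"
    then have "A (h c) < length R" "h c \<in> set (R ! A (h c))"
      using clients[OF c] R(1) by (auto simp: routing_def)
    moreover from this have "c \<in> g ` set (R ! A (h c))" using clients[OF c] by force
    ultimately show "(A \<circ> h) c < length (map (map g) R)" "c \<in> set (map (map g) R ! (A \<circ> h) c)"
      by simp_all
  qed
  ultimately show ?thesis using R(2) by metis
qed

text \<open>The encoding sees vertices only through their positions in \<open>vs\<close>, so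
  renaming each vertex to its position leaves the input unchanged and reduces everything to vertex
  sets {..<n}.\<close>

definition relabel :: "'a list \<Rightarrow> 'a gas_cvrp \<Rightarrow> nat gas_cvrp" where
  "relabel vs I = \<lparr>
     network = \<lparr>pverts = {..<length vs},
       parcs = {(i, j). i < length vs \<and> j < length vs \<and> (vs ! i, vs ! j) \<in> parcs (network I)}\<rparr>,
     weight = (\<lambda>(i, j). weight I (vs ! i, vs ! j)),
     depots = {i. i < length vs \<and> vs ! i \<in> depots I},
     clients = {i. i < length vs \<and> vs ! i \<in> clients I},
     vehicles = vehicles I, gas = gas I\<rparr>"

context
  fixes I :: "'a gas_cvrp" and vs :: "'a list"
  assumes inst: "gas_cvrp_instance I" and vs: "distinct vs" "set vs = pverts (network I)"
begin

interpretation pair_graph "network I" using inst by (simp add: gas_cvrp_instance_def)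

lemma relabel_instance: "gas_cvrp_instance (relabel vs I)"
proof -
  let ?G = "network (relabel vs I)"
  have "pair_graph ?G"
  proof
    show "finite (pverts ?G)" "finite (parcs ?G)"
      by (auto simp: relabel_def intro: finite_subset[of _ "{..<length vs} \<times> {..<length vs}"])
    fix e assume e: "e \<in> parcs ?G"
    then show "fst e \<in> pverts ?G" "snd e \<in> pverts ?G" by (auto simp: relabel_def)
    have "(u, u) \<notin> parcs (network I)" for u using no_loops[of "(u, u)"] by auto
    then show "fst e \<noteq> snd e" using e by (auto simp: relabel_def)
  next
    show "symmetric (with_proj ?G)"
      using arcs_symmetric by (auto simp: symmetric_def sym_def arcs_ends_def arc_to_ends_def relabel_def)
  qed
  moreover have "\<exists>i<length vs. vs ! i \<in> depots I"
    using inst vs(2) unfolding gas_cvrp_instance_def by (metis all_not_in_conv in_set_conv_nth subset_iff)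
  ultimately show ?thesis using inst
    by (auto simp: gas_cvrp_instance_def relabel_def)
qed

lemma encode_relabel: "encode [0..<length vs] (relabel vs I) r = encode vs I r"
proof -
  have m: "map (\<lambda>i. f (vs ! i)) [0..<length vs] = map f vs" for f :: "'a \<Rightarrow> 'b"
  proof -
    have "map f vs = map f (map (\<lambda>i. vs ! i) [0..<length vs])" by (simp add: map_nth)
    then show ?thesis by (simp add: comp_def)
  qed
  have "map (\<lambda>v. of_bool (v \<in> depots (relabel vs I))) [0..<length vs] = map (\<lambda>v. of_bool (v \<in> depots I)) vs"
    "map (\<lambda>v. of_bool (v \<in> clients (relabel vs I))) [0..<length vs] = map (\<lambda>v. of_bool (v \<in> clients I)) vs"
    unfolding m[symmetric] by (auto simp: relabel_def)
  moreover have "[if (u, v) \<in> parcs (network (relabel vs I)) then Suc (weight (relabel vs I) (u, v)) else 0.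
      u \<leftarrow> [0..<length vs], v \<leftarrow> [0..<length vs]] =
    [if (u, v) \<in> parcs (network I) then Suc (weight I (u, v)) else 0. u \<leftarrow> vs, v \<leftarrow> vs]"
    unfolding m[symmetric] by (intro arg_cong[of _ _ concat] map_cong refl) (auto simp: relabel_def)
  ultimately show ?thesis
    unfolding encode_def by (simp only: length_upt diff_zero) (simp add: relabel_def)
qed

lemma routing_relabel:
  "(\<exists>R A. routing (relabel vs I) R A \<and> routing_weight (relabel vs I) R \<le> r) \<longleftrightarrow>
   (\<exists>R A. routing I R A \<and> routing_weight I R \<le> r)"
proof -
  define idx where "idx v = (THE i. i < length vs \<and> vs ! i = v)" for v
  have idx: "idx v < length vs \<and> vs ! idx v = v" if v: "v \<in> pverts (network I)" for v
  proof -
    obtain i where "i < length vs" "vs ! i = v" using v vs(2) in_set_conv_nth[of v vs] by auto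
    then have "\<exists>!i. i < length vs \<and> vs ! i = v"
      using nth_eq_iff_index_eq[OF vs(1)] by blast
    then show ?thesis unfolding idx_def by (rule theI')
  qed
  have idx': "idx (vs ! i) = i" if "i < length vs" for i
    using idx[of "vs ! i"] that vs by (metis nth_eq_iff_index_eq nth_mem)
  have sub: "depots I \<subseteq> pverts (network I)" "clients I \<subseteq> pverts (network I)"
    using inst by (auto simp: gas_cvrp_instance_def)
  have arcs: "u \<in> pverts (network I)" "v \<in> pverts (network I)" if "(u, v) \<in> parcs (network I)" for u v
    using in_arcsD1[OF that] in_arcsD2[OF that] by auto
  show ?thesis
  proof
    assume *: "\<exists>R A. routing (relabel vs I) R A \<and> routing_weight (relabel vs I) R \<le> r"
    show "\<exists>R A. routing I R A \<and> routing_weight I R \<le> r"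
      by (rule routing_transfer[where I = "relabel vs I" and g = "\<lambda>i. vs ! i" and h = idx])
        (use * vs(2) idx sub in \<open>auto simp: relabel_def\<close>)
  next
    assume *: "\<exists>R A. routing I R A \<and> routing_weight I R \<le> r"
    show "\<exists>R A. routing (relabel vs I) R A \<and> routing_weight (relabel vs I) R \<le> r"
      by (rule routing_transfer[where I = I and h = "\<lambda>i. vs ! i" and g = idx])
        (use * idx idx' sub arcs in \<open>auto simp: relabel_def\<close>)
  qed
qed

end

definition solver :: ram where
  "solver = Seq prepare (Seq (comp_cmd 0 tables) (Seq (comp_expr 0 answer) (move 0 (tr 0))))"

lemma runs_solver:
  fixes I :: "nat gas_cvrp" and n r :: nat
  assumes inst: "gas_cvrp_instance I" and verts: "pverts (network I) = {..<n}"
  defines "B \<equiv> (n * tower (r + 2)) ^ 9"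
  shows "\<exists>R M. runs solver (input_state (encode [0..<n] I r))
      (200 * (B + 1) + (time_cmd B tables + (time_expr B answer + 2))) (R, M) \<and>
    R 0 = of_bool (\<exists>R A. routing I R A \<and> routing_weight I R \<le> r)"
proof -
  let ?W = "n * tower (r + 2)"
  have n: "0 < n" using inst verts by (auto simp: gas_cvrp_instance_def)
  have t: "tower (r + 2) \<le> ?W" using n by simp
  have e: "4 * 2 ^ r = (2::nat) ^ (r + 2)" by simp
  \<comment> \<open>As 2 r + 1 < 2^(2 r + 1), the left side is at most 2^2^(4 r + 1), and 4 r + 1
    \<le> 2^(r + 2).\<close>
  have big: "Suc (2 * r) ^ 2 ^ (2 * r) \<le> tower (r + 2)"
  proof -
    have "Suc (2 * r) ^ 2 ^ (2 * r) \<le> (2 ^ (2 * r + 1)) ^ 2 ^ (2 * r)"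
      using less_exp[of "2 * r + 1"] by (intro power_mono) (simp_all del: power_Suc)
    also have "\<dots> = 2 ^ ((2 * r + 1) * 2 ^ (2 * r))" by (rule power_mult[symmetric])
    also have "\<dots> \<le> 2 ^ (2 ^ (2 * r + 1) * 2 ^ (2 * r))"
      using less_exp[of "2 * r + 1"] by (intro power_increasing mult_le_mono1) simp_all
    also have "\<dots> = 2 ^ 2 ^ (2 * r + 1 + 2 * r)" by (simp only: power_add)
    also have "\<dots> \<le> 2 ^ 2 ^ 2 ^ (r + 2)"
    proof (intro power_increasing)
      have "r < 2 ^ r" by (rule less_exp)
      then show "2 * r + 1 + 2 * r \<le> 2 ^ (r + 2)" using e by linarith
    qed simp_all
    finally show ?thesis by (simp add: tower_def)
  qed
  interpret cvrp_state I n r ?W B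
  proof
    show "gas_cvrp_instance I" "pverts (network I) = {..<n}" "0 < n" by (fact inst verts n)+
    have "r < 2 ^ r" by (rule less_exp)
    moreover have "2 ^ (r + 2) \<le> tower (r + 2)" by (rule tower_ge)
    ultimately have r: "2 * r < tower (r + 2)" "2 \<le> tower (r + 2)" using e by linarith+
    then show "2 * r < ?W" using t by linarith
    show "2 * n \<le> ?W" using r(2) by (simp add: mult.commute)
    show "Suc (2 * r) ^ 2 ^ (2 * r) \<le> ?W" using big t by linarith
  qed (simp add: B_def)
  have st: "input_state (encode [0..<n] I r) = (\<lambda>_. 0, input)"
    by (simp add: input_def input_state_def)
  obtain R1 where R1: "runs prepare (\<lambda>_. 0, input) (200 * (B + 1)) (R1, input)" "R1 0 = B" "R1 1 = ?W"
    using runs_prepare[of input] n by (auto simp: input_header B_def)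
  let ?\<rho> = "\<lambda>x. R1 (vr x)"
  have \<rho>: "?\<rho> 0 = ?W" using R1(3) by (simp add: vr_def)
  obtain R2 where R2: "runs (comp_cmd 0 tables) (R1, input) (time_cmd B tables) (R2, sem B tables ?\<rho> input)"
    "same 0 R1 R2"
    using runs_comp_cmd[of 0 tables R1 input] unfolding R1(2) by blast
  then have R2': "R2 0 = B" "(\<lambda>x. R2 (vr x)) = ?\<rho>" using R1(2) by (auto simp: same_def)
  obtain R3 where R3: "runs (comp_expr 0 answer) (R2, sem B tables ?\<rho> input) (time_expr B answer)
      (R3, sem B tables ?\<rho> input)" "R3 (tr 0) = ev B answer ?\<rho> (sem B tables ?\<rho> input)"
    using runs_comp_expr[of 0 answer R2 "sem B tables ?\<rho> input"] R2' by auto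
  have "runs solver (\<lambda>_. 0, input) (200 * (B + 1) + (time_cmd B tables + (time_expr B answer + 2)))
      (R3(0 := R3 (tr 0)), sem B tables ?\<rho> input)"
    unfolding solver_def
    by (rule runs_Seq[OF R1(1) runs_Seq[OF R2(1) runs_Seq[OF R3(1) runs_move]]]) simp
  then show ?thesis unfolding st using R3(2) ev_answer[where \<rho> = ?\<rho>, OF \<rho>]
    by (intro exI[of _ "R3(0 := R3 (tr 0))"] exI[of _ "sem B tables ?\<rho> input"]) simp
qed

theorem corollary4p2:
  shows "\<exists>(P :: ram) (f :: nat \<Rightarrow> nat) (c :: nat). computable f \<and>
    (\<forall>(I :: nat gas_cvrp) (vs :: nat list) (r :: nat).
       gas_cvrp_instance I \<longrightarrow> distinct vs \<longrightarrow> set vs = pverts (network I) \<longrightarrow>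
       (\<exists>t. t \<le> f r * card (pverts (network I)) ^ c \<and>
            run P (encode vs I r) t
              (of_bool (\<exists>R A. routing I R A \<and> routing_weight I R \<le> r))))"
proof -
  let ?T = "\<lambda>B. 200 * (B + 1) + (time_cmd B tables + (time_expr B answer + 2))"
  have "poly_bounded (\<lambda>B. 200 * (B + 1))"
    unfolding poly_bounded_def by (intro exI[of _ 200] exI[of _ 1]) simp
  then have "poly_bounded ?T"
    by (intro poly_bounded_intros poly_bounded_time_cmd poly_bounded_time_expr)
  then obtain K d where Kd: "\<And>B. ?T B \<le> K * (B + 1) ^ d" unfolding poly_bounded_def by blast
  \<comment> \<open>The shift consists of the 2 in \<open>tower (r + 2)\<close>, the constant factor
    K * 2^d and the exponent 9 * d, as \<open>tower_absorbs\<close> requires.\<close>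
  let ?f = "\<lambda>r. tower (r + (2 + K * 2 ^ d + 9 * d))"
  show ?thesis
  proof (rule exI[of _ solver], rule exI[of _ ?f], rule exI[of _ "9 * d"],
      intro conjI allI impI computable_tower)
    fix I :: "nat gas_cvrp" and vs :: "nat list" and r :: nat
    assume I: "gas_cvrp_instance I" and vs: "distinct vs" "set vs = pverts (network I)"
    let ?n = "length vs" and ?t = "tower (r + 2)"
    let ?B = "(?n * ?t) ^ 9"
    have n: "card (pverts (network I)) = ?n" using vs by (metis distinct_card)
    have "0 < ?n" using I vs(2) by (auto simp: gas_cvrp_instance_def)
    then have "0 < ?B" by (simp add: tower_def)
    obtain R M where "runs solver (input_state (encode vs I r)) (?T ?B) (R, M)"
      "R 0 = of_bool (\<exists>R A. routing I R A \<and> routing_weight I R \<le> r)"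
      using runs_solver[OF relabel_instance[OF I vs], of ?n r]
      unfolding encode_relabel[OF I vs] routing_relabel[OF I vs] by (auto simp: relabel_def)
    then obtain t where t: "t \<le> ?T ?B" "run solver (encode vs I r) t
        (of_bool (\<exists>R A. routing I R A \<and> routing_weight I R \<le> r))"
      unfolding runs_def run_def by blast
    \<comment> \<open>Unlike \<open>?B + 1\<close>, the number \<open>2 * ?B\<close> is a product,
      whose powers split into a part for n and a part for \<open>r\<close>.\<close>
    have B1: "?B + 1 \<le> 2 * ?B" using \<open>0 < ?B\<close> by linarith
    have "t \<le> K * (?B + 1) ^ d" using t(1) Kd le_trans by blast
    also have "\<dots> \<le> K * (2 * ?B) ^ d" by (intro mult_le_mono2 power_mono[OF B1]) simp
    also have "\<dots> = K * (2 ^ d * (?n ^ (9 * d) * ?t ^ (9 * d)))"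
      by (simp only: power_mult_distrib power_mult)
    also have "\<dots> = K * 2 ^ d * ?t ^ (9 * d) * ?n ^ (9 * d)"
    proof -
      have "K * (x * (y * z)) = K * x * z * y" for x y z :: nat by simp
      then show ?thesis .
    qed
    also have "\<dots> \<le> ?f r * ?n ^ (9 * d)"
      using tower_absorbs[of "K * 2 ^ d" "r + 2" "9 * d"] by (intro mult_le_mono1) (simp add: add_ac)
    finally have "t \<le> ?f r * ?n ^ (9 * d)" .
    then show "\<exists>t. t \<le> ?f r * card (pverts (network I)) ^ (9 * d) \<and>
        run solver (encode vs I r) t (of_bool (\<exists>R A. routing I R A \<and> routing_weight I R \<le> r))"
      unfolding n using t(2) by (intro exI[of _ t] conjI)
  qed
qed

end
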